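(* Let $F:\mathbb{R}^2\to\mathbb{R}^2$ be a differentiable local homeomorphism. If $F$ satisfies the $W$-condition, then $F$ is injective and $F(\mathbb{R}^2)$ is convex.
   Context: Differentiable means (Fréchet) differentiable at every point, not necessarily $C^1$. For $\theta\in\mathbb{R}$ let $R_\theta=\begin{pmatrix}\cos\theta&-\sin\theta\\ \sin\theta&\cos\theta\end{pmatrix}$ and $F_\theta=R_\theta\circ F\circ R_{-\theta}$. Let $\mathbb{R}^+=(0,+\infty)$ and let $\mathcal{P}$ be the set of all nondecreasing functions $P:\mathbb{R}^+\to\mathbb{R}^+$ such that for every $M>0$ there exists a large constant $N$ (depending on $M$ and $P$) with $\int_2^N\frac{1}{P(x)}\,dx>M$. $W$-condition: $F$ satisfies the $W$-condition if there is a function $P\in\mathcal{P}$ such that, for each $\theta\in\mathbb{R}$, there does not exist a sequence $(x_k,y_k)\in\mathbb{R}^2$ with $x_k\to+\infty$ such that $F_\theta(x_k,y_k)\to T$ for some $T\in\mathbb{R}^2$ and $DF_\theta(x_k,y_k)$ has a real eigenvalue $\lambda_k$ satisfying $\lambda_kP(x_k)\to 0$. *)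

theory Defs
  imports "HOL-Analysis.Analysis"
begin

definition local_homeomorphism :: "('a::topological_space \<Rightarrow> 'b::topological_space) \<Rightarrow> bool" where
  "local_homeomorphism f \<longleftrightarrow>
    (\<forall>x. \<exists>U. open U \<and> x \<in> U \<and> open (f ` U) \<and> (\<exists>g. homeomorphism U (f ` U) f g))"

definition rot :: "real \<Rightarrow> real^2^2" where
  "rot \<theta> = vector [vector [cos \<theta>, - sin \<theta>], vector [sin \<theta>, cos \<theta>]]"

definition conj_rot :: "real \<Rightarrow> (real^2 \<Rightarrow> real^2) \<Rightarrow> real^2 \<Rightarrow> real^2" where
  "conj_rot \<theta> F = (\<lambda>p. rot \<theta> *v F (rot (- \<theta>) *v p))"

definition real_eigenvalue :: "('a::real_vector \<Rightarrow> 'a) \<Rightarrow> real \<Rightarrow> bool" where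
  "real_eigenvalue A c \<longleftrightarrow> (\<exists>v. v \<noteq> 0 \<and> A v = c *\<^sub>R v)"

text \<open>Elements of \<open>slow_functions\<close> are total functions on the reals, but only their
  restriction to \<open>{0<..}\<close> is constrained; values at nonpositive arguments are irrelevant,
  also in \<open>W_condition\<close>, where the argument of \<open>P\<close> tends to infinity.\<close>

definition slow_functions :: "(real \<Rightarrow> real) set" where
  "slow_functions = {P. (\<forall>x>0. P x > 0) \<and> mono_on {0<..} P \<and>
     (\<forall>M>0. \<exists>N\<ge>2. integral {2..N} (\<lambda>x. 1 / P x) > M)}"

text \<open>Monotonicity makes the integral above a genuine one, not the default value 0 of
  \<open>integral\<close> for nonintegrable functions.\<close>

lemma slow_functions_integrable:
  assumes "P \<in> slow_functions"
  shows "(\<lambda>x. 1 / P x) integrable_on {2..N}"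
proof -
  have "(\<lambda>x. - (1 / P x)) integrable_on {2..N}"
  proof (rule integrable_on_mono_on)
    show "mono_on {2..N} (\<lambda>x. - (1 / P x))"
      using assms by (auto simp: slow_functions_def mono_on_def intro!: divide_left_mono)
  qed
  then show ?thesis
    using integrable_neg by fastforce
qed

definition W_condition :: "(real^2 \<Rightarrow> real^2) \<Rightarrow> bool" where
  "W_condition F \<longleftrightarrow>
    (\<exists>P\<in>slow_functions. \<forall>\<theta>. \<not> (\<exists>(x :: nat \<Rightarrow> real) (y :: nat \<Rightarrow> real) (l :: nat \<Rightarrow> real) T.
        filterlim x at_top sequentially \<and>
        (\<lambda>k. conj_rot \<theta> F (vector [x k, y k])) \<longlonglongrightarrow> T \<and>
        (\<forall>k. real_eigenvalue (frechet_derivative (conj_rot \<theta> F) (at (vector [x k, y k]))) (l k)) \<and>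
        (\<lambda>k. l k * P (x k)) \<longlonglongrightarrow> 0))"

end

theory Submission
  imports Defs "HOL-Complex_Analysis.Complex_Analysis"
begin

text \<open>The plane is identified with the complex numbers. From a point \<open>p\<close> one lifts the identity through
  \<open>F\<close> along straight segments issuing from \<open>F p\<close>. The end points of the segments that lift form an
  open set \<open>lift_dom p\<close>, star-shaped about \<open>F p\<close>, and the lifts define a section \<open>branch p\<close> of \<open>F\<close> on
  it. If every branch is onto, then \<open>F\<close> is injective and its range, being equal to every
  \<open>lift_dom p\<close>, is star-shaped about each of its points, that is, convex.

  If some branch is not onto, it lives on a triangle minus one side, and on that side it has a point
  of escape to infinity, while it extends beyond the side near both of its ends. After a rotation
  of the plane this gives an \<^emph>\<open>escape box\<close>: a box, bounded on the left by a line
  \<open>Re w + \<eta> * Im w = c\<close>, on which a branch is defined, with an obstacle on that line and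
  none at its two corners. Everything else is the proof that escape boxes do not exist.

  The \<open>W\<close>-condition is used twice. The first use (\<open>escape_box_bounded\<close>) shows that the function
  \<open>slant \<eta> z = Re z + \<eta> * Im z\<close>, constant on the lines parallel to the left side, is bounded on
  the image of the branch. Otherwise let \<open>M a\<close> be the largest slant of a point of the
  box whose lift has slant \<open>a\<close>; at the maximum the slant is a left eigenvector of the
  derivative of \<open>F\<close>, and the eigenvalue is a one-sided slope of \<open>M\<close>. By the \<open>W\<close>-condition the slopes are
  at least \<open>c / P a\<close> in absolute value, and a bounded function cannot have such slopes, because the
  integral of \<open>1 / P\<close> diverges.

  An escape box can be tilted: for all slopes near \<open>\<eta>\<close> the line that supports the obstacles bounds
  an escape box again. By Baire's theorem the bound for the branch is uniform for an interval of
  slopes, and all but countably many slopes have just one supporting obstacle. At such a tip \<open>e0\<close>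
  with slope \<open>\<eta>0\<close> the branch runs off to infinity in a strip about the line \<open>slant \<eta>0 = 0\<close>, in one of
  its two directions. The strips that belong to the neighbouring slopes diverge from each other,
  so the images of the tilted boxes together fill a half strip \<open>\<bar>slant \<eta>0 q\<bar> \<le> A\<close>, \<open>\<epsilon> * Im q \<ge> Y\<close> of any
  width (\<open>half_strip_covered\<close>). The only thing that could prevent this is a gap between two obstacles
  on a common supporting line. The branch maps a gap to an arc with both ends at infinity in a
  strip, and the Jordan curve theorem confines the image of what lies below the gap to the same
  strip; the bound that belongs to a slightly tilted box then contradicts the escape at the end of
  the gap (\<open>no_gap\<close>).

  On the half strip \<open>F\<close> is injective and tends to \<open>e0\<close> at infinity. The left and the right edge lie
  over opposite sides of \<open>e0\<close>, and no point lies over the ray that leaves \<open>e0\<close> on the side of the obstacles. A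
  winding number shows that such a map reverses the orientation (\<open>half_strip_orientation\<close>). Hence
  its derivative has nonpositive determinant and two real eigenvalues. Now the \<open>W\<close>-condition is used
  in the direction of decreasing slant: on a substrip \<open>- 2 * a \<le> slant \<eta>0 q \<le> - a\<close> the
  eigenvalues are bounded away from zero at all heights, so \<open>F\<close> expands the area by a fixed
  factor there, although it maps far discs of a fixed radius into arbitrarily small
  neighbourhoods of \<open>e0\<close>. This contradiction (\<open>tip_contradiction\<close>) ends the proof.\<close>

section \<open>Branches of the inverse of a local homeomorphism\<close>

definition section_on :: "(complex \<Rightarrow> complex) \<Rightarrow> complex set \<Rightarrow> (complex \<Rightarrow> complex) \<Rightarrow> bool" where
  "section_on F S \<sigma> \<longleftrightarrow> continuous_on S \<sigma> \<and> (\<forall>w\<in>S. F (\<sigma> w) = w)"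

lemma section_on_subset: "section_on F S \<sigma> \<Longrightarrow> T \<subseteq> S \<Longrightarrow> section_on F T \<sigma>"
  unfolding section_on_def using continuous_on_subset by blast

lemma section_on_cong: "section_on F S \<sigma> \<Longrightarrow> (\<And>w. w \<in> S \<Longrightarrow> \<tau> w = \<sigma> w) \<Longrightarrow> section_on F S \<tau>"
  unfolding section_on_def using continuous_on_cong by metis

lemma section_on_locally:
  assumes "\<And>w. w \<in> S \<Longrightarrow> \<exists>T. open T \<and> w \<in> T \<and> section_on F (S \<inter> T) \<sigma>"
  shows "section_on F S \<sigma>"
  unfolding section_on_def
proof
  obtain T where T: "\<And>w. w \<in> S \<Longrightarrow> open (T w) \<and> w \<in> T w \<and> section_on F (S \<inter> T w) \<sigma>"
    using assms by metis
  show "continuous_on S \<sigma>"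
    unfolding continuous_on_eq_continuous_within
  proof
    fix w assume w: "w \<in> S"
    have "continuous (at w within S \<inter> T w) \<sigma>"
      using T[OF w] w unfolding section_on_def continuous_on_eq_continuous_within by auto
    moreover have "at w within S = at w within S \<inter> T w"
      by (rule at_within_nhd[of w "T w"]) (use T[OF w] in auto)
    ultimately show "continuous (at w within S) \<sigma>" by simp
  qed
  show "\<forall>w\<in>S. F (\<sigma> w) = w" using assms unfolding section_on_def by blast
qed

locale loc_homeo =
  fixes F :: "complex \<Rightarrow> complex"
  assumes cont_F: "continuous_on UNIV F"
    and loc: "\<And>p. \<exists>U g. open U \<and> p \<in> U \<and> open (F ` U) \<and> homeomorphism U (F ` U) F g"
begin

lemma local_section:
  obtains r g U where "r > 0" "section_on F (ball (F p) r) g" "g (F p) = p" "open U" "p \<in> U"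
    "\<And>q. q \<in> U \<Longrightarrow> F q \<in> ball (F p) r \<and> g (F q) = q"
    "\<And>w. w \<in> ball (F p) r \<Longrightarrow> g w \<in> U"
proof -
  obtain U g where U: "open U" "p \<in> U" "open (F ` U)" "homeomorphism U (F ` U) F g"
    using loc by blast
  then obtain r where r: "r > 0" "ball (F p) r \<subseteq> F ` U"
    by (meson imageI openE)
  have "section_on F (ball (F p) r) g"
    using U(4) r(2) unfolding section_on_def homeomorphism_def
    by (meson continuous_on_subset subsetD)
  moreover have "open (U \<inter> F -` ball (F p) r)"
    using U(1) cont_F by (simp add: continuous_on_open_vimage open_Int)
  moreover have "g (F q) = q" if "q \<in> U" for q
    using U(4) that unfolding homeomorphism_def by blast
  moreover have "g w \<in> U \<inter> F -` ball (F p) r" if "w \<in> ball (F p) r" for w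
    using U(4) that r unfolding homeomorphism_def by (metis IntI image_eqI subsetD vimageI)
  ultimately show ?thesis
    using that[of r g "U \<inter> F -` ball (F p) r"] r(1) U(2) by auto
qed

text \<open>The set of agreement is closed because the sections are continuous, and open because \<open>F\<close> is locally
  injective.\<close>

lemma section_unique:
  assumes S: "connected S" and s: "section_on F S \<sigma>" and t: "section_on F S \<tau>"
    and w0: "w0 \<in> S" "\<sigma> w0 = \<tau> w0" and w: "w \<in> S"
  shows "\<sigma> w = \<tau> w"
proof -
  let ?E = "{w \<in> S. \<sigma> w - \<tau> w = 0}"
  have cs: "continuous_on S \<sigma>" and ct: "continuous_on S \<tau>"
    using s t unfolding section_on_def by auto
  have cl: "closedin (top_of_set S) ?E"
    by (intro continuous_closedin_preimage_constant continuous_intros cs ct)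
  have op: "openin (top_of_set S) ?E"
  proof (subst openin_subopen, intro ballI)
    fix v assume v: "v \<in> ?E"
    then have vS: "v \<in> S" "\<sigma> v = \<tau> v" by auto
    obtain r g U where U: "open U" "\<sigma> v \<in> U" "\<And>q. q \<in> U \<Longrightarrow> g (F q) = q"
      by (rule local_section[of "\<sigma> v"]) metis
    have "openin (top_of_set S) (S \<inter> \<sigma> -` U \<inter> (S \<inter> \<tau> -` U))"
      by (intro openin_Int continuous_openin_preimage_gen cs ct U(1))
    moreover have "S \<inter> \<sigma> -` U \<inter> (S \<inter> \<tau> -` U) \<subseteq> ?E"
    proof
      fix x assume x: "x \<in> S \<inter> \<sigma> -` U \<inter> (S \<inter> \<tau> -` U)"
      then have "F (\<sigma> x) = x" "F (\<tau> x) = x" using s t unfolding section_on_def by auto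
      then show "x \<in> ?E" using x U(3)[of "\<sigma> x"] U(3)[of "\<tau> x"] by auto
    qed
    ultimately show "\<exists>T. openin (top_of_set S) T \<and> v \<in> T \<and> T \<subseteq> ?E"
      using vS U(2) by (intro exI[of _ "S \<inter> \<sigma> -` U \<inter> (S \<inter> \<tau> -` U)"]) auto
  qed
  have "?E = {} \<or> ?E = S" by (rule connected_clopen[THEN iffD1, OF S, rule_format]) (intro conjI op cl)
  then show ?thesis using w0 w by auto
qed

text \<open>Local inverses at the points of \<open>K\<close> live on balls of a common radius \<open>e\<close> by compactness. If two such
  balls meet, the midpoint of their centres lies in \<open>K\<close> and in both balls; the two
  inverses agree there, hence on the whole intersection. Convexity of \<open>K\<close> is what makes the
  pieces fit together.\<close>

lemma section_nbhd:
  assumes K: "compact K" "convex K" and s: "section_on F K \<tau>"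
  obtains e \<tau>' where "e > 0" "section_on F {v. \<exists>x\<in>K. dist x v < e} \<tau>'" "\<And>x. x \<in> K \<Longrightarrow> \<tau>' x = \<tau> x"
proof -
  have "\<exists>r g. r > 0 \<and> section_on F (ball w r) g \<and> (\<forall>v\<in>K \<inter> ball w r. \<tau> v = g v)" if w: "w \<in> K" for w
  proof -
    have Fw: "F (\<tau> w) = w" using s w unfolding section_on_def by auto
    obtain r g U where g: "r > 0" "section_on F (ball w r) g" "g w = \<tau> w"
      using local_section[of "\<tau> w"] unfolding Fw by metis
    have "\<tau> v = g v" if v: "v \<in> K \<inter> ball w r" for v
    proof (rule section_unique[where S="K \<inter> ball w r" and ?w0.0=w and \<sigma>=\<tau> and \<tau>=g])
      show "connected (K \<inter> ball w r)" using K by (simp add: convex_Int convex_connected)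
      show "section_on F (K \<inter> ball w r) \<tau>" "section_on F (K \<inter> ball w r) g"
        using s g(2) section_on_subset by blast+
    qed (use v w g in auto)
    then show ?thesis using g by blast
  qed
  then obtain r g where rg: "\<And>w. w \<in> K \<Longrightarrow> r w > 0 \<and> section_on F (ball w (r w)) (g w) \<and>
      (\<forall>v\<in>K \<inter> ball w (r w). \<tau> v = g w v)" by metis
  have cov: "K \<subseteq> \<Union>((\<lambda>w. ball w (r w)) ` K)"
  proof
    fix x assume "x \<in> K"
    then show "x \<in> \<Union>((\<lambda>w. ball w (r w)) ` K)" using rg[of x] by (intro UN_I[of x]) auto
  qed
  obtain e where e: "0 < e" "\<And>x. x \<in> K \<Longrightarrow> \<exists>G\<in>(\<lambda>w. ball w (r w)) ` K. ball x e \<subseteq> G"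
    by (rule Heine_Borel_lemma[OF K(1) cov]) auto
  have "\<exists>h. section_on F (ball x e) h \<and> (\<forall>v\<in>K \<inter> ball x e. \<tau> v = h v)" if xK: "x \<in> K" for x
  proof -
    obtain w where w: "w \<in> K" "ball x e \<subseteq> ball w (r w)" using e(2)[OF xK] by auto
    then have "section_on F (ball x e) (g w)" using rg[of w] section_on_subset by blast
    moreover have "\<forall>v\<in>K \<inter> ball x e. \<tau> v = g w v" using rg[OF w(1)] w(2) by blast
    ultimately show ?thesis by blast
  qed
  then obtain h where h: "\<And>x. x \<in> K \<Longrightarrow> section_on F (ball x e) (h x) \<and> (\<forall>v\<in>K \<inter> ball x e. \<tau> v = h x v)"
    by metis
  have agree: "h x1 v = h x2 v" if x: "x1 \<in> K" "x2 \<in> K" and v: "v \<in> ball x1 e" "v \<in> ball x2 e" for x1 x2 v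
  proof (rule section_unique[where S="ball x1 e \<inter> ball x2 e" and ?w0.0="midpoint x1 x2" and \<sigma>="h x1" and \<tau>="h x2"])
    have m: "midpoint x1 x2 \<in> K" using K x by (meson closed_segment_subset midpoint_in_closed_segment subsetD)
    have d: "dist x1 x2 < 2 * e" using v dist_triangle2[of x1 x2 v] by (auto simp: dist_commute)
    then have mb: "midpoint x1 x2 \<in> ball x1 e" "midpoint x1 x2 \<in> ball x2 e"
      by (auto simp: dist_midpoint)
    show "midpoint x1 x2 \<in> ball x1 e \<inter> ball x2 e" using mb by auto
    show "h x1 (midpoint x1 x2) = h x2 (midpoint x1 x2)" using h x m mb by (metis IntI)
    show "connected (ball x1 e \<inter> ball x2 e)" by (simp add: convex_Int convex_connected)
    show "section_on F (ball x1 e \<inter> ball x2 e) (h x1)" "section_on F (ball x1 e \<inter> ball x2 e) (h x2)"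
      using h x section_on_subset by blast+
  qed (use v in auto)
  define \<tau>' where "\<tau>' v = h (SOME x. x \<in> K \<and> v \<in> ball x e) v" for v
  have t: "\<tau>' v = h x v" if "x \<in> K" "v \<in> ball x e" for x v
  proof -
    have "(SOME x. x \<in> K \<and> v \<in> ball x e) \<in> K \<and> v \<in> ball (SOME x. x \<in> K \<and> v \<in> ball x e) e"
      by (rule someI[of _ x]) (use that in auto)
    then show ?thesis unfolding \<tau>'_def using agree that by blast
  qed
  have "section_on F {v. \<exists>x\<in>K. dist x v < e} \<tau>'"
  proof (rule section_on_locally)
    fix w assume "w \<in> {v. \<exists>x\<in>K. dist x v < e}"
    then obtain x where x: "x \<in> K" "w \<in> ball x e" by auto
    have "section_on F (ball x e) \<tau>'" using h x(1) t by (meson section_on_cong)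
    then show "\<exists>T. open T \<and> w \<in> T \<and> section_on F ({v. \<exists>x\<in>K. dist x v < e} \<inter> T) \<tau>'"
      using x by (intro exI[of _ "ball x e"]) (auto intro: section_on_subset)
  qed
  moreover have "\<tau>' x = \<tau> x" if "x \<in> K" for x using t[of x x] h[OF that] that e(1) by auto
  ultimately show ?thesis using that e(1) by blast
qed

definition lift_dom :: "complex \<Rightarrow> complex set" where
  "lift_dom p = {w. \<exists>\<tau>. section_on F (closed_segment (F p) w) \<tau> \<and> \<tau> (F p) = p}"

text \<open>Two lifts of a segment from the same initial value agree by \<open>section_unique\<close>, so the choice is
  immaterial.\<close>

definition branch :: "complex \<Rightarrow> complex \<Rightarrow> complex" where
  "branch p w = (SOME \<tau>. section_on F (closed_segment (F p) w) \<tau> \<and> \<tau> (F p) = p) w"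

lemma star_section_imp_lift_dom:
  assumes s: "section_on F S \<tau>" and w: "closed_segment (F p) w \<subseteq> S" and p: "\<tau> (F p) = p"
  shows "w \<in> lift_dom p" "branch p w = \<tau> w"
proof -
  have s': "section_on F (closed_segment (F p) w) \<tau>" using s w section_on_subset by blast
  then show "w \<in> lift_dom p" unfolding lift_dom_def using p by auto
  define \<rho> where "\<rho> = (SOME \<tau>. section_on F (closed_segment (F p) w) \<tau> \<and> \<tau> (F p) = p)"
  have r: "section_on F (closed_segment (F p) w) \<rho>" "\<rho> (F p) = p"
    using someI[of "\<lambda>\<tau>. section_on F (closed_segment (F p) w) \<tau> \<and> \<tau> (F p) = p" \<tau>] s' p
    unfolding \<rho>_def by auto
  show "branch p w = \<tau> w" unfolding branch_def \<rho>_def[symmetric]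
    by (rule section_unique[OF _ r(1) s', where ?w0.0="F p"]) (use r p in auto)
qed

lemma lift_dom_base: "F p \<in> lift_dom p" "branch p (F p) = p"
  using star_section_imp_lift_dom[of "{F p}" "\<lambda>_. p" p "F p"] by (auto simp: section_on_def)

text \<open>A neighbourhood of a segment is convex, so the section on it given by \<open>section_nbhd\<close> is the lift along
  the segments inside it.\<close>

lemma lift_dom_section_nbhd:
  assumes "w \<in> lift_dom p"
  obtains e where "e > 0" "{v. \<exists>x\<in>closed_segment (F p) w. dist x v < e} \<subseteq> lift_dom p"
    "section_on F {v. \<exists>x\<in>closed_segment (F p) w. dist x v < e} (branch p)"
proof -
  obtain \<tau> where t: "section_on F (closed_segment (F p) w) \<tau>" "\<tau> (F p) = p"
    using assms unfolding lift_dom_def by auto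
  obtain e \<tau>' where e: "e > 0" "section_on F {v. \<exists>x\<in>closed_segment (F p) w. dist x v < e} \<tau>'"
    "\<And>x. x \<in> closed_segment (F p) w \<Longrightarrow> \<tau>' x = \<tau> x"
    by (rule section_nbhd[OF _ _ t(1)]) auto
  define N where "N = {v. \<exists>x\<in>closed_segment (F p) w. dist x v < e}"
  have N: "N = (\<Union>x\<in>closed_segment (F p) w. \<Union>y\<in>ball 0 e. {x + y})"
  proof (intro set_eqI iffI)
    fix v assume "v \<in> N"
    then obtain x where x: "x \<in> closed_segment (F p) w" "dist x v < e" unfolding N_def by auto
    then show "v \<in> (\<Union>x\<in>closed_segment (F p) w. \<Union>y\<in>ball 0 e. {x + y})"
      by (intro UN_I[of x] UN_I[of "v - x"]) (auto simp: dist_norm norm_minus_commute)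
  next
    fix v assume "v \<in> (\<Union>x\<in>closed_segment (F p) w. \<Union>y\<in>ball 0 e. {x + y})"
    then obtain x y where "x \<in> closed_segment (F p) w" "y \<in> ball 0 e" "v = x + y" by auto
    then show "v \<in> N" unfolding N_def by (auto intro!: bexI[of _ x] simp: dist_norm)
  qed
  have "convex N" unfolding N by (rule convex_sums) auto
  moreover have "F p \<in> N" unfolding N_def using e(1) by (auto intro!: bexI[of _ "F p"])
  ultimately have c: "closed_segment (F p) v \<subseteq> N" if "v \<in> N" for v
    using that by (simp add: closed_segment_subset)
  have tp: "\<tau>' (F p) = p" using e(3) t(2) by simp
  have "v \<in> lift_dom p" "branch p v = \<tau>' v" if "v \<in> N" for v
    using star_section_imp_lift_dom[OF e(2)[folded N_def] c[OF that] tp] by auto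
  then show ?thesis using that[OF e(1)] e(2) section_on_cong unfolding N_def[symmetric]
    by (metis subsetI)
qed

lemma open_lift_dom: "open (lift_dom p)"
  unfolding open_contains_ball
proof
  fix w assume "w \<in> lift_dom p"
  then obtain e where "e > 0" "{v. \<exists>x\<in>closed_segment (F p) w. dist x v < e} \<subseteq> lift_dom p"
    by (rule lift_dom_section_nbhd)
  moreover have "ball w e \<subseteq> {v. \<exists>x\<in>closed_segment (F p) w. dist x v < e}" by auto
  ultimately show "\<exists>e>0. ball w e \<subseteq> lift_dom p" by blast
qed

lemma section_lift_dom: "section_on F (lift_dom p) (branch p)"
proof (rule section_on_locally)
  fix w assume "w \<in> lift_dom p"
  then obtain e where "e > 0" "section_on F {v. \<exists>x\<in>closed_segment (F p) w. dist x v < e} (branch p)"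
    by (rule lift_dom_section_nbhd)
  then show "\<exists>T. open T \<and> w \<in> T \<and> section_on F (lift_dom p \<inter> T) (branch p)"
    by (intro exI[of _ "ball w e"]) (auto elim!: section_on_subset)
qed

lemma F_branch [simp]: "w \<in> lift_dom p \<Longrightarrow> F (branch p w) = w"
  using section_lift_dom unfolding section_on_def by auto

lemma continuous_on_branch: "S \<subseteq> lift_dom p \<Longrightarrow> continuous_on S (branch p)"
  using section_lift_dom continuous_on_subset unfolding section_on_def by blast

lemma isCont_branch: "w \<in> lift_dom p \<Longrightarrow> isCont (branch p) w"
  using continuous_on_branch[of "lift_dom p" p] open_lift_dom continuous_on_eq_continuous_at by blast

lemma lift_dom_starlike:
  assumes "w \<in> lift_dom p" shows "closed_segment (F p) w \<subseteq> lift_dom p"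
proof
  fix x assume x: "x \<in> closed_segment (F p) w"
  obtain e where "e > 0" "{v. \<exists>x\<in>closed_segment (F p) w. dist x v < e} \<subseteq> lift_dom p"
    by (rule lift_dom_section_nbhd[OF assms])
  then show "x \<in> lift_dom p" using x by (metis (mono_tags, lifting) dist_self mem_Collect_eq subsetD)
qed

lemma local_section_at_branch:
  assumes "w \<in> lift_dom p"
  obtains V where "open V" "branch p w \<in> V" "\<And>q. q \<in> V \<Longrightarrow> F q \<in> lift_dom p \<and> branch p (F q) = q"
proof -
  obtain r g U where g: "r > 0" "section_on F (ball w r) g" "g w = branch p w" "open U" "branch p w \<in> U"
    "\<And>q. q \<in> U \<Longrightarrow> F q \<in> ball w r \<and> g (F q) = q"
    using local_section[of "branch p w"] assms by auto metis
  obtain e where e: "e > 0" "ball w e \<subseteq> lift_dom p" using assms open_lift_dom open_contains_ball by meson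
  define m where "m = min r e"
  have m: "m > 0" "ball w m \<subseteq> lift_dom p" "ball w m \<subseteq> ball w r" using e g(1) unfolding m_def by auto
  have ag: "branch p v = g v" if "v \<in> ball w m" for v
    by (rule section_unique[where S="ball w m" and ?w0.0=w and \<sigma>="branch p" and \<tau>=g])
       (use m g that in \<open>auto intro: section_on_subset[OF section_lift_dom] section_on_subset[OF g(2)]\<close>)
  have "open (U \<inter> F -` ball w m)" using g(4) cont_F by (simp add: continuous_on_open_vimage open_Int)
  moreover have "branch p w \<in> U \<inter> F -` ball w m" using g(5) assms m(1) by auto
  moreover have "F q \<in> lift_dom p \<and> branch p (F q) = q" if "q \<in> U \<inter> F -` ball w m" for q
    using that g(6)[of q] ag[of "F q"] m by auto
  ultimately show ?thesis using that by blast
qed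

lemma open_branch_image:
  assumes "open V" "V \<subseteq> lift_dom p" shows "open (branch p ` V)"
proof (subst open_subopen, intro ballI)
  fix q assume "q \<in> branch p ` V"
  then obtain w where w: "w \<in> V" "q = branch p w" by auto
  obtain O' where O': "open O'" "branch p w \<in> O'" "\<And>q. q \<in> O' \<Longrightarrow> F q \<in> lift_dom p \<and> branch p (F q) = q"
    by (rule local_section_at_branch[of w p]) (use w assms in auto)
  have "open (O' \<inter> F -` V)" using O'(1) assms(1) cont_F by (simp add: continuous_on_open_vimage open_Int)
  moreover have "O' \<inter> F -` V \<subseteq> branch p ` V" 
  proof
    fix x assume x: "x \<in> O' \<inter> F -` V"
    then have "x = branch p (F x)" using O'(3)[of x] by auto
    then show "x \<in> branch p ` V" using x by blast
  qed
  moreover have "q \<in> O' \<inter> F -` V" using w O'(2) assms(2) by auto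
  ultimately show "\<exists>T. open T \<and> q \<in> T \<and> T \<subseteq> branch p ` V" by blast
qed

lemma inj_on_branch: "inj_on (branch p) (lift_dom p)"
  by (metis F_branch inj_onI)

text \<open>The only way to leave \<open>lift_dom p\<close> is to escape to infinity: a local inverse at a boundary
  point \<open>w\<close> that matches the branch at a single point of \<open>S\<close> already continues the branch to \<open>w\<close>.\<close>

lemma lift_dom_extend:
  assumes S: "convex S" "S \<subseteq> lift_dom p" "open_segment (F p) w \<subseteq> S"
    and g: "r > 0" "section_on F (ball w r) g"
    and v: "v \<in> S \<inter> ball w r" "branch p v = g v" and p: "F p \<in> S"
  shows "w \<in> lift_dom p" "branch p w = g w"
proof -
  define \<tau> where "\<tau> x = (if x \<in> ball w r then g x else branch p x)" for x
  have ag: "branch p x = g x" if "x \<in> S \<inter> ball w r" for x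
  proof (rule section_unique[where S="S \<inter> ball w r" and ?w0.0=v and \<sigma>="branch p" and \<tau>=g])
    show "connected (S \<inter> ball w r)" using S by (simp add: convex_Int convex_connected)
    show "section_on F (S \<inter> ball w r) (branch p)"
      by (rule section_on_subset[OF section_lift_dom]) (use S(2) in auto)
    show "section_on F (S \<inter> ball w r) g"
      by (rule section_on_subset[OF g(2)]) auto
  qed (use v that in auto)
  have tS: "\<tau> x = branch p x" if "x \<in> S" for x using ag that unfolding \<tau>_def by auto
  have sub: "closed_segment (F p) w - {w} \<subseteq> S" using S(3) p by (auto simp: closed_segment_eq_open)
  have "section_on F (closed_segment (F p) w) \<tau>"
  proof (rule section_on_locally)
    fix x assume x: "x \<in> closed_segment (F p) w"
    show "\<exists>T. open T \<and> x \<in> T \<and> section_on F (closed_segment (F p) w \<inter> T) \<tau>"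
    proof (cases "x = w")
      case True
      have "section_on F (ball w r) \<tau>" using g(2) unfolding \<tau>_def by (rule section_on_cong) auto
      then show ?thesis using True g(1)
        by (intro exI[of _ "ball w r"]) (auto elim!: section_on_subset)
    next
      case False
      have "section_on F S \<tau>" using section_on_subset[OF section_lift_dom S(2)] tS by (rule section_on_cong)
      then have "section_on F (closed_segment (F p) w \<inter> - {w}) \<tau>"
        by (rule section_on_subset) (use sub in auto)
      then show ?thesis using False by (intro exI[of _ "- {w}"]) auto
    qed
  qed
  from star_section_imp_lift_dom[OF this order_refl] tS[OF p] lift_dom_base
  show "w \<in> lift_dom p" "branch p w = g w" using g(1) unfolding \<tau>_def by auto
qed

text \<open>If the branch has a finite limit along some sequence tending to \<open>w\<close>, the local inverse at the limit
  continues it.\<close>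

lemma lift_dom_extend_lim:
  assumes S: "convex S" "S \<subseteq> lift_dom p" "open_segment (F p) w \<subseteq> S" "F p \<in> S"
    and wn: "\<And>n::nat. wn n \<in> S" "wn \<longlonglongrightarrow> w" and q: "(\<lambda>n. branch p (wn n)) \<longlonglongrightarrow> q"
  shows "w \<in> lift_dom p" "branch p w = q"
proof -
  have "(\<lambda>n. F (branch p (wn n))) \<longlonglongrightarrow> F q"
    using cont_F q by (metis isCont_tendsto_compose UNIV_I continuous_on_eq_continuous_at open_UNIV)
  moreover have Fw: "F (branch p (wn n)) = wn n" for n using S(2) wn(1)[of n] by auto
  ultimately have Fq: "F q = w" using wn(2) LIMSEQ_unique by fastforce
  obtain r g U where g: "r > 0" "section_on F (ball w r) g" "g w = q" "open U" "q \<in> U"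
    "\<And>q. q \<in> U \<Longrightarrow> F q \<in> ball w r \<and> g (F q) = q"
    using local_section[of q] unfolding Fq by metis
  have "eventually (\<lambda>n. branch p (wn n) \<in> U) sequentially"
    using q g(4,5) by (simp add: tendsto_def)
  then obtain n where n: "branch p (wn n) \<in> U" by (meson eventually_False_sequentially eventually_mono)
  have v: "wn n \<in> S \<inter> ball w r" "branch p (wn n) = g (wn n)" using g(6)[OF n] Fw wn(1) by auto
  show "w \<in> lift_dom p" "branch p w = q" using lift_dom_extend[OF S(1-3) g(1,2) v S(4)] g(3) by auto
qed

lemma lift_dom_rebase:
  assumes S: "convex S" "S \<subseteq> lift_dom p" "F p' \<in> S" "p' = branch p (F p')" and w: "w \<in> S"
  shows "w \<in> lift_dom p'" "branch p' w = branch p w"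
  using star_section_imp_lift_dom[of S "branch p" p' w] section_on_subset[OF section_lift_dom S(2)] S w
  by (auto simp: closed_segment_subset)

end

section \<open>Slanted boxes and their obstacles\<close>

text \<open>The lines \<open>slant \<eta> w = c\<close> are the left sides of the boxes below. Their normal is \<open>1 + \<i> * \<eta>\<close>, and
  \<open>\<eta> = 0\<close> is the vertical line.\<close>

definition slant :: "real \<Rightarrow> complex \<Rightarrow> real" where "slant \<eta> z = Re z + \<eta> * Im z"

lemma slant_add: "slant \<eta> (a + b) = slant \<eta> a + slant \<eta> b"
  and slant_diff: "slant \<eta> (a - b) = slant \<eta> a - slant \<eta> b"
  and slant_scaleR: "slant \<eta> (t *\<^sub>R a) = t * slant \<eta> a"
  by (auto simp: slant_def algebra_simps)

lemma slant_change: "slant \<eta> z = slant \<eta>' z + (\<eta> - \<eta>') * Im z"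
  by (simp add: slant_def algebra_simps)

lemma continuous_on_slant [continuous_intros]:
  "continuous_on S f \<Longrightarrow> continuous_on S (\<lambda>x. slant \<eta> (f x))"
  unfolding slant_def by (intro continuous_intros)

lemma tendsto_slant: "(f \<longlongrightarrow> l) G \<Longrightarrow> (g \<longlongrightarrow> \<eta>) G \<Longrightarrow> ((\<lambda>x. slant (g x) (f x)) \<longlongrightarrow> slant \<eta> l) G"
  unfolding slant_def by (intro tendsto_intros)

lemma slant_abs_le: "\<bar>slant \<eta> z\<bar> \<le> (1 + \<bar>\<eta>\<bar>) * cmod z"
proof -
  have "\<bar>slant \<eta> z\<bar> \<le> \<bar>Re z\<bar> + \<bar>\<eta>\<bar> * \<bar>Im z\<bar>" unfolding slant_def by (metis abs_mult abs_triangle_ineq)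
  also have "\<dots> \<le> cmod z + \<bar>\<eta>\<bar> * cmod z"
    by (intro add_mono mult_left_mono abs_Re_le_cmod abs_Im_le_cmod) auto
  finally show ?thesis by (simp add: algebra_simps)
qed

lemma bounded_slant_Im: "cmod z \<le> \<bar>slant \<eta> z\<bar> + (1 + \<bar>\<eta>\<bar>) * \<bar>Im z\<bar>"
proof -
  have "cmod z \<le> \<bar>Re z\<bar> + \<bar>Im z\<bar>" by (rule cmod_le)
  moreover have "\<bar>Re z\<bar> \<le> \<bar>slant \<eta> z\<bar> + \<bar>\<eta>\<bar> * \<bar>Im z\<bar>"
    unfolding slant_def by (metis (no_types, opaque_lifting) abs_mult abs_triangle_ineq4 add_diff_cancel_right')
  ultimately show ?thesis by (simp add: algebra_simps)
qed

text \<open>The strip is unbounded to the left, where a slanted line will cut it off. The other three sides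
  do not depend on the slope, so the boxes of different slopes are relatively open in one strip.\<close>

definition left_strip :: "real \<Rightarrow> real \<Rightarrow> real \<Rightarrow> complex set" where
  "left_strip b0 b1 d = {w. b0 \<le> Im w \<and> Im w \<le> b1 \<and> Re w \<le> d}"

definition slant_box :: "real \<Rightarrow> real \<Rightarrow> real \<Rightarrow> real \<Rightarrow> real \<Rightarrow> complex set" where
  "slant_box b0 b1 d \<eta> c = {w \<in> left_strip b0 b1 d. c < slant \<eta> w}"

lemma left_strip_convex: "convex (left_strip b0 b1 d)"
proof -
  have "left_strip b0 b1 d = {w. Im w \<ge> b0} \<inter> {w. Im w \<le> b1} \<inter> {w. Re w \<le> d}" by (auto simp: left_strip_def)
  then show ?thesis by (simp add: convex_halfspace_Im_le convex_halfspace_Im_ge convex_halfspace_Re_le convex_Int)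
qed

lemma closed_left_strip: "closed (left_strip b0 b1 d)"
  unfolding left_strip_def by (intro closed_Collect_conj closed_Collect_le continuous_intros)

lemma slant_segment: "slant \<eta> ((1 - u) *\<^sub>R x + u *\<^sub>R y) = (1 - u) * slant \<eta> x + u * slant \<eta> y"
  by (simp add: slant_add slant_scaleR)

lemma slant_inner: "slant \<eta> w = Complex 1 \<eta> \<bullet> w"
  by (simp add: slant_def inner_complex_def)

lemma convex_slant_gt: "convex {w. c < slant \<eta> w}"
  using convex_halfspace_gt[of c "Complex 1 \<eta>"] by (simp add: slant_inner)

lemma slant_box_eq: "slant_box b0 b1 d \<eta> c = left_strip b0 b1 d \<inter> {w. c < slant \<eta> w}" by (auto simp: slant_box_def)

lemma slant_box_convex: "convex (slant_box b0 b1 d \<eta> c)"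
  unfolding slant_box_eq by (intro convex_Int left_strip_convex convex_slant_gt)

lemma compact_left_strip_slant: "compact {w \<in> left_strip b0 b1 d. c \<le> slant \<eta> w}"
proof -
  have "closed {w. c \<le> slant \<eta> w}" by (intro closed_Collect_le continuous_intros)
  moreover have "{w \<in> left_strip b0 b1 d. c \<le> slant \<eta> w} = left_strip b0 b1 d \<inter> {w. c \<le> slant \<eta> w}" by auto
  ultimately have "closed {w \<in> left_strip b0 b1 d. c \<le> slant \<eta> w}" using closed_left_strip by auto
  moreover have "cmod w \<le> (\<bar>c\<bar> + \<bar>d\<bar> + \<bar>\<eta>\<bar> * (\<bar>b0\<bar> + \<bar>b1\<bar>)) + (\<bar>b0\<bar> + \<bar>b1\<bar>)"
    if "w \<in> left_strip b0 b1 d" "c \<le> slant \<eta> w" for w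
  proof -
    have i: "\<bar>Im w\<bar> \<le> \<bar>b0\<bar> + \<bar>b1\<bar>" using that by (auto simp: left_strip_def)
    have "\<bar>\<eta> * Im w\<bar> \<le> \<bar>\<eta>\<bar> * (\<bar>b0\<bar> + \<bar>b1\<bar>)" unfolding abs_mult using i by (simp add: mult_left_mono)
    moreover have "c - \<eta> * Im w \<le> Re w" "Re w \<le> d" using that by (auto simp: left_strip_def slant_def)
    ultimately have "\<bar>Re w\<bar> \<le> \<bar>c\<bar> + \<bar>d\<bar> + \<bar>\<eta>\<bar> * (\<bar>b0\<bar> + \<bar>b1\<bar>)" by linarith
    then show ?thesis using i cmod_le[of w] by linarith
  qed
  then have "bounded {w \<in> left_strip b0 b1 d. c \<le> slant \<eta> w}" by (intro boundedI) auto
  ultimately show ?thesis by (simp add: compact_eq_bounded_closed)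
qed

context loc_homeo
begin

text \<open>Obstacles are the points of the strip outside \<open>lift_dom p\<close>. On the left side of an escape box there
  is at least one, and its two corners are none. The inequality says that the corners
  lie to the left of the right side. The base \<open>F p\<close> lies in the box, so the branch on the
  convex box is the restriction of any section through \<open>p\<close>.\<close>

definition escape_box :: "complex \<Rightarrow> real \<Rightarrow> real \<Rightarrow> real \<Rightarrow> real \<Rightarrow> real \<Rightarrow> bool" where
  "escape_box p b0 b1 d \<eta> c \<longleftrightarrow> slant_box b0 b1 d \<eta> c \<subseteq> lift_dom p \<and> F p \<in> slant_box b0 b1 d \<eta> c \<and>
     (\<forall>b\<in>{b0, b1}. c - \<eta> * b < d \<and> Complex (c - \<eta> * b) b \<in> lift_dom p) \<and>
     (\<exists>e. e \<in> left_strip b0 b1 d \<and> slant \<eta> e = c \<and> e \<notin> lift_dom p)"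

lemma escape_boxD:
  assumes "escape_box p b0 b1 d \<eta> c"
  shows "slant_box b0 b1 d \<eta> c \<subseteq> lift_dom p" "F p \<in> slant_box b0 b1 d \<eta> c"
    "c - \<eta> * b0 < d" "c - \<eta> * b1 < d"
    "Complex (c - \<eta> * b0) b0 \<in> lift_dom p" "Complex (c - \<eta> * b1) b1 \<in> lift_dom p"
    "\<exists>e. e \<in> left_strip b0 b1 d \<and> slant \<eta> e = c \<and> e \<notin> lift_dom p"
  using assms unfolding escape_box_def by auto

lemma escape_box_notin_Im:
  assumes "escape_box p b0 b1 d \<eta> c" "e \<in> left_strip b0 b1 d" "e \<notin> lift_dom p" "slant \<eta> e = c"
  shows "b0 < Im e" "Im e < b1"
proof -
  have "e = Complex (c - \<eta> * Im e) (Im e)" using assms(4) by (simp add: slant_def complex_eq_iff)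
  then have "Im e \<noteq> b0" "Im e \<noteq> b1" using escape_boxD(5,6)[OF assms(1)] assms(3) by metis+
  then show "b0 < Im e" "Im e < b1" using assms(2) by (auto simp: left_strip_def)
qed

lemma open_segment_slant_box:
  assumes "w0 \<in> slant_box b0 b1 d \<eta> c" "e \<in> left_strip b0 b1 d" "slant \<eta> e \<ge> c"
  shows "open_segment w0 e \<subseteq> slant_box b0 b1 d \<eta> c"
proof
  fix x assume x: "x \<in> open_segment w0 e"
  then obtain u where u: "0 < u" "u < 1" "x = (1 - u) *\<^sub>R w0 + u *\<^sub>R e"
    by (auto simp: in_segment)
  have "x \<in> left_strip b0 b1 d" using assms(1,2) u left_strip_convex unfolding slant_box_def convex_alt by auto
  moreover have "(1 - u) * (slant \<eta> w0 - c) > 0" "u * (slant \<eta> e - c) \<ge> 0" using assms u by (auto simp: slant_box_def)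
  then have "c < slant \<eta> x" unfolding u(3) slant_segment by (simp add: algebra_simps)
  ultimately show "x \<in> slant_box b0 b1 d \<eta> c" by (simp add: slant_box_def)
qed

lemma escape_box_line:
  assumes h: "escape_box p b0 b1 d \<eta> c" and "b0 \<le> b" "b \<le> b1"
  shows "c - \<eta> * b < d"
proof (cases "\<eta> \<ge> 0")
  case True then have "\<eta> * b0 \<le> \<eta> * b" using assms by (simp add: mult_left_mono)
  then show ?thesis using escape_boxD(3)[OF h] by linarith
next
  case False then have "\<eta> * b1 \<le> \<eta> * b" using assms by (simp add: mult_left_mono_neg)
  then show ?thesis using escape_boxD(4)[OF h] by linarith
qed

definition obstacle :: "complex \<Rightarrow> real \<Rightarrow> real \<Rightarrow> real \<Rightarrow> real \<Rightarrow> real \<Rightarrow> complex set" where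
  "obstacle p b0 b1 d \<eta> c = {w \<in> left_strip b0 b1 d. c \<le> slant \<eta> w} - lift_dom p"

lemma compact_obstacle: "compact (obstacle p b0 b1 d \<eta> c)"
  unfolding obstacle_def using compact_left_strip_slant open_lift_dom by (simp add: Diff_eq compact_Int_closed closed_Compl)

end

text \<open>The support function of the obstacles: the line \<open>slant \<eta> w = support N \<eta>\<close> touches them from the right.\<close>

definition support :: "complex set \<Rightarrow> real \<Rightarrow> real" where
  "support N \<eta> = Sup (slant \<eta> ` N)"

lemma LIMSEQ_dist_inverse:
  assumes "\<And>n. dist (x n) l < 1 / real (Suc n)"
  shows "x \<longlonglongrightarrow> l"
proof -
  have "(\<lambda>n. 1 / real (Suc n)) \<longlonglongrightarrow> 0" using LIMSEQ_inverse_real_of_nat by (simp add: inverse_eq_divide)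
  then have "(\<lambda>n. dist (x n) l) \<longlonglongrightarrow> 0"
    by (rule Lim_null_comparison[rotated], intro always_eventually allI, unfold real_norm_def abs_of_nonneg[OF zero_le_dist])
      (rule less_imp_le[OF assms])
  then show ?thesis by (rule tendsto_dist_iff[THEN iffD2])
qed

lemma support_attained:
  assumes "compact N" "N \<noteq> {}"
  obtains e where "e \<in> N" "slant \<eta> e = support N \<eta>"
proof -
  have c: "compact (slant \<eta> ` N)" using assms(1) by (intro compact_continuous_image continuous_intros) auto
  then have "Sup (slant \<eta> ` N) \<in> slant \<eta> ` N" using assms
    by (intro closed_contains_Sup) (auto simp: compact_imp_closed bounded_imp_bdd_above compact_imp_bounded)
  then show ?thesis using that unfolding support_def by fastforce
qed

lemma support_upper: "compact N \<Longrightarrow> w \<in> N \<Longrightarrow> slant \<eta> w \<le> support N \<eta>"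
  unfolding support_def by (intro cSup_upper bounded_imp_bdd_above compact_imp_bounded
      compact_continuous_image continuous_intros) auto

lemma support_lipschitz:
  assumes "compact N" "N \<noteq> {}"
  obtains B where "B > 0" "\<And>\<eta> \<eta>'. \<bar>support N \<eta> - support N \<eta>'\<bar> \<le> B * \<bar>\<eta> - \<eta>'\<bar>"
proof -
  obtain B where B: "B > 0" "\<And>w. w \<in> N \<Longrightarrow> cmod w \<le> B"
    using assms compact_imp_bounded by (meson bounded_pos)
  have "support N \<eta> \<le> support N \<eta>' + B * \<bar>\<eta> - \<eta>'\<bar>" for \<eta> \<eta>'
  proof -
    obtain e where e: "e \<in> N" "slant \<eta> e = support N \<eta>" by (rule support_attained[OF assms])
    have "\<bar>(\<eta> - \<eta>') * Im e\<bar> \<le> B * \<bar>\<eta> - \<eta>'\<bar>" unfolding abs_mult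
      using B(2)[OF e(1)] abs_Im_le_cmod[of e] by (simp add: mult.commute mult_right_mono)
    then show ?thesis using support_upper[OF assms(1) e(1), of \<eta>'] slant_change[of \<eta> e \<eta>'] e(2) by linarith
  qed
  then have "\<bar>support N \<eta> - support N \<eta>'\<bar> \<le> B * \<bar>\<eta> - \<eta>'\<bar>" for \<eta> \<eta>'
    by (metis (no_types, lifting) abs_diff_le_iff abs_minus_commute add.commute diff_le_eq)
  then show ?thesis using that B(1) by blast
qed

lemma tendsto_support:
  assumes "compact N" "N \<noteq> {}" "(f \<longlongrightarrow> \<eta>) G"
  shows "((\<lambda>x. support N (f x)) \<longlongrightarrow> support N \<eta>) G"
proof -
  obtain B where B: "B > 0" "\<And>\<eta> \<eta>'. \<bar>support N \<eta> - support N \<eta>'\<bar> \<le> B * \<bar>\<eta> - \<eta>'\<bar>"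
    using support_lipschitz[OF assms(1,2)] by metis
  have "((\<lambda>x. B * \<bar>f x - \<eta>\<bar>) \<longlongrightarrow> B * \<bar>\<eta> - \<eta>\<bar>) G" using assms(3) by (intro tendsto_intros)
  then have l0: "((\<lambda>x. B * \<bar>f x - \<eta>\<bar>) \<longlongrightarrow> 0) G" by simp
  have "((\<lambda>x. support N (f x) - support N \<eta>) \<longlongrightarrow> 0) G"
    by (rule Lim_null_comparison[OF _ l0], rule always_eventually, unfold real_norm_def, rule allI, rule B(2))
  then show ?thesis by (simp add: LIM_zero_iff)
qed

context loc_homeo
begin

text \<open>Obstacles form a closed set, so near the left side they are compact and have a support function.
  Moving the left side of the box to the supporting line keeps all obstacles out of the box. The
  corners stay free of obstacles for small tilts because they move continuously and
  \<open>lift_dom p\<close> is open. Cutting the obstacles at \<open>c - 1\<close> only makes them compact; by the last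
  conclusion the ones that are cut off do not reach the supporting lines.\<close>

lemma escape_box_tilt:
  assumes h: "escape_box p b0 b1 d \<eta>0 c" and N: "N = obstacle p b0 b1 d \<eta>0 (c - 1)"
  shows "N \<noteq> {}" "support N \<eta>0 = c" "eventually (\<lambda>\<eta>. escape_box p b0 b1 d \<eta> (support N \<eta>)) (nhds \<eta>0)"
    "eventually (\<lambda>\<eta>. \<forall>w\<in>left_strip b0 b1 d. w \<notin> lift_dom p \<longrightarrow> support N \<eta> \<le> slant \<eta> w \<longrightarrow> w \<in> N) (nhds \<eta>0)"
proof -
  obtain e where e: "e \<in> left_strip b0 b1 d" "slant \<eta>0 e = c" "e \<notin> lift_dom p" using escape_boxD(7)[OF h] by auto
  have eN: "e \<in> N" using e unfolding N obstacle_def by auto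
  show ne: "N \<noteq> {}" using eN by auto
  have cN: "compact N" unfolding N by (rule compact_obstacle)
  have le: "slant \<eta>0 w \<le> c" if "w \<in> left_strip b0 b1 d" "w \<notin> lift_dom p" for w
    using escape_boxD(1)[OF h] that unfolding slant_box_def by force
  obtain e' where e': "e' \<in> N" "slant \<eta>0 e' = support N \<eta>0" by (rule support_attained[OF cN ne])
  show s0: "support N \<eta>0 = c"
    using le[of e'] e' support_upper[OF cN eN, of \<eta>0] e(2) unfolding N obstacle_def by auto
  have lim: "((\<lambda>\<eta>. support N \<eta>) \<longlongrightarrow> c) (nhds \<eta>0)"
    using tendsto_support[OF cN ne, of "\<lambda>x. x" \<eta>0 "nhds \<eta>0"] s0 by (simp add: filterlim_ident)
  have idn: "((\<lambda>\<eta>::real. \<eta>) \<longlongrightarrow> \<eta>0) (nhds \<eta>0)" by (rule filterlim_ident)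
  have corner: "eventually (\<lambda>\<eta>. support N \<eta> - \<eta> * b < d \<and> Complex (support N \<eta> - \<eta> * b) b \<in> lift_dom p) (nhds \<eta>0)"
    if b: "c - \<eta>0 * b < d" "Complex (c - \<eta>0 * b) b \<in> lift_dom p" for b
  proof (rule eventually_conj)
    have l: "((\<lambda>\<eta>. support N \<eta> - \<eta> * b) \<longlongrightarrow> c - \<eta>0 * b) (nhds \<eta>0)"
      by (intro tendsto_intros lim idn)
    show "eventually (\<lambda>\<eta>. support N \<eta> - \<eta> * b < d) (nhds \<eta>0)"
      using order_tendstoD(2)[OF l b(1)] .
    have "((\<lambda>\<eta>. Complex (support N \<eta> - \<eta> * b) b) \<longlongrightarrow> Complex (c - \<eta>0 * b) b) (nhds \<eta>0)"
      by (intro tendsto_Complex l tendsto_const)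
    then show "eventually (\<lambda>\<eta>. Complex (support N \<eta> - \<eta> * b) b \<in> lift_dom p) (nhds \<eta>0)"
      using open_lift_dom b(2) topological_tendstoD by blast
  qed
  have Fp: "F p \<in> left_strip b0 b1 d" "c < slant \<eta>0 (F p)" using escape_boxD(2)[OF h] by (auto simp: slant_box_def)
  have "((\<lambda>\<eta>. slant \<eta> (F p) - support N \<eta>) \<longlongrightarrow> slant \<eta>0 (F p) - c) (nhds \<eta>0)"
    unfolding slant_def by (intro tendsto_intros lim idn)
  then have evF: "eventually (\<lambda>\<eta>. slant \<eta> (F p) - support N \<eta> > 0) (nhds \<eta>0)"
    by (rule order_tendstoD) (use Fp in auto)
  define B where "B = \<bar>b0\<bar> + \<bar>b1\<bar> + 1"
  have "((\<lambda>\<eta>. c - 1 + \<bar>\<eta> - \<eta>0\<bar> * B - support N \<eta>) \<longlongrightarrow> c - 1 + \<bar>\<eta>0 - \<eta>0\<bar> * B - c) (nhds \<eta>0)"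
    by (intro tendsto_intros lim idn)
  then have evB: "eventually (\<lambda>\<eta>. c - 1 + \<bar>\<eta> - \<eta>0\<bar> * B - support N \<eta> < 0) (nhds \<eta>0)"
    by (rule order_tendstoD) auto
  show evN: "eventually (\<lambda>\<eta>. \<forall>w\<in>left_strip b0 b1 d. w \<notin> lift_dom p \<longrightarrow> support N \<eta> \<le> slant \<eta> w \<longrightarrow> w \<in> N) (nhds \<eta>0)"
    using evB
  proof eventually_elim
    case (elim \<eta>)
    show ?case
    proof (intro ballI impI)
      fix w assume w: "w \<in> left_strip b0 b1 d" "w \<notin> lift_dom p" "support N \<eta> \<le> slant \<eta> w"
      have "\<bar>Im w\<bar> \<le> B" using w(1) unfolding left_strip_def B_def by auto
      then have "\<bar>(\<eta> - \<eta>0) * Im w\<bar> \<le> \<bar>\<eta> - \<eta>0\<bar> * B" unfolding abs_mult by (rule mult_left_mono) auto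
      then have "c - 1 \<le> slant \<eta>0 w" using elim w(3) slant_change[of \<eta> w \<eta>0] by linarith
      then show "w \<in> N" unfolding N obstacle_def using w by auto
    qed
  qed
  show "eventually (\<lambda>\<eta>. escape_box p b0 b1 d \<eta> (support N \<eta>)) (nhds \<eta>0)"
    using corner[OF escape_boxD(3,5)[OF h]] corner[OF escape_boxD(4,6)[OF h]] evF evN
  proof eventually_elim
    case (elim \<eta>)
    have "w \<in> lift_dom p" if w: "w \<in> slant_box b0 b1 d \<eta> (support N \<eta>)" for w
    proof (rule ccontr)
      assume n: "w \<notin> lift_dom p"
      have wb: "w \<in> left_strip b0 b1 d" "support N \<eta> < slant \<eta> w" using w by (auto simp: slant_box_def)
      then have "w \<in> N" using elim(4) n by auto
      then show False using support_upper[OF cN, of w \<eta>] wb by auto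
    qed
    moreover obtain e where "e \<in> N" "slant \<eta> e = support N \<eta>" by (rule support_attained[OF cN ne])
    then have "\<exists>e. e \<in> left_strip b0 b1 d \<and> slant \<eta> e = support N \<eta> \<and> e \<notin> lift_dom p"
      unfolding N obstacle_def by auto
    ultimately show ?case unfolding escape_box_def using elim Fp by (auto simp: slant_box_def)
  qed
qed

text \<open>The boxes may vary along the sequence. The local inverse at the limit \<open>q\<close> agrees with the branch on
  each late box near \<open>w\<close>, and all late boxes share a point with the limit box, on which the two
  therefore agree as well.\<close>

lemma escape_box_escape_lim:
  assumes h: "escape_box p b0 b1 d \<eta> c" and ev: "eventually (\<lambda>n. escape_box p b0 b1 d (\<eta>n n) (cn n)) sequentially"
    and lim: "\<eta>n \<longlonglongrightarrow> \<eta>" "cn \<longlonglongrightarrow> c"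
    and wn: "\<And>n::nat. wn n \<in> slant_box b0 b1 d (\<eta>n n) (cn n)" "wn \<longlonglongrightarrow> w"
    and q: "(\<lambda>n. branch p (wn n)) \<longlonglongrightarrow> q"
  shows "w \<in> lift_dom p" "branch p w = q"
proof -
  have wnb: "wn n \<in> left_strip b0 b1 d" "cn n < slant (\<eta>n n) (wn n)" for n using wn(1)[of n] by (auto simp: slant_box_def)
  have wb: "w \<in> left_strip b0 b1 d" using closed_sequentially[OF closed_left_strip _ wn(2)] wnb by auto
  have "(\<lambda>n. slant (\<eta>n n) (wn n)) \<longlonglongrightarrow> slant \<eta> w" by (intro tendsto_slant wn(2) lim(1))
  then have wc: "c \<le> slant \<eta> w" using lim(2) wnb(2) by (intro LIMSEQ_le) (auto intro: less_imp_le)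
  have os: "open_segment (F p) w \<subseteq> slant_box b0 b1 d \<eta> c" by (rule open_segment_slant_box[OF escape_boxD(2)[OF h] wb wc])
  have cont: "(\<lambda>n. F (branch p (wn n))) \<longlonglongrightarrow> F q"
    using cont_F q by (metis isCont_tendsto_compose UNIV_I continuous_on_eq_continuous_at open_UNIV)
  have evF: "eventually (\<lambda>n. F (branch p (wn n)) = wn n) sequentially"
    using ev
  proof eventually_elim
    case (elim n)
    then show ?case using wn(1)[of n] escape_boxD(1)[OF elim] by auto
  qed
  have Fq: "F q = w" using tendsto_cong[OF evF] cont wn(2) LIMSEQ_unique by blast
  obtain r g U where g: "r > 0" "section_on F (ball w r) g" "g w = q" "open U" "q \<in> U"
    "\<And>q. q \<in> U \<Longrightarrow> F q \<in> ball w r \<and> g (F q) = q"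
    using local_section[of q] unfolding Fq by metis
  have evU: "eventually (\<lambda>n. branch p (wn n) \<in> U) sequentially"
    using q g(4,5) by (simp add: tendsto_def)
  \<comment> \<open>A point common to the ball and to all late boxes.\<close>
  obtain v where v: "v \<in> slant_box b0 b1 d \<eta> c \<inter> ball w r"
  proof (cases "F p \<in> ball w r")
    case True then show ?thesis using that escape_boxD(2)[OF h] by auto
  next
    case False
    then have ne: "F p \<noteq> w" using g(1) by auto
    define u where "u = 1 - min (1/2) (r / (2 * dist (F p) w))"
    have u: "0 < u" "u < 1" using ne g(1) unfolding u_def by auto
    define v where "v = (1 - u) *\<^sub>R F p + u *\<^sub>R w"
    have "v \<in> open_segment (F p) w" unfolding v_def in_segment using u ne by auto
    moreover
    have "w - v = (1 - u) *\<^sub>R (w - F p)" unfolding v_def by (simp add: algebra_simps)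
    then have "dist w v = (1 - u) * dist (F p) w" using u by (simp add: dist_norm norm_minus_commute)
    moreover have "(1 - u) * dist (F p) w \<le> r / (2 * dist (F p) w) * dist (F p) w"
      unfolding u_def using ne by (intro mult_right_mono) auto
    moreover have "r / (2 * dist (F p) w) * dist (F p) w = r / 2" using ne by simp
    ultimately have "v \<in> open_segment (F p) w \<and> dist w v < r" using g(1) by auto
    then show ?thesis using that os by auto
  qed
  have "(\<lambda>n. slant (\<eta>n n) v - cn n) \<longlonglongrightarrow> slant \<eta> v - c" unfolding slant_def by (intro tendsto_intros lim)
  then have "eventually (\<lambda>n. slant (\<eta>n n) v - cn n > 0) sequentially"
    by (rule order_tendstoD) (use v in \<open>auto simp: slant_box_def\<close>)
  with evF evU ev have "eventually (\<lambda>n. branch p (wn n) \<in> U \<and> F (branch p (wn n)) = wn n \<and> escape_box p b0 b1 d (\<eta>n n) (cn n)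
     \<and> slant (\<eta>n n) v - cn n > 0) sequentially" by eventually_elim auto
  then obtain n where n: "branch p (wn n) \<in> U" "F (branch p (wn n)) = wn n" "escape_box p b0 b1 d (\<eta>n n) (cn n)"
     "slant (\<eta>n n) v - cn n > 0" using eventually_happens'[OF sequentially_bot] by blast
  let ?S = "slant_box b0 b1 d (\<eta>n n) (cn n)"
  have "branch p v = g v"
  proof (rule section_unique[where S="?S \<inter> ball w r" and \<sigma>="branch p" and \<tau>=g and ?w0.0="wn n"])
    show "connected (?S \<inter> ball w r)" by (simp add: slant_box_convex convex_Int convex_connected)
    show "section_on F (?S \<inter> ball w r) (branch p)"
      by (rule section_on_subset[OF section_lift_dom]) (use escape_boxD(1)[OF n(3)] in auto)
    show "section_on F (?S \<inter> ball w r) g" by (rule section_on_subset[OF g(2)]) auto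
    show "wn n \<in> ?S \<inter> ball w r" "branch p (wn n) = g (wn n)" using g(6)[OF n(1)] n(2) wn(1) by auto
    show "v \<in> ?S \<inter> ball w r" using v n(4) by (auto simp: slant_box_def)
  qed
  from lift_dom_extend[OF slant_box_convex escape_boxD(1)[OF h] os g(1,2) v this escape_boxD(2)[OF h]] g(3)
  show "w \<in> lift_dom p" "branch p w = q" by auto
qed

end

section \<open>One-sided slopes of a bounded semicontinuous function\<close>

definition usc_at :: "(real \<Rightarrow> real) \<Rightarrow> real \<Rightarrow> bool" where
  "usc_at M a \<longleftrightarrow> (\<forall>e>0. \<exists>\<delta>>0. \<forall>t. \<bar>t - a\<bar> < \<delta> \<longrightarrow> M t < M a + e)"

text \<open>\<open>M\<close> lies locally above a line of slope \<open>l\<close> through \<open>(a, M a)\<close>, up to an error of first order.\<close>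

definition subslope :: "(real \<Rightarrow> real) \<Rightarrow> real \<Rightarrow> real \<Rightarrow> bool" where
  "subslope M a l \<longleftrightarrow> (\<forall>e>0. \<exists>\<delta>>0. \<forall>h. \<bar>h\<bar> < \<delta> \<longrightarrow> M (a + h) \<ge> M a + l * h - e * \<bar>h\<bar>)"

lemma usc_attains_max:
  assumes ab: "a \<le> b" and usc: "\<And>x. x \<in> {a..b} \<Longrightarrow> usc_at N x" and bd: "\<And>x. x \<in> {a..b} \<Longrightarrow> N x \<le> B"
  obtains x where "x \<in> {a..b}" "\<And>t. t \<in> {a..b} \<Longrightarrow> N t \<le> N x"
proof -
  define S where "S = Sup (N ` {a..b})"
  have bdd: "bdd_above (N ` {a..b})" by (rule bdd_aboveI[of _ B]) (use bd in blast)
  have up: "N t \<le> S" if "t \<in> {a..b}" for t unfolding S_def using bdd that by (auto intro: cSup_upper)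
  have "\<exists>x\<in>{a..b}. N x > S - 1 / real (Suc n)" for n
  proof -
    have "S - 1 / real (Suc n) < Sup (N ` {a..b})" unfolding S_def by simp
    then show ?thesis using ab bdd by (subst (asm) less_cSup_iff) auto
  qed
  then obtain x where x: "\<And>n. x n \<in> {a..b}" "\<And>n. N (x n) > S - 1 / real (Suc n)" by metis
  have "seq_compact {a..b}" using compact_Icc compact_imp_seq_compact by blast
  then obtain l r where l: "l \<in> {a..b}" "strict_mono r" "(x \<circ> r) \<longlonglongrightarrow> l"
    using x(1) unfolding seq_compact_def by metis
  have "S \<le> N l"
  proof (rule ccontr)
    assume "\<not> S \<le> N l"
    then have e: "(S - N l) / 2 > 0" by auto
    then obtain \<delta> where d: "\<delta> > 0" "\<And>t. \<bar>t - l\<bar> < \<delta> \<Longrightarrow> N t < N l + (S - N l) / 2"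
      using usc[OF l(1)] unfolding usc_at_def by blast
    have "eventually (\<lambda>n. dist ((x \<circ> r) n) l < \<delta>) sequentially" using l(3) d(1) by (rule tendstoD)
    moreover have "(\<lambda>n. 1 / real (Suc (r n))) \<longlonglongrightarrow> 0"
      using LIMSEQ_subseq_LIMSEQ[OF LIMSEQ_inverse_real_of_nat l(2)]
      by (simp add: o_def inverse_eq_divide)
    then have "eventually (\<lambda>n. 1 / real (Suc (r n)) < (S - N l) / 2) sequentially"
      using e by (rule order_tendstoD)
    ultimately have "eventually (\<lambda>n. False) sequentially"
    proof eventually_elim
      case (elim n)
      have "N (x (r n)) < N l + (S - N l) / 2" by (rule d(2)) (use elim(1) in \<open>simp add: dist_real_def\<close>)
      moreover have "S - (S - N l) / 2 < N (x (r n))"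
        using diff_strict_left_mono[OF elim(2), of S] x(2)[of "r n"] by (rule less_trans)
      ultimately show ?case by (simp add: field_simps)
    qed
    then show False by simp
  qed
  then show ?thesis using that[OF l(1)] up order_trans by blast
qed

lemma subslope_step_right:
  assumes "subslope N x l" "l > 0" "x < b"
  obtains y where "x < y" "y < b" "N x < N y"
proof -
  obtain \<delta> where d: "\<delta> > 0" "\<And>h. \<bar>h\<bar> < \<delta> \<Longrightarrow> N (x + h) \<ge> N x + l * h - l / 2 * \<bar>h\<bar>"
    using assms(1,2) unfolding subslope_def by (meson half_gt_zero)
  define h where "h = min (\<delta> / 2) ((b - x) / 2)"
  have h: "0 < h" "h < \<delta>" "x + h < b" using d(1) assms(3) unfolding h_def by (auto simp: min_def field_simps)
  have "l * h > 0" using h assms by simp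
  then have "N (x + h) > N x" using d(2)[of h] h by (simp add: field_simps)
  then show ?thesis using that[of "x + h"] h by auto
qed

lemma subslope_step_left:
  assumes "subslope N x l" "l < 0" "a < x"
  obtains y where "a < y" "y < x" "N x < N y"
proof -
  have "subslope (\<lambda>t. N (- t)) (- x) (- l)"
    unfolding subslope_def
  proof (intro allI impI)
    fix e :: real assume "e > 0"
    then obtain \<delta> where d: "\<delta> > 0" "\<And>h. \<bar>h\<bar> < \<delta> \<Longrightarrow> N (x + h) \<ge> N x + l * h - e * \<bar>h\<bar>"
      using assms(1) unfolding subslope_def by meson
    show "\<exists>\<delta>>0. \<forall>h. \<bar>h\<bar> < \<delta> \<longrightarrow> N (- (- x + h)) \<ge> N (- (- x)) + - l * h - e * \<bar>h\<bar>"
      using d(1) d(2)[of "- h" for h] by (intro exI[of _ \<delta>]) auto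
  qed
  then obtain y where "- x < y" "y < - a" "N (- (- x)) < N (- y)"
    using subslope_step_right[of "\<lambda>t. N (- t)" "- x" "- l" "- a"] assms by auto
  then show ?thesis using that[of "- y"] by auto
qed

lemma subslope_tilt:
  assumes "subslope M a l" shows "subslope (\<lambda>x. M x + s * x) a (l + s)"
  unfolding subslope_def
proof (intro allI impI)
  fix e :: real assume "e > 0"
  then obtain \<delta> where d: "\<delta> > 0" "\<And>h. \<bar>h\<bar> < \<delta> \<Longrightarrow> M (a + h) \<ge> M a + l * h - e * \<bar>h\<bar>"
    using assms(1) unfolding subslope_def by meson
  then show "\<exists>\<delta>>0. \<forall>h. \<bar>h\<bar> < \<delta> \<longrightarrow> M (a + h) + s * (a + h) \<ge> M a + s * a + (l + s) * h - e * \<bar>h\<bar>"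
    by (intro exI[of _ \<delta>]) (auto simp: algebra_simps)
qed

lemma usc_tilt:
  assumes "usc_at M a" shows "usc_at (\<lambda>x. M x + s * x) a"
  unfolding usc_at_def
proof (intro allI impI)
  fix e :: real assume e: "e > 0"
  then obtain \<delta> where d: "\<delta> > 0" "\<And>t. \<bar>t - a\<bar> < \<delta> \<Longrightarrow> M t < M a + e / 2"
    using assms(1) unfolding usc_at_def by (meson half_gt_zero)
  define \<delta>' where "\<delta>' = min \<delta> (e / (2 * (\<bar>s\<bar> + 1)))"
  have "M t + s * t < M a + s * a + e" if t: "\<bar>t - a\<bar> < \<delta>'" for t
  proof -
    have "\<bar>s * (t - a)\<bar> \<le> (\<bar>s\<bar> + 1) * \<bar>t - a\<bar>" unfolding abs_mult by (intro mult_right_mono) auto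
    also have "\<dots> \<le> (\<bar>s\<bar> + 1) * (e / (2 * (\<bar>s\<bar> + 1)))" using t unfolding \<delta>'_def by (intro mult_left_mono) auto
    also have "\<dots> = e / 2"
    proof -
      have "\<alpha> * (e / (2 * \<alpha>)) = e / 2" if "\<alpha> > 0" for \<alpha> :: real using that by simp
      from this[of "\<bar>s\<bar> + 1"] show ?thesis by linarith
    qed
    finally have "s * (t - a) \<le> e / 2" by linarith
    then have "s * t - s * a \<le> e / 2" by (simp only: right_diff_distrib)
    moreover have "M t < M a + e / 2" using d(2) t unfolding \<delta>'_def by auto
    ultimately show ?thesis by linarith
  qed
  moreover have "\<delta>' > 0" unfolding \<delta>'_def using d(1) e by auto
  ultimately show "\<exists>\<delta>>0. \<forall>t. \<bar>t - a\<bar> < \<delta> \<longrightarrow> M t + s * t < M a + s * a + e" by blast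
qed

text \<open>After subtracting \<open>s * x\<close> all slopes are positive, and a semicontinuous function with positive
  subslopes attains its maximum over an interval at the right end.\<close>

lemma subslope_growth:
  assumes ab: "a \<le> b" and usc: "\<And>x. x \<in> {a..b} \<Longrightarrow> usc_at M x" and bd: "\<And>x. x \<in> {a..b} \<Longrightarrow> M x \<le> B"
    and sl: "\<And>x. x \<in> {a..b} \<Longrightarrow> \<exists>l>s. subslope M x l"
  shows "M b - M a \<ge> s * (b - a)"
proof -
  have bdN: "M x + - s * x \<le> B + \<bar>s\<bar> * (\<bar>a\<bar> + \<bar>b\<bar>)" if x: "x \<in> {a..b}" for x
  proof -
    have "\<bar>s * x\<bar> \<le> \<bar>s\<bar> * (\<bar>a\<bar> + \<bar>b\<bar>)" unfolding abs_mult using x by (intro mult_left_mono) auto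
    then show ?thesis using bd[OF x] by linarith
  qed
  obtain x where x: "x \<in> {a..b}" "\<And>t. t \<in> {a..b} \<Longrightarrow> M t + - s * t \<le> M x + - s * x"
    using usc_attains_max[OF ab usc_tilt[OF usc, where s="-s"] bdN] by metis
  have "x = b"
  proof (rule ccontr)
    assume "x \<noteq> b"
    then have xb: "x < b" using x by auto
    obtain l where l: "l > s" "subslope M x l" using sl[OF x(1)] by auto
    obtain y where "x < y" "y < b" "M x + - s * x < M y + - s * y"
      using subslope_step_right[OF subslope_tilt[OF l(2), of "- s"] _ xb] l(1) by auto
    then show False using x(2)[of y] x(1) by auto
  qed
  then show ?thesis using x(2)[of a] ab by (auto simp: algebra_simps)
qed

lemma subslope_decay:
  assumes ab: "a \<le> b" and usc: "\<And>x. x \<in> {a..b} \<Longrightarrow> usc_at M x" and bd: "\<And>x. x \<in> {a..b} \<Longrightarrow> M x \<le> B"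
    and sl: "\<And>x. x \<in> {a..b} \<Longrightarrow> \<exists>l<(-s). subslope M x l"
  shows "M a - M b \<ge> s * (b - a)"
proof -
  have bdN: "M x + s * x \<le> B + \<bar>s\<bar> * (\<bar>a\<bar> + \<bar>b\<bar>)" if x: "x \<in> {a..b}" for x
  proof -
    have "\<bar>s * x\<bar> \<le> \<bar>s\<bar> * (\<bar>a\<bar> + \<bar>b\<bar>)" unfolding abs_mult using x by (intro mult_left_mono) auto
    then show ?thesis using bd[OF x] by linarith
  qed
  obtain x where x: "x \<in> {a..b}" "\<And>t. t \<in> {a..b} \<Longrightarrow> M t + s * t \<le> M x + s * x"
    using usc_attains_max[OF ab usc_tilt[OF usc, where s="s"] bdN] by metis
  have "x = a"
  proof (rule ccontr)
    assume "x \<noteq> a"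
    then have xb: "a < x" using x by auto
    obtain l where l: "l < - s" "subslope M x l" using sl[OF x(1)] by auto
    obtain y where "a < y" "y < x" "M x + s * x < M y + s * y"
      using subslope_step_left[OF subslope_tilt[OF l(2), of "s"] _ xb] l(1) by auto
    then show False using x(2)[of y] x(1) by auto
  qed
  then show ?thesis using x(2)[of b] ab by (auto simp: algebra_simps)
qed

text \<open>A point with nonzero subslope is not a local maximum, so on an interval the maximum is attained at an
  end. Hence a positive slope at \<open>a\<close> forces positive slopes at all later points: \<open>M\<close> either
  grows from some point on, or decreases throughout. In both cases its change over \<open>[T k, T (k + 1)]\<close>
  is at least half of \<open>T * \<rho> (T (k + 1))\<close>, and the sum of these diverges.\<close>

lemma usc_subslope_contradiction:
  assumes usc: "\<And>a. a > a1 \<Longrightarrow> usc_at M a" and bd: "\<And>a. a > a1 \<Longrightarrow> \<bar>M a\<bar> \<le> B"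
    and sl: "\<And>a. a > a1 \<Longrightarrow> \<exists>l. \<bar>l\<bar> \<ge> \<rho> a \<and> subslope M a l"
    and \<rho>: "\<And>a. a > a1 \<Longrightarrow> \<rho> a > 0" "\<And>a b. a1 < a \<Longrightarrow> a \<le> b \<Longrightarrow> \<rho> b \<le> \<rho> a"
    and T: "T > 0" and div: "\<And>K m. \<exists>n\<ge>m. (\<Sum>k=m..<n. \<rho> (T * real (Suc k))) > K"
  shows False
proof -
  have main: False if a: "a > a1" and mon: "\<And>x b. a < x \<Longrightarrow> x \<le> b \<Longrightarrow> \<bar>\<epsilon>\<bar> = 1 \<and> \<epsilon> * (M b - M x) \<ge> \<rho> b / 2 * (b - x)"
    for a \<epsilon> :: real
  proof -
    obtain m :: nat where m: "a / T < real m" using reals_Archimedean2 by blast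
    have mk: "a < T * real k" if "m \<le> k" for k
      using m T that by (smt (verit, best) mult.commute of_nat_le_iff pos_divide_less_eq mult_left_mono)
    have sum: "\<epsilon> * (M (T * real n) - M (T * real m)) \<ge> T / 2 * (\<Sum>k=m..<n. \<rho> (T * real (Suc k)))" if "m \<le> n" for n
      using that
    proof (induction n rule: dec_induct)
      case base then show ?case by simp
    next
      case (step n)
      have "\<epsilon> * (M (T * real (Suc n)) - M (T * real n)) \<ge> \<rho> (T * real (Suc n)) / 2 * (T * real (Suc n) - T * real n)"
        using mon[of "T * real n" "T * real (Suc n)"] mk[of n] step(1) T by (auto simp: mult_left_mono)
      then have st: "\<epsilon> * (M (T * real (Suc n)) - M (T * real n)) \<ge> T / 2 * \<rho> (T * real (Suc n))"
        by (simp add: algebra_simps)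
      have "T / 2 * (\<Sum>k=m..<Suc n. \<rho> (T * real (Suc k))) =
          T / 2 * (\<Sum>k=m..<n. \<rho> (T * real (Suc k))) + T / 2 * \<rho> (T * real (Suc n))"
        using step(1) by (simp add: sum.atLeastLessThan_Suc algebra_simps)
      also have "\<dots> \<le> \<epsilon> * (M (T * real n) - M (T * real m)) + \<epsilon> * (M (T * real (Suc n)) - M (T * real n))"
        using st step.IH by linarith
      also have "\<dots> = \<epsilon> * (M (T * real (Suc n)) - M (T * real m))" by (simp add: algebra_simps)
      finally show ?case .
    qed
    obtain n where n: "m \<le> n" "(\<Sum>k=m..<n. \<rho> (T * real (Suc k))) > 4 * B / T" using div by blast
    have "T / 2 * (\<Sum>k=m..<n. \<rho> (T * real (Suc k))) > 2 * B" using n(2) T by (simp add: field_simps)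
    then have "2 * B < \<epsilon> * (M (T * real n) - M (T * real m))" using sum[OF n(1)] by linarith
    also have "\<dots> \<le> \<bar>\<epsilon>\<bar> * \<bar>M (T * real n) - M (T * real m)\<bar>" by (metis abs_ge_self abs_mult)
    also have "\<dots> = \<bar>M (T * real n) - M (T * real m)\<bar>" using mon[of "a + 1" "a + 1"] by simp
    also have "\<dots> \<le> 2 * B" using bd[of "T * real n"] bd[of "T * real m"] mk[of m] mk[of n] n(1) a by force
    finally show False by simp
  qed
  have bd': "M a \<le> B" if "a > a1" for a using bd[OF that] by auto
  show False
  proof (cases "\<exists>a>a1. \<exists>l>0. subslope M a l")
    case True
    then obtain a l where a: "a > a1" "l > 0" "subslope M a l" by auto
    have pos: "l' > 0" if b: "b > a" and l': "\<bar>l'\<bar> \<ge> \<rho> b" "subslope M b l'" for b l'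
    proof (rule ccontr)
      assume "\<not> l' > 0"
      then have neg: "l' < 0" using l'(1) \<rho>(1)[of b] a b by force
      obtain x where x: "x \<in> {a..b}" "\<And>t. t \<in> {a..b} \<Longrightarrow> M t \<le> M x"
        by (rule usc_attains_max[of a b M B]) (use a b usc bd' in auto)
      obtain lx where lx: "\<bar>lx\<bar> \<ge> \<rho> x" "subslope M x lx" using sl[of x] x a by auto
      have "lx \<noteq> 0" using lx(1) \<rho>(1)[of x] x a by force
      consider "x = a" | "x = b" | "a < x" "x < b" "lx > 0" | "a < x" "x < b" "lx < 0"
        using x(1) \<open>lx \<noteq> 0\<close> by fastforce
      then show False
      proof cases
        case 1
        obtain y where "a < y" "y < b" "M a < M y" by (rule subslope_step_right[OF a(3,2) b])
        then show False using x(2)[of y] 1 by auto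
      next
        case 2
        obtain y where "a < y" "y < b" "M b < M y" by (rule subslope_step_left[OF l'(2) neg b])
        then show False using x(2)[of y] 2 by auto
      next
        case 3
        obtain y where "x < y" "y < b" "M x < M y" by (rule subslope_step_right[OF lx(2) 3(3) 3(2)])
        then show False using x(2)[of y] 3 by auto
      next
        case 4
        obtain y where "a < y" "y < x" "M x < M y" by (rule subslope_step_left[OF lx(2) 4(3) 4(1)])
        then show False using x(2)[of y] 4 by auto
      qed
    qed
    show False
    proof (rule main[OF a(1), of 1])
      fix x b assume xb: "a < x" "x \<le> b"
      have "M b - M x \<ge> \<rho> b / 2 * (b - x)"
      proof (rule subslope_growth[OF xb(2), where B=B])
        fix t assume t: "t \<in> {x..b}"
        show "usc_at M t" "M t \<le> B" using usc bd' t xb a by auto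
        obtain l where l: "\<bar>l\<bar> \<ge> \<rho> t" "subslope M t l" using sl[of t] t xb a by auto
        have "l > \<rho> b / 2" using pos[OF _ l] l(1) \<rho>(2)[of t b] \<rho>(1)[of b] t xb a by force
        then show "\<exists>l>\<rho> b / 2. subslope M t l" using l by auto
      qed
      then show "\<bar>1::real\<bar> = 1 \<and> 1 * (M b - M x) \<ge> \<rho> b / 2 * (b - x)" by simp
    qed
  next
    case False
    show False
    proof (rule main[of "a1 + 1" "- 1"])
      fix x b assume xb: "a1 + 1 < x" "x \<le> b"
      have "M x - M b \<ge> \<rho> b / 2 * (b - x)"
      proof (rule subslope_decay[OF xb(2), where B=B])
        fix t assume t: "t \<in> {x..b}"
        show "usc_at M t" "M t \<le> B" using usc bd' t xb by auto
        obtain l where l: "\<bar>l\<bar> \<ge> \<rho> t" "subslope M t l" using sl[of t] t xb by auto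
        have "\<not> l > 0" using False l(2) t xb by force
        then have "l < - (\<rho> b / 2)" using l(1) \<rho>(2)[of t b] \<rho>(1)[of b] t xb by force
        then show "\<exists>l<(- (\<rho> b / 2)). subslope M t l" using l by auto
      qed
      then show "\<bar>- 1::real\<bar> = 1 \<and> - 1 * (M b - M x) \<ge> \<rho> b / 2 * (b - x)" by simp
    qed simp
  qed
qed

text \<open>Since \<open>1 / P\<close> decreases, its integral over \<open>[k, k + 1]\<close> is at most \<open>1 / P k\<close>.\<close>

lemma slow_function_sum_diverges:
  assumes P: "P \<in> slow_functions"
  shows "\<exists>n\<ge>m. (\<Sum>k=m..<n. 1 / P (real (Suc k))) > K"
proof -
  have pos: "P x > 0" if "x > 0" for x using P that unfolding slow_functions_def by auto
  have mono: "P x \<le> P y" if "0 < x" "x \<le> y" for x y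
    using P that unfolding slow_functions_def mono_on_def by auto
  have int: "(\<lambda>x. 1 / P x) integrable_on {a..b}" if "a \<ge> 2" for a b
    by (rule integrable_subinterval_real[OF slow_functions_integrable[OF P, of b]]) (use that in auto)
  define m' where "m' = max m 2"
  have st: "integral {real k..real (Suc k)} (\<lambda>x. 1 / P x) \<le> 1 / P (real k)" if "k \<ge> 2" for k
  proof -
    have "integral {real k..real (Suc k)} (\<lambda>x. 1 / P x) \<le> integral {real k..real (Suc k)} (\<lambda>x. 1 / P (real k))"
      by (rule integral_le) (use that int[of "real k" "real (Suc k)"] pos mono in \<open>auto intro!: divide_left_mono\<close>)
    then show ?thesis by simp
  qed
  have le: "integral {real m'..real n} (\<lambda>x. 1 / P x) \<le> (\<Sum>k=m'..<n. 1 / P (real k))" if "m' \<le> n" for n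
    using that
  proof (induction n rule: dec_induct)
    case base then show ?case by simp
  next
    case (step n)
    have "integral {real m'..real (Suc n)} (\<lambda>x. 1 / P x) =
      integral {real m'..real n} (\<lambda>x. 1 / P x) + integral {real n..real (Suc n)} (\<lambda>x. 1 / P x)"
      by (rule Henstock_Kurzweil_Integration.integral_combine[symmetric]) (use step(1) int in \<open>auto simp: m'_def\<close>)
    then show ?case using step st[of n] by (auto simp: m'_def)
  qed
  define I where "I = integral {2..real m'} (\<lambda>x. 1 / P x)"
  define K' where "K' = \<bar>K\<bar> + \<bar>I\<bar> + 1 / P (real m') + 1"
  have "1 / P (real m') > 0" using pos[of "real m'"] by (simp add: m'_def)
  then have K'0: "K' > 0" "K' - I - 1 / P (real m') > K" unfolding K'_def by linarith+
  obtain N where N: "N \<ge> 2" "integral {2..N} (\<lambda>x. 1 / P x) > K'"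
    using P K'0(1) unfolding slow_functions_def by auto
  obtain n0 :: nat where n0: "N \<le> real n0" using real_arch_simple by blast
  define n where "n = max n0 (Suc m')"
  have nn: "N \<le> real n" "m' < n" using n0 unfolding n_def by auto
  have "integral {2..real n} (\<lambda>x. 1 / P x) = integral {2..N} (\<lambda>x. 1 / P x) + integral {N..real n} (\<lambda>x. 1 / P x)"
    by (rule Henstock_Kurzweil_Integration.integral_combine[symmetric]) (use nn N int in auto)
  moreover have "integral {N..real n} (\<lambda>x. 1 / P x) \<ge> 0"
    by (rule integral_nonneg) (use int[of N "real n"] N pos in \<open>auto intro!: less_imp_le\<close>)
  ultimately have g: "integral {2..real n} (\<lambda>x. 1 / P x) > K'" using N by linarith
  have "integral {2..real n} (\<lambda>x. 1 / P x) = I + integral {real m'..real n} (\<lambda>x. 1 / P x)"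
    unfolding I_def by (rule Henstock_Kurzweil_Integration.integral_combine[symmetric]) (use nn int in \<open>auto simp: m'_def\<close>)
  then have big: "(\<Sum>k=m'..<n. 1 / P (real k)) > K + 1 / P (real m')" using g le[of n] nn K'0 by linarith
  have "(\<Sum>k=m'..<n. 1 / P (real k)) = 1 / P (real m') + (\<Sum>k=Suc m'..<n. 1 / P (real k))"
    using nn(2) by (simp add: sum.atLeast_Suc_lessThan)
  also have "(\<Sum>k=Suc m'..<n. 1 / P (real k)) = (\<Sum>k=m'..<n - 1. 1 / P (real (Suc k)))"
    using sum.shift_bounds_Suc_ivl[of "\<lambda>k. 1 / P (real k)" m' "n - 1"] nn(2) by simp
  finally have "(\<Sum>k=m'..<n - 1. 1 / P (real (Suc k))) > K" using big by linarith
  also have "(\<Sum>k=m'..<n - 1. 1 / P (real (Suc k))) \<le> (\<Sum>k=m..<n - 1. 1 / P (real (Suc k)))"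
    by (rule sum_mono2) (use pos in \<open>auto simp: m'_def intro!: less_imp_le\<close>)
  finally show ?thesis using nn(2) by (intro exI[of _ "n - 1"]) (auto simp: m'_def)
qed

section \<open>The eigenvalue condition bounds a branch on a slanted box\<close>

text \<open>The first coordinate after rotating the plane by the angle \<open>- Arg u\<close> is \<open>Re (cnj u * q)\<close>, while
  eigenvalues do not change under rotation. So the rotations can be replaced by directions \<open>u\<close>.\<close>

definition complex_W_condition :: "(complex \<Rightarrow> complex) \<Rightarrow> (complex \<Rightarrow> complex \<Rightarrow> complex) \<Rightarrow> (real \<Rightarrow> real) \<Rightarrow> bool" where
  "complex_W_condition F F' P \<longleftrightarrow> (\<forall>u. cmod u = 1 \<longrightarrow> \<not> (\<exists>p l T. filterlim (\<lambda>k::nat. Re (cnj u * p k)) at_top sequentially \<and>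
     (\<lambda>k. F (p k)) \<longlonglongrightarrow> T \<and> (\<forall>k. real_eigenvalue (F' (p k)) (l k)) \<and>
     (\<lambda>k. l k * P (Re (cnj u * p k))) \<longlonglongrightarrow> 0))"

locale wc_map = loc_homeo F for F :: "complex \<Rightarrow> complex" +
  fixes F' :: "complex \<Rightarrow> complex \<Rightarrow> complex" and P :: "real \<Rightarrow> real"
  assumes der: "\<And>p. (F has_derivative F' p) (at p)"
    and slow: "P \<in> slow_functions" and wc: "complex_W_condition F F' P"
begin

lemma P_pos: "x > 0 \<Longrightarrow> P x > 0"
  using slow unfolding slow_functions_def by auto

lemma P_mono: "0 < x \<Longrightarrow> x \<le> y \<Longrightarrow> P x \<le> P y"
  using slow unfolding slow_functions_def mono_on_def by auto

text \<open>The sequence in the condition comes from a failure of the bound for all constants; since \<open>F\<close> maps it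
  to a bounded set, its image converges along a subsequence.\<close>

lemma eigenvalue_bound:
  assumes u: "cmod u = 1" and Bd: "bounded Bd"
  obtains c r0 where "c > 0" "r0 > 0"
    "\<And>q l. Re (cnj u * q) \<ge> r0 \<Longrightarrow> F q \<in> Bd \<Longrightarrow> real_eigenvalue (F' q) l \<Longrightarrow> \<bar>l\<bar> \<ge> c / P (Re (cnj u * q))"
proof -
  have "\<exists>n::nat. \<forall>q l. Re (cnj u * q) \<ge> real (Suc n) \<longrightarrow> F q \<in> Bd \<longrightarrow> real_eigenvalue (F' q) l \<longrightarrow>
     \<bar>l\<bar> * P (Re (cnj u * q)) \<ge> 1 / real (Suc n)"
  proof (rule ccontr)
    assume "\<not> ?thesis"
    then have "\<forall>n. \<exists>q l. Re (cnj u * q) \<ge> real (Suc n) \<and> F q \<in> Bd \<and> real_eigenvalue (F' q) l \<and>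
       \<bar>l\<bar> * P (Re (cnj u * q)) < 1 / real (Suc n)" by (meson not_le)
    then obtain q l where ql: "\<And>n. Re (cnj u * q n) \<ge> real (Suc n)" "\<And>n. F (q n) \<in> Bd"
      "\<And>n. real_eigenvalue (F' (q n)) (l n)" "\<And>n. \<bar>l n\<bar> * P (Re (cnj u * q n)) < 1 / real (Suc n)"
      by metis
    have "bounded (range (\<lambda>n. F (q n)))" by (rule bounded_subset[OF Bd]) (use ql(2) in auto)
    then obtain T r where r: "strict_mono (r :: nat \<Rightarrow> nat)" "((\<lambda>n. F (q n)) \<circ> r) \<longlonglongrightarrow> T"
      using bounded_imp_convergent_subsequence by blast
    have "filterlim (\<lambda>n. Re (cnj u * q (r n))) at_top sequentially"
    proof (rule filterlim_at_top_mono[OF filterlim_real_sequentially])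
      show "\<forall>\<^sub>F n in sequentially. real n \<le> Re (cnj u * q (r n))"
      proof (rule always_eventually, rule allI)
        fix n show "real n \<le> Re (cnj u * q (r n))"
          using ql(1)[of "r n"] seq_suble[OF r(1), of n] by simp
      qed
    qed
    moreover have "(\<lambda>n. l (r n) * P (Re (cnj u * q (r n)))) \<longlonglongrightarrow> 0"
    proof (rule Lim_null_comparison)
      show "(\<lambda>n. 1 / real (Suc (r n))) \<longlonglongrightarrow> 0"
        using LIMSEQ_subseq_LIMSEQ[OF LIMSEQ_inverse_real_of_nat r(1)] by (simp add: o_def inverse_eq_divide)
      show "\<forall>\<^sub>F n in sequentially. norm (l (r n) * P (Re (cnj u * q (r n)))) \<le> 1 / real (Suc (r n))"
      proof (rule always_eventually, rule allI)
        fix n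
        have "P (Re (cnj u * q (r n))) > 0" using ql(1)[of "r n"] by (intro P_pos) auto
        then show "norm (l (r n) * P (Re (cnj u * q (r n)))) \<le> 1 / real (Suc (r n))"
          using ql(4)[of "r n"] by (simp only: real_norm_def abs_mult abs_of_pos)
      qed
    qed
    ultimately have "\<exists>p l T. filterlim (\<lambda>k::nat. Re (cnj u * p k)) at_top sequentially \<and>
     (\<lambda>k. F (p k)) \<longlonglongrightarrow> T \<and> (\<forall>k. real_eigenvalue (F' (p k)) (l k)) \<and>
     (\<lambda>k. l k * P (Re (cnj u * p k))) \<longlonglongrightarrow> 0"
      using r(2) ql(3) unfolding o_def
      by (intro exI[of _ "\<lambda>n. q (r n)"] exI[of _ "\<lambda>n. l (r n)"] exI[of _ T]) simp
    then show False using wc u unfolding complex_W_condition_def by blast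
  qed
  then obtain n :: nat where n: "\<And>q l. Re (cnj u * q) \<ge> real (Suc n) \<Longrightarrow> F q \<in> Bd \<Longrightarrow> real_eigenvalue (F' q) l \<Longrightarrow>
     \<bar>l\<bar> * P (Re (cnj u * q)) \<ge> 1 / real (Suc n)" by blast
  have "\<bar>l\<bar> \<ge> 1 / real (Suc n) / P (Re (cnj u * q))"
    if "Re (cnj u * q) \<ge> real (Suc n)" "F q \<in> Bd" "real_eigenvalue (F' q) l" for q l
  proof -
    have Pq: "P (Re (cnj u * q)) > 0" by (rule P_pos) (use that(1) in linarith)
    show ?thesis by (subst pos_divide_le_eq[OF Pq]) (rule n[OF that])
  qed
  then show ?thesis using that[of "1 / real (Suc n)" "real (Suc n)"] by simp
qed

end

text \<open>The hypothesis says that \<open>slant \<eta>\<close> is an eigenvector of the transpose. For its eigenvalue \<open>l\<close> the map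
  \<open>A - l\<close> has values in the kernel of \<open>slant \<eta>\<close>, a line, so it is singular.\<close>

lemma slant_kernel_eigenvalue:
  fixes A :: "complex \<Rightarrow> complex"
  assumes A: "linear A" and k: "\<And>z. slant \<eta> z = 0 \<Longrightarrow> slant \<eta> (A z) = 0"
  shows "real_eigenvalue A (slant \<eta> (A 1))" "slant \<eta> (A z) = slant \<eta> (A 1) * slant \<eta> z"
proof -
  define l where "l = slant \<eta> (A 1)"
  have om1: "slant \<eta> 1 = 1" by (simp add: slant_def)
  have eq: "slant \<eta> (A z) = l * slant \<eta> z" for z
  proof -
    have "slant \<eta> (z - slant \<eta> z *\<^sub>R 1) = 0" by (simp add: slant_diff slant_scaleR om1)
    then have "slant \<eta> (A (z - slant \<eta> z *\<^sub>R 1)) = 0" by (rule k)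
    then show ?thesis by (simp add: linear_diff[OF A] linear_scale[OF A] slant_diff slant_scaleR l_def mult.commute)
  qed
  show "slant \<eta> (A z) = slant \<eta> (A 1) * slant \<eta> z" using eq[of z] unfolding l_def .
  define B where "B z = A z - l *\<^sub>R z" for z
  have lB: "linear B" unfolding B_def using A by (intro linear_compose_sub linear_compose_scale_right linear_ident) auto
  have Bk: "B z = Im (B z) *\<^sub>R Complex (- \<eta>) 1" for z
  proof -
    have "slant \<eta> (B z) = 0" unfolding B_def by (simp add: slant_diff slant_scaleR eq)
    then show ?thesis unfolding slant_def by (simp add: complex_eq_iff mult.commute)
  qed
  have "\<exists>v. v \<noteq> 0 \<and> B v = 0"
  proof (cases "Im (B 1) = 0 \<and> Im (B \<i>) = 0")
    case True then show ?thesis using Bk[of 1] by (intro exI[of _ 1]) auto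
  next
    case False
    define v where "v = Im (B \<i>) *\<^sub>R 1 + (- Im (B 1)) *\<^sub>R \<i>"
    have "B v = Im (B \<i>) *\<^sub>R B 1 + (- Im (B 1)) *\<^sub>R B \<i>"
      unfolding v_def by (simp only: linear_add[OF lB] linear_scale[OF lB])
    also have "\<dots> = 0" by (subst Bk[of 1], subst Bk[of \<i>]) (simp add: algebra_simps)
    finally have "B v = 0" .
    moreover have "v \<noteq> 0" using False unfolding v_def by (auto simp: complex_eq_iff)
    ultimately show ?thesis by blast
  qed
  then show "real_eigenvalue A (slant \<eta> (A 1))" unfolding real_eigenvalue_def B_def l_def by auto
qed

context wc_map
begin

text \<open>On the three sides other than the left one the branch is bounded, so the level sets \<open>X w = a\<close> of the
  lifted slant \<open>X\<close> avoid them for large \<open>a\<close>. A point of such a level set with the largest slant \<open>M a\<close> is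
  an interior point of the box, and near its lift \<open>F\<close> has a conditional maximum: this makes
  \<open>slant \<eta>\<close> a left eigenvector of the derivative and its eigenvalue a subslope of \<open>M\<close>. The factor \<open>\<epsilon>\<close>
  treats the bounds from above and below together.\<close>

lemma escape_box_bounded_above:
  assumes h: "escape_box p b0 b1 d \<eta> c" and eps: "\<epsilon> = 1 \<or> \<epsilon> = - 1"
  shows "\<exists>C. \<forall>w\<in>slant_box b0 b1 d \<eta> c. \<epsilon> * slant \<eta> (branch p w) \<le> C"
proof (rule ccontr)
  assume "\<not> ?thesis"
  then have unb: "\<exists>w\<in>slant_box b0 b1 d \<eta> c. \<epsilon> * slant \<eta> (branch p w) > C" for C by (meson not_le)
  define K where "K = slant_box b0 b1 d \<eta> c"
  define X where "X w = \<epsilon> * slant \<eta> (branch p w)" for w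
  have KOm: "K \<subseteq> lift_dom p" using escape_boxD(1)[OF h] K_def by simp
  have conX: "continuous_on K X" unfolding X_def by (intro continuous_intros continuous_on_branch KOm)
  have conK: "connected K" unfolding K_def by (intro convex_connected slant_box_convex)
  have b01: "b0 \<le> b1" using escape_boxD(2)[OF h] by (auto simp: slant_box_def left_strip_def)
  have dline: "c < d + \<eta> * b" if "b0 \<le> b" "b \<le> b1" for b using escape_box_line[OF h that] by simp
  define Sd where "Sd = {w \<in> left_strip b0 b1 d. c \<le> slant \<eta> w} \<inter> {w. Im w = b0 \<or> Im w = b1 \<or> Re w = d}"
  have "closed {w. Im w = b0 \<or> Im w = b1 \<or> Re w = d}"
    by (intro closed_Collect_disj closed_Collect_eq continuous_intros)
  then have cSd: "compact Sd" unfolding Sd_def by (intro compact_Int_closed compact_left_strip_slant)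
  have SdOm: "Sd \<subseteq> lift_dom p"
  proof
    fix w assume w: "w \<in> Sd"
    show "w \<in> lift_dom p"
    proof (cases "c < slant \<eta> w")
      case True then show ?thesis using w KOm unfolding Sd_def K_def slant_box_def by auto
    next
      case False
      then have oc: "slant \<eta> w = c" using w by (auto simp: Sd_def)
      then have "Re w \<noteq> d" using dline[of "Im w"] w by (auto simp: Sd_def left_strip_def slant_def)
      moreover have "w = Complex (c - \<eta> * Im w) (Im w)" using oc by (simp add: slant_def complex_eq_iff)
      ultimately show ?thesis using w escape_boxD(5,6)[OF h] by (auto simp: Sd_def)
    qed
  qed
  have "bounded (X ` Sd)" unfolding X_def
    by (intro compact_imp_bounded compact_continuous_image continuous_intros continuous_on_branch SdOm cSd)
  then obtain a0 where a0: "\<And>w. w \<in> Sd \<Longrightarrow> X w \<le> a0"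
    using bounded_imp_bdd_above unfolding bdd_above_def by (metis imageI)
  have side: "w \<in> Sd" if "w \<in> K" "Im w = b0 \<or> Im w = b1 \<or> Re w = d" for w
    using that unfolding K_def slant_box_def Sd_def by auto
  define w1 where "w1 = Complex d b1"
  have w1: "w1 \<in> K" "X w1 \<le> a0"
  proof -
    show "w1 \<in> K" unfolding K_def slant_box_def left_strip_def w1_def slant_def using dline[of b1] b01 by auto
    then show "X w1 \<le> a0" by (intro a0 side) (auto simp: w1_def)
  qed
  have lev: "\<exists>w\<in>K. X w = a" if "a > a0" for a
  proof -
    obtain w2 where w2: "w2 \<in> K" "X w2 > a" using unb[of a] unfolding K_def X_def by auto
    have "connected (X ` K)" by (rule connected_continuous_image[OF conX conK])
    then have "{X w1..X w2} \<subseteq> X ` K" using w1 w2 by (intro connected_contains_Icc) auto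
    moreover have "a \<in> {X w1..X w2}" using w1 w2 that by auto
    ultimately show ?thesis by (auto simp: image_iff)
  qed
  have cmp: "compact {w \<in> left_strip b0 b1 d. s \<le> slant \<eta> w}" for s by (rule compact_left_strip_slant)
  have cmpK: "{w \<in> left_strip b0 b1 d. s \<le> slant \<eta> w} \<subseteq> K" if "s > c" for s using that unfolding K_def slant_box_def by auto
  have "\<exists>w. w \<in> K \<and> X w = a \<and> (\<forall>v\<in>K. X v = a \<longrightarrow> slant \<eta> v \<le> slant \<eta> w)" if a: "a > a0" for a
  proof -
    obtain w' where w': "w' \<in> K" "X w' = a" using lev[OF a] by auto
    define Q where "Q = {w \<in> left_strip b0 b1 d. slant \<eta> w' \<le> slant \<eta> w}"
    have wc: "slant \<eta> w' > c" using w'(1) unfolding K_def slant_box_def by auto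
    have QK: "Q \<subseteq> K" unfolding Q_def using cmpK wc by auto
    have "closed (Q \<inter> X -` {a})"
    proof (rule continuous_closed_preimage)
      show "continuous_on Q X" by (rule continuous_on_subset[OF conX QK])
      show "closed Q" unfolding Q_def by (rule compact_imp_closed[OF cmp])
    qed auto
    then have "compact (Q \<inter> (Q \<inter> X -` {a}))" unfolding Q_def by (intro compact_Int_closed cmp)
    moreover have "w' \<in> Q \<inter> (Q \<inter> X -` {a})" using w' unfolding Q_def K_def slant_box_def by auto
    ultimately obtain w where w: "w \<in> Q \<inter> (Q \<inter> X -` {a})" "\<forall>v\<in>Q \<inter> (Q \<inter> X -` {a}). slant \<eta> v \<le> slant \<eta> w"
      using continuous_attains_sup[OF _ _ continuous_on_slant[OF continuous_on_id], of "Q \<inter> (Q \<inter> X -` {a})" \<eta>]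
      by blast
    have "slant \<eta> v \<le> slant \<eta> w" if v: "v \<in> K" "X v = a" for v
    proof (cases "slant \<eta> w' \<le> slant \<eta> v")
      case True
      then have "v \<in> Q \<inter> (Q \<inter> X -` {a})" using v unfolding Q_def K_def slant_box_def by auto
      then show ?thesis using w(2) by auto
    next
      case False
      then show ?thesis using w(1) unfolding Q_def by auto
    qed
    then show ?thesis using w(1) QK by auto
  qed
  then obtain W where W: "\<And>a. a > a0 \<Longrightarrow> W a \<in> K" "\<And>a. a > a0 \<Longrightarrow> X (W a) = a"
    "\<And>a v. a > a0 \<Longrightarrow> v \<in> K \<Longrightarrow> X v = a \<Longrightarrow> slant \<eta> v \<le> slant \<eta> (W a)" by metis
  define M where "M a = slant \<eta> (W a)" for a
  have Mc: "M a > c" if "a > a0" for a using W(1)[OF that] unfolding M_def K_def slant_box_def by auto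
  have bK: "bounded K"
    by (rule bounded_subset[OF compact_imp_bounded[OF cmp[of c]]]) (auto simp: K_def slant_box_def)
  then obtain Bk where Bk: "\<And>w. w \<in> K \<Longrightarrow> cmod w \<le> Bk" by (meson bounded_iff)
  have Mb: "\<bar>M a\<bar> \<le> (1 + \<bar>\<eta>\<bar>) * Bk" if "a > a0" for a
    using slant_abs_le[of \<eta> "W a"] mult_left_mono[OF Bk[OF W(1)[OF that]], of "1 + \<bar>\<eta>\<bar>"]
    unfolding M_def by linarith
  have usc: "usc_at M a" if a: "a > a0" for a
    unfolding usc_at_def
  proof (intro allI impI, rule ccontr)
    fix e :: real assume e: "e > 0" and neg: "\<not> (\<exists>\<delta>>0. \<forall>t. \<bar>t - a\<bar> < \<delta> \<longrightarrow> M t < M a + e)"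
    have "\<exists>t. \<bar>t - a\<bar> < min (a - a0) (1 / real (Suc n)) \<and> M t \<ge> M a + e" for n
      using neg a by (metis diff_gt_0_iff_gt less_divide_eq_1 not_le min_less_iff_conj of_nat_0_less_iff zero_less_Suc zero_less_divide_1_iff)
    then obtain t where t: "\<And>n. \<bar>t n - a\<bar> < min (a - a0) (1 / real (Suc n))" "\<And>n. M (t n) \<ge> M a + e" by metis
    have ta: "t n > a0" for n using t(1)[of n] by linarith
    have lim: "t \<longlonglongrightarrow> a"
    proof (rule LIM_zero_cancel, rule Lim_null_comparison)
      show "(\<lambda>n. 1 / real (Suc n)) \<longlonglongrightarrow> 0" using LIMSEQ_inverse_real_of_nat by (simp add: inverse_eq_divide)
      show "\<forall>\<^sub>F n in sequentially. norm (t n - a) \<le> 1 / real (Suc n)"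
        by (rule always_eventually, rule allI) (use t(1) in \<open>auto intro: less_imp_le\<close>)
    qed
    define Q where "Q = {w \<in> left_strip b0 b1 d. M a + e \<le> slant \<eta> w}"
    have QK: "Q \<subseteq> K" unfolding Q_def using Mc[OF a] e by (intro cmpK) auto
    have WQ: "W (t n) \<in> Q" for n
      using W(1)[OF ta] t(2)[of n] unfolding Q_def M_def K_def slant_box_def by auto
    have "seq_compact Q" unfolding Q_def using cmp compact_imp_seq_compact by blast
    then obtain w r where w: "w \<in> Q" "strict_mono r" "((\<lambda>n. W (t n)) \<circ> r) \<longlonglongrightarrow> w"
      using WQ unfolding seq_compact_def by metis
    have "\<forall>\<^sub>F n in sequentially. ((\<lambda>n. W (t n)) \<circ> r) n \<in> K"
      by (rule always_eventually, rule allI) (use WQ QK in auto)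
    from continuous_on_tendsto_compose[OF conX w(3) subsetD[OF QK w(1)] this]
    have "((\<lambda>n. X (W (t n))) \<circ> r) \<longlonglongrightarrow> X w" by (simp add: o_def)
    moreover have "((\<lambda>n. X (W (t n))) \<circ> r) \<longlonglongrightarrow> a"
      using LIMSEQ_subseq_LIMSEQ[OF lim w(2)] W(2)[OF ta] by (simp add: o_def)
    ultimately have "X w = a" by (rule LIMSEQ_unique)
    then have "slant \<eta> w \<le> M a" using W(3)[OF a] w(1) QK unfolding M_def by auto
    then show False using w(1) e unfolding Q_def by auto
  qed
  have touch: "\<exists>l. real_eigenvalue (F' (branch p (W a))) l \<and> subslope M a (\<epsilon> * l)" if a: "a > a0" for a
  proof -
    define q where "q = branch p (W a)"
    have WK: "W a \<in> K" by (rule W(1)[OF a])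
    have WOm: "W a \<in> lift_dom p" using WK KOm by auto
    have Fq: "F q = W a" using WOm q_def by simp
    obtain V where V: "open V" "q \<in> V" "\<And>x. x \<in> V \<Longrightarrow> F x \<in> lift_dom p \<and> branch p (F x) = x"
      using local_section_at_branch[OF WOm] unfolding q_def by metis
    define I where "I = {w. b0 < Im w \<and> Im w < b1 \<and> Re w < d \<and> c < slant \<eta> w}"
    have oI: "open I" unfolding I_def by (intro open_Collect_conj open_Collect_less continuous_intros)
    have IK: "I \<subseteq> K" unfolding I_def K_def slant_box_def left_strip_def by auto
    have "W a \<in> I"
    proof (rule ccontr)
      assume "W a \<notin> I"
      then have "W a \<in> Sd" using WK by (intro side) (auto simp: I_def K_def slant_box_def left_strip_def)
      then show False using a0 W(2)[OF a] a by force
    qed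
    then have qV: "q \<in> V \<inter> F -` I" using V(2) Fq by auto
    have oV: "open (V \<inter> F -` I)" using V(1) oI cont_F by (simp add: continuous_on_open_vimage open_Int)
    have XF: "F x \<in> K" "X (F x) = \<epsilon> * slant \<eta> x" if "x \<in> V \<inter> F -` I" for x
      using that V(3)[of x] IK unfolding X_def by auto
    have aq: "a = \<epsilon> * slant \<eta> q" using XF(2)[OF qV] W(2)[OF a] Fq by simp
    have MF: "M (\<epsilon> * slant \<eta> x) \<ge> slant \<eta> (F x)" if "x \<in> V \<inter> F -` I" "\<epsilon> * slant \<eta> x > a0" for x
      unfolding M_def using W(3)[OF that(2) XF(1)[OF that(1)] XF(2)[OF that(1)]] .
    obtain \<delta>0 where d0: "\<delta>0 > 0" "ball q \<delta>0 \<subseteq> V \<inter> F -` I" using oV qV open_contains_ball by meson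
    have linA: "linear (F' q)" using der[of q] has_derivative_linear by blast
    have dl: "((\<lambda>t. slant \<eta> (F (q + t *\<^sub>R z))) has_real_derivative slant \<eta> (F' q z)) (at 0)" for z
    proof -
      have "((\<lambda>t::real. q + t *\<^sub>R z) has_derivative (\<lambda>t. t *\<^sub>R z)) (at 0)"
        by (auto intro!: derivative_eq_intros)
      moreover have "(F has_derivative F' q) (at (q + 0 *\<^sub>R z))" using der by simp
      ultimately have "((\<lambda>t. F (q + t *\<^sub>R z)) has_derivative (\<lambda>t. F' q (t *\<^sub>R z))) (at 0)"
        by (rule has_derivative_compose)
      then have "((\<lambda>t. slant \<eta> (F (q + t *\<^sub>R z))) has_derivative (\<lambda>t. slant \<eta> (F' q (t *\<^sub>R z)))) (at 0)"
        unfolding slant_def by (auto intro!: derivative_eq_intros)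
      moreover have "(\<lambda>t. slant \<eta> (F' q (t *\<^sub>R z))) = (*) (slant \<eta> (F' q z))"
        by (auto simp: linear_scale[OF linA] slant_scaleR mult.commute)
      ultimately show ?thesis by (simp add: has_field_derivative_def)
    qed
    have ker: "slant \<eta> (F' q z) = 0" if z: "slant \<eta> z = 0" for z
    proof (rule DERIV_local_max[OF dl[of z]])
      define \<delta> where "\<delta> = \<delta>0 / (cmod z + 1)"
      show "\<delta> > 0" unfolding \<delta>_def using d0(1) by (intro divide_pos_pos) (auto simp: add_nonneg_pos)
      show "\<forall>y. \<bar>0 - y\<bar> < \<delta> \<longrightarrow> slant \<eta> (F (q + y *\<^sub>R z)) \<le> slant \<eta> (F (q + 0 *\<^sub>R z))"
      proof (intro allI impI)
        fix y :: real assume y: "\<bar>0 - y\<bar> < \<delta>"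
        have "\<bar>y\<bar> * cmod z \<le> \<bar>y\<bar> * (cmod z + 1)" by (intro mult_left_mono) auto
        also have "\<dots> < \<delta> * (cmod z + 1)" using y by (intro mult_strict_right_mono) (auto simp: add_nonneg_pos)
        also have "\<dots> = \<delta>0" unfolding \<delta>_def using add_nonneg_pos[of "cmod z" 1] by simp
        finally have "q + y *\<^sub>R z \<in> ball q \<delta>0" by (simp add: dist_norm)
        then have xV: "q + y *\<^sub>R z \<in> V \<inter> F -` I" using d0 by auto
        have "\<epsilon> * slant \<eta> (q + y *\<^sub>R z) = a" using z aq by (simp add: slant_add slant_scaleR)
        then have "slant \<eta> (F (q + y *\<^sub>R z)) \<le> M a" using MF[OF xV] a by simp
        then show "slant \<eta> (F (q + y *\<^sub>R z)) \<le> slant \<eta> (F (q + 0 *\<^sub>R z))" using Fq by (simp add: M_def)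
      qed
    qed
    define l where "l = slant \<eta> (F' q 1)"
    have eig: "real_eigenvalue (F' q) l" unfolding l_def by (rule slant_kernel_eigenvalue(1)[OF linA ker])
    have e2: "\<epsilon> * \<epsilon> = 1" "\<bar>\<epsilon>\<bar> = 1" using eps by auto
    have "subslope M a (\<epsilon> * l)"
      unfolding subslope_def
    proof (intro allI impI)
      fix e :: real assume e: "e > 0"
      have "((\<lambda>t. slant \<eta> (F (q + t *\<^sub>R complex_of_real \<epsilon>))) has_real_derivative \<epsilon> * l) (at 0)"
        using dl[of "of_real \<epsilon>"] linear_scale[OF linA, of \<epsilon> 1] unfolding l_def
        by (simp add: scaleR_conv_of_real flip: slant_scaleR)
      then have "((\<lambda>t. slant \<eta> (F (q + t *\<^sub>R complex_of_real \<epsilon>))) has_derivative (*) (\<epsilon> * l)) (at 0)"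
        by (simp add: has_field_derivative_def)
      then obtain \<delta>1 where d1: "\<delta>1 > 0" "\<And>t. \<bar>t\<bar> < \<delta>1 \<Longrightarrow>
        \<bar>slant \<eta> (F (q + t *\<^sub>R complex_of_real \<epsilon>)) - slant \<eta> (F q) - \<epsilon> * l * t\<bar> \<le> e * \<bar>t\<bar>"
        using e unfolding has_derivative_at_alt by (auto simp: ) 
      define \<delta> where "\<delta> = min \<delta>1 (min \<delta>0 (a - a0))"
      have "M (a + h) \<ge> M a + \<epsilon> * l * h - e * \<bar>h\<bar>" if h: "\<bar>h\<bar> < \<delta>" for h
      proof -
        have xb: "q + h *\<^sub>R complex_of_real \<epsilon> \<in> V \<inter> F -` I"
          using d0(2) h e2(2) unfolding \<delta>_def by (auto simp: subset_iff dist_norm)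
        have xa: "\<epsilon> * slant \<eta> (q + h *\<^sub>R complex_of_real \<epsilon>) = a + h"
        proof -
          have "slant \<eta> (q + h *\<^sub>R complex_of_real \<epsilon>) = slant \<eta> q + h * \<epsilon>" by (simp add: slant_def)
          then have "\<epsilon> * slant \<eta> (q + h *\<^sub>R complex_of_real \<epsilon>) = \<epsilon> * slant \<eta> q + h * (\<epsilon> * \<epsilon>)"
            by (simp only: distrib_left mult.left_commute)
          then show ?thesis using e2(1) aq by simp
        qed
        have "M (a + h) \<ge> slant \<eta> (F (q + h *\<^sub>R complex_of_real \<epsilon>))" using MF[OF xb] xa h unfolding \<delta>_def by auto
        moreover have "\<bar>slant \<eta> (F (q + h *\<^sub>R complex_of_real \<epsilon>)) - slant \<eta> (F q) - \<epsilon> * l * h\<bar> \<le> e * \<bar>h\<bar>"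
          using d1(2)[of h] h unfolding \<delta>_def by auto
        ultimately show ?thesis using arg_cong[OF Fq, of "slant \<eta>"] unfolding M_def by linarith
      qed
      moreover have "\<delta> > 0" unfolding \<delta>_def using d1 d0 a by auto
      ultimately show "\<exists>\<delta>>0. \<forall>h. \<bar>h\<bar> < \<delta> \<longrightarrow> M (a + h) \<ge> M a + \<epsilon> * l * h - e * \<bar>h\<bar>" by blast
    qed
    then show ?thesis using eig unfolding q_def by blast
  qed
  \<comment> \<open>The \<open>W\<close>-condition in the direction of the normal of the left side.\<close>
  define n where "n = sqrt (1 + \<eta>\<^sup>2)"
  have n: "n \<ge> 1" "n * n = 1 + \<eta>\<^sup>2" unfolding n_def by (auto simp: real_le_rsqrt simp flip: power2_eq_square)
  define u where "u = complex_of_real (\<epsilon> / n) * Complex 1 \<eta>"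
  have "cmod (Complex 1 \<eta>) = n" unfolding n_def cmod_def by simp
  then have "cmod u = \<bar>\<epsilon> / n\<bar> * n" unfolding u_def norm_mult norm_of_real by (rule arg_cong)
  then have u1: "cmod u = 1" using eps n(1) by auto
  have ru: "Re (cnj u * z) = \<epsilon> * slant \<eta> z / n" for z unfolding u_def slant_def using n(1) by (simp add: field_simps)
  obtain c0 r0 where c0: "c0 > 0" "r0 > 0"
    "\<And>q l. Re (cnj u * q) \<ge> r0 \<Longrightarrow> F q \<in> K \<Longrightarrow> real_eigenvalue (F' q) l \<Longrightarrow> \<bar>l\<bar> \<ge> c0 / P (Re (cnj u * q))"
    using eigenvalue_bound[OF u1 bK] by metis
  define a1 where "a1 = max (max a0 0) (n * r0)"
  have a1: "a > a0" "a / n > 0" "a / n \<ge> r0" if "a > a1" for a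
    using that n(1) unfolding a1_def by (auto simp: field_simps)
  show False
  proof (rule usc_subslope_contradiction[where M=M and ?a1.0=a1 and B="(1 + \<bar>\<eta>\<bar>) * Bk" and \<rho>="\<lambda>a. c0 / P (a / n)" and T=n])
    fix a assume a: "a > a1"
    show "usc_at M a" "\<bar>M a\<bar> \<le> (1 + \<bar>\<eta>\<bar>) * Bk" using usc Mb a1(1)[OF a] by auto
    show "c0 / P (a / n) > 0" using c0(1) P_pos[OF a1(2)[OF a]] by simp
    obtain l where l: "real_eigenvalue (F' (branch p (W a))) l" "subslope M a (\<epsilon> * l)" using touch[OF a1(1)[OF a]] by auto
    have Wk: "W a \<in> K" by (rule W(1)[OF a1(1)[OF a]])
    have re: "Re (cnj u * branch p (W a)) = a / n" using W(2)[OF a1(1)[OF a]] unfolding ru X_def by simp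
    have "\<bar>l\<bar> \<ge> c0 / P (a / n)"
      using c0(3)[of "branch p (W a)" l] re a1(3)[OF a] l(1) Wk KOm by (auto simp: subset_iff)
    moreover have "\<bar>\<epsilon> * l\<bar> = \<bar>l\<bar>" using eps by (auto simp: abs_mult)
    ultimately show "\<exists>l. \<bar>l\<bar> \<ge> c0 / P (a / n) \<and> subslope M a l" using l(2) by metis
  next
    fix a b assume ab: "a1 < a" "a \<le> b"
    have "P (a / n) \<le> P (b / n)" using a1(2)[OF ab(1)] ab(2) n(1) by (intro P_mono) (auto simp: divide_right_mono)
    then show "c0 / P (b / n) \<le> c0 / P (a / n)" using c0(1) P_pos[OF a1(2)[OF ab(1)]]
      by (intro divide_left_mono) auto
  next
    fix R :: real and m :: nat
    obtain k where k: "k \<ge> m" "(\<Sum>i=m..<k. 1 / P (real (Suc i))) > R / c0"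
      using slow_function_sum_diverges[OF slow] by blast
    have "(\<Sum>i=m..<k. c0 / P (n * real (Suc i) / n)) = c0 * (\<Sum>i=m..<k. 1 / P (real (Suc i)))"
      using n(1) by (simp add: sum_distrib_left)
    also have "\<dots> > R" using k(2) c0(1) by (simp add: field_simps)
    finally show "\<exists>k\<ge>m. (\<Sum>i=m..<k. c0 / P (n * real (Suc i) / n)) > R" using k(1) by auto
  qed (use n in auto)
qed

lemma escape_box_bounded:
  assumes h: "escape_box p b0 b1 d \<eta> c"
  obtains C where "\<And>w. w \<in> slant_box b0 b1 d \<eta> c \<Longrightarrow> \<bar>slant \<eta> (branch p w)\<bar> \<le> C"
proof -
  obtain C1 where C1: "\<forall>w\<in>slant_box b0 b1 d \<eta> c. 1 * slant \<eta> (branch p w) \<le> C1"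
    using escape_box_bounded_above[OF h, of 1] by auto
  obtain C2 where C2: "\<forall>w\<in>slant_box b0 b1 d \<eta> c. - 1 * slant \<eta> (branch p w) \<le> C2"
    using escape_box_bounded_above[OF h, of "- 1"] by auto
  have "\<bar>slant \<eta> (branch p w)\<bar> \<le> max C1 C2" if "w \<in> slant_box b0 b1 d \<eta> c" for w
    using C1 C2 that by (fastforce simp: max_def)
  then show ?thesis using that by blast
qed

end

section \<open>A fan of slants and its tip\<close>

text \<open>A family of escape boxes with common obstacles \<open>N\<close> and with slopes in an open interval, for which
  the bound of \<open>escape_box_bounded\<close> is uniform.\<close>

locale fan = wc_map F F' P for F F' P +
  fixes p :: complex and b0 b1 d :: real and N :: "complex set" and j0 j1 C :: real
  assumes j: "j0 < j1" and N: "compact N" "N \<noteq> {}" "N \<subseteq> left_strip b0 b1 d - lift_dom p"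
    and hr: "\<And>\<eta>. j0 < \<eta> \<Longrightarrow> \<eta> < j1 \<Longrightarrow> escape_box p b0 b1 d \<eta> (support N \<eta>)"
    and mem: "\<And>\<eta> w. j0 < \<eta> \<Longrightarrow> \<eta> < j1 \<Longrightarrow> w \<in> left_strip b0 b1 d \<Longrightarrow> w \<notin> lift_dom p \<Longrightarrow> support N \<eta> \<le> slant \<eta> w \<Longrightarrow> w \<in> N"
    and bd: "\<And>\<eta> w. j0 < \<eta> \<Longrightarrow> \<eta> < j1 \<Longrightarrow> w \<in> slant_box b0 b1 d \<eta> (support N \<eta>) \<Longrightarrow> \<bar>slant \<eta> (branch p w)\<bar> \<le> C"

context wc_map
begin

text \<open>The slopes at which the bound \<open>n\<close> holds form a closed set, since a point of a box also lies in the
  boxes of all nearby slopes. By Baire's theorem one of these sets contains an interval.\<close>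

lemma escape_box_imp_fan:
  assumes h: "escape_box p b0 b1 d \<eta>0 c"
  obtains N j0 j1 C where "fan F F' P p b0 b1 d N j0 j1 C"
proof -
  define N where "N = obstacle p b0 b1 d \<eta>0 (c - 1)"
  have cN: "compact N" unfolding N_def by (rule compact_obstacle)
  have ne: "N \<noteq> {}" using escape_box_tilt(1)[OF h N_def] .
  have "eventually (\<lambda>\<eta>. escape_box p b0 b1 d \<eta> (support N \<eta>) \<and>
     (\<forall>w\<in>left_strip b0 b1 d. w \<notin> lift_dom p \<longrightarrow> support N \<eta> \<le> slant \<eta> w \<longrightarrow> w \<in> N)) (nhds \<eta>0)"
    using escape_box_tilt(3)[OF h N_def] escape_box_tilt(4)[OF h N_def] by eventually_elim auto
  then obtain \<epsilon> where e: "\<epsilon> > 0" "\<And>\<eta>. dist \<eta> \<eta>0 < \<epsilon> \<Longrightarrow> escape_box p b0 b1 d \<eta> (support N \<eta>)"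
    "\<And>\<eta> w. dist \<eta> \<eta>0 < \<epsilon> \<Longrightarrow> w \<in> left_strip b0 b1 d \<Longrightarrow> w \<notin> lift_dom p \<Longrightarrow> support N \<eta> \<le> slant \<eta> w \<Longrightarrow> w \<in> N"
    unfolding eventually_nhds_metric by blast
  define I where "I = {\<eta>0 - \<epsilon>/2..\<eta>0 + \<epsilon>/2}"
  have I: "dist \<eta> \<eta>0 < \<epsilon>" if "\<eta> \<in> I" for \<eta> using that e(1) unfolding I_def dist_real_def by auto
  define A where "A n = {\<eta> \<in> I. \<forall>w\<in>slant_box b0 b1 d \<eta> (support N \<eta>). \<bar>slant \<eta> (branch p w)\<bar> \<le> real n}" for n
  have clA: "closed (A n)" for n
    unfolding closed_sequential_limits
  proof (intro allI impI, elim conjE)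
    fix x l assume x: "\<forall>k. x k \<in> A n" "x \<longlonglongrightarrow> l"
    have lI: "l \<in> I" using closed_sequentially[of I x l] x unfolding A_def I_def by auto
    have "\<bar>slant l (branch p w)\<bar> \<le> real n" if w: "w \<in> slant_box b0 b1 d l (support N l)" for w
    proof -
      have "(\<lambda>k. slant (x k) w - support N (x k)) \<longlonglongrightarrow> slant l w - support N l"
        by (intro tendsto_diff tendsto_slant tendsto_const x(2) tendsto_support[OF cN ne])
      then have "eventually (\<lambda>k. slant (x k) w - support N (x k) > 0) sequentially"
        by (rule order_tendstoD) (use w in \<open>auto simp: slant_box_def\<close>)
      then have ev: "eventually (\<lambda>k. \<bar>slant (x k) (branch p w)\<bar> \<le> real n) sequentially"
      proof eventually_elim
        case (elim k)
        then have "w \<in> slant_box b0 b1 d (x k) (support N (x k))" using w by (auto simp: slant_box_def)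
        then show ?case using x(1) unfolding A_def by auto
      qed
      have "(\<lambda>k. \<bar>slant (x k) (branch p w)\<bar>) \<longlonglongrightarrow> \<bar>slant l (branch p w)\<bar>"
        by (intro tendsto_rabs tendsto_slant tendsto_const x(2))
      then show ?thesis by (rule tendsto_upperbound[OF _ ev]) simp
    qed
    then show "l \<in> A n" unfolding A_def using lI by auto
  qed
  have cov: "\<exists>n. \<eta> \<in> A n" if \<eta>I: "\<eta> \<in> I" for \<eta>
  proof -
    obtain C where C: "\<And>w. w \<in> slant_box b0 b1 d \<eta> (support N \<eta>) \<Longrightarrow> \<bar>slant \<eta> (branch p w)\<bar> \<le> C"
      using escape_box_bounded[OF e(2)[OF I[OF \<eta>I]]] by metis
    obtain n :: nat where "C \<le> real n" using real_arch_simple by blast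
    then have "\<eta> \<in> A n" unfolding A_def using \<eta>I C by force
    then show ?thesis ..
  qed
  have "\<exists>n. \<not> I \<subseteq> closure (I - A n)"
  proof (rule ccontr)
    assume "\<not> ?thesis"
    then have "I \<subseteq> closure (\<Inter>(range (\<lambda>n. I - A n)))"
    proof (intro Baire)
      show "closed I" unfolding I_def by simp
      show "countable (range (\<lambda>n. I - A n))" by simp
      fix T assume "T \<in> range (\<lambda>n. I - A n)"
      then obtain n where T: "T = I \<inter> - A n" by auto
      show "openin (top_of_set I) T \<and> I \<subseteq> closure T"
        using \<open>\<not> (\<exists>n. \<not> I \<subseteq> closure (I - A n))\<close> clA unfolding T by (auto simp: Diff_eq open_Compl)
    qed
    moreover have "\<Inter>(range (\<lambda>n. I - A n)) = {}" using cov by auto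
    ultimately have "I \<subseteq> closure {}" by (simp only:)
    then have "I = {}" by simp
    then show False using e(1) unfolding I_def by auto
  qed
  then obtain n x where x: "x \<in> I" "x \<notin> closure (I - A n)" by auto
  then obtain r where r: "r > 0" "ball x r \<inter> (I - A n) = {}"
    unfolding closure_approachable by (fastforce simp: dist_commute)
  define j0 where "j0 = max (x - r) (\<eta>0 - \<epsilon>/2)"
  define j1 where "j1 = min (x + r) (\<eta>0 + \<epsilon>/2)"
  have jj: "j0 < j1" using x(1) r(1) e(1) unfolding j0_def j1_def I_def by auto
  have inA: "\<eta> \<in> A n" "\<eta> \<in> I" if "j0 < \<eta>" "\<eta> < j1" for \<eta>
  proof -
    show "\<eta> \<in> I" using that unfolding j0_def j1_def I_def by auto
    moreover have "\<eta> \<in> ball x r" using that unfolding j0_def j1_def by (auto simp: dist_real_def)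
    ultimately show "\<eta> \<in> A n" using r(2) by auto
  qed
  have "fan F F' P p b0 b1 d N j0 j1 (real n)"
  proof unfold_locales
    show "j0 < j1" by (rule jj)
    show "compact N" "N \<noteq> {}" by (rule cN, rule ne)
    show "N \<subseteq> left_strip b0 b1 d - lift_dom p" unfolding N_def obstacle_def by auto
  next
    fix \<eta> assume \<eta>: "j0 < \<eta>" "\<eta> < j1"
    show "escape_box p b0 b1 d \<eta> (support N \<eta>)" by (rule e(2)[OF I[OF inA(2)[OF \<eta>]]])
    fix w
    show "w \<in> left_strip b0 b1 d \<Longrightarrow> w \<notin> lift_dom p \<Longrightarrow> support N \<eta> \<le> slant \<eta> w \<Longrightarrow> w \<in> N"
      by (rule e(3)[OF I[OF inA(2)[OF \<eta>]]])
    show "w \<in> slant_box b0 b1 d \<eta> (support N \<eta>) \<Longrightarrow> \<bar>slant \<eta> (branch p w)\<bar> \<le> real n"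
      using inA(1)[OF \<eta>] unfolding A_def by auto
  qed
  then show ?thesis by (rule that)
qed

end

context fan
begin

abbreviation K :: "real \<Rightarrow> complex set" where "K \<eta> \<equiv> slant_box b0 b1 d \<eta> (support N \<eta>)"

lemma K_lift_dom: "j0 < \<eta> \<Longrightarrow> \<eta> < j1 \<Longrightarrow> K \<eta> \<subseteq> lift_dom p" using hr escape_boxD(1) by blast

lemma N_box: "e \<in> N \<Longrightarrow> e \<in> left_strip b0 b1 d" and N_lift_dom: "e \<in> N \<Longrightarrow> e \<notin> lift_dom p" using N(3) by auto

text \<open>Supporting points are subgradients of the convex support function, hence monotone in the slope.\<close>

lemma maximizer_mono:
  assumes e: "e \<in> N" "slant \<eta> e = support N \<eta>" "e' \<in> N" "slant \<eta>' e' = support N \<eta>'" "\<eta> < \<eta>'"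
  shows "Im e \<le> Im e'"
proof -
  have "slant \<eta> e' \<le> slant \<eta> e" "slant \<eta>' e \<le> slant \<eta>' e'"
    using support_upper[OF N(1), of e' \<eta>] support_upper[OF N(1), of e \<eta>'] e by auto
  then have "(\<eta>' - \<eta>) * (Im e' - Im e) \<ge> 0" by (simp add: slant_def algebra_simps)
  then show ?thesis using e(5) by (simp add: zero_le_mult_iff)
qed

text \<open>A selection of supporting points is monotone in the slope, so it is continuous at some slope; there
  monotonicity from both sides pins down every supporting point.\<close>

lemma unique_tip:
  obtains \<eta>0 e0 where "j0 < \<eta>0" "\<eta>0 < j1" "e0 \<in> N" "slant \<eta>0 e0 = support N \<eta>0"
    "\<And>e. e \<in> N \<Longrightarrow> slant \<eta>0 e = support N \<eta>0 \<Longrightarrow> e = e0"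
proof -
  have "\<exists>e. e \<in> N \<and> slant \<eta> e = support N \<eta>" for \<eta> using support_attained[OF N(1,2)] by metis
  then obtain E where E: "\<And>\<eta>. E \<eta> \<in> N" "\<And>\<eta>. slant \<eta> (E \<eta>) = support N \<eta>" by metis
  have "mono_on {j0<..<j1} (\<lambda>\<eta>. Im (E \<eta>))"
    unfolding mono_on_def using maximizer_mono E by (metis le_less order_refl)
  then have "countable {a \<in> {j0<..<j1}. \<not> isCont (\<lambda>\<eta>. Im (E \<eta>)) a}"
    by (intro mono_on_ctble_discont_open) auto
  moreover have "uncountable {j0<..<j1}" using uncountable_open_interval j by blast
  ultimately obtain \<eta>0 where e0: "\<eta>0 \<in> {j0<..<j1}" "isCont (\<lambda>\<eta>. Im (E \<eta>)) \<eta>0"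
    by (metis (mono_tags, lifting) countable_subset mem_Collect_eq subsetI)
  have uq: "e = E \<eta>0" if e: "e \<in> N" "slant \<eta>0 e = support N \<eta>0" for e
  proof -
    have seq: "(\<lambda>n. \<eta>0 + s / real (Suc n)) \<longlonglongrightarrow> \<eta>0" for s
      using tendsto_add[OF tendsto_const tendsto_mult[OF tendsto_const LIMSEQ_inverse_real_of_nat], of \<eta>0 s]
      by (simp add: divide_inverse)
    have lim: "(\<lambda>n. Im (E (\<eta>0 + s / real (Suc n)))) \<longlonglongrightarrow> Im (E \<eta>0)" for s
      using isCont_tendsto_compose[OF e0(2) seq] .
    have "Im (E \<eta>0) \<le> Im e"
      by (rule LIMSEQ_le_const2[OF lim[of "- 1"]])
        (intro exI[of _ 0] allI impI maximizer_mono[OF E e], simp)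
    moreover have "Im e \<le> Im (E \<eta>0)"
      by (rule LIMSEQ_le_const[OF lim[of 1]])
        (intro exI[of _ 0] allI impI maximizer_mono[OF e E], simp)
    ultimately have "Im e = Im (E \<eta>0)" by simp
    then show ?thesis using e(2) E(2)[of \<eta>0] by (simp add: slant_def complex_eq_iff)
  qed
  show ?thesis by (rule that[OF _ _ E(1) E(2) uq]) (use e0(1) in auto)
qed

lemma maximizer_limit:
  assumes "\<And>n::nat. e n \<in> N" "\<And>n. slant (\<eta> n) (e n) = support N (\<eta> n)" "\<eta> \<longlonglongrightarrow> \<eta>'" "e \<longlonglongrightarrow> l"
  shows "l \<in> N" "slant \<eta>' l = support N \<eta>'"
proof -
  show "l \<in> N" using closed_sequentially[OF compact_imp_closed[OF N(1)]] assms(1,4) by blast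
  have "(\<lambda>n. slant (\<eta> n) (e n)) \<longlonglongrightarrow> slant \<eta>' l" by (rule tendsto_slant[OF assms(4,3)])
  moreover have "(\<lambda>n. slant (\<eta> n) (e n)) \<longlonglongrightarrow> support N \<eta>'"
    using tendsto_support[OF N(1,2) assms(3)] assms(2) by simp
  ultimately show "slant \<eta>' l = support N \<eta>'" by (rule LIMSEQ_unique)
qed

lemma escape_lim:
  assumes "j0 < \<eta>'" "\<eta>' < j1" "\<eta>n \<longlonglongrightarrow> \<eta>'" "\<And>n::nat. wn n \<in> K (\<eta>n n)" "wn \<longlonglongrightarrow> w" "(\<lambda>n. branch p (wn n)) \<longlonglongrightarrow> q"
  shows "w \<in> lift_dom p" "branch p w = q"
proof -
  have "eventually (\<lambda>n. j0 < \<eta>n n \<and> \<eta>n n < j1) sequentially"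
    using order_tendstoD[OF assms(3)] assms(1,2) by (auto intro: eventually_conj)
  then have ev: "eventually (\<lambda>n. escape_box p b0 b1 d (\<eta>n n) (support N (\<eta>n n))) sequentially"
    by eventually_elim (use hr in auto)
  show "w \<in> lift_dom p" "branch p w = q"
    using escape_box_escape_lim[OF hr[OF assms(1,2)] ev assms(3) tendsto_support[OF N(1,2) assms(3)] assms(4-6)] by auto
qed

lemma limit_in_closed_box:
  assumes "\<eta>n \<longlonglongrightarrow> \<eta>'" "\<And>n::nat. wn n \<in> K (\<eta>n n)" "wn \<longlonglongrightarrow> w"
  shows "w \<in> left_strip b0 b1 d" "support N \<eta>' \<le> slant \<eta>' w"
proof -
  have wb: "wn n \<in> left_strip b0 b1 d" "support N (\<eta>n n) < slant (\<eta>n n) (wn n)" for n using assms(2)[of n] by (auto simp: slant_box_def)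
  show "w \<in> left_strip b0 b1 d" using closed_sequentially[OF closed_left_strip _ assms(3)] wb by auto
  show "support N \<eta>' \<le> slant \<eta>' w"
    by (rule LIMSEQ_le[OF tendsto_support[OF N(1,2) assms(1)] tendsto_slant[OF assms(3,1)]])
      (use wb in \<open>auto intro: less_imp_le\<close>)
qed

lemma bounded_K: "bounded (\<Union>\<eta>\<in>{j0<..<j1}. K \<eta>)"
proof -
  have "compact ((\<lambda>\<eta>. support N \<eta>) ` {j0..j1})"
    by (intro compact_continuous_image continuous_on_sequentiallyI compact_Icc)
      (auto intro: tendsto_support[OF N(1,2)])
  then obtain s where s: "\<And>\<eta>. \<eta> \<in> {j0..j1} \<Longrightarrow> - s \<le> support N \<eta>"
    by (metis bounded_iff compact_imp_bounded imageI abs_le_D2 real_norm_def minus_le_iff)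
  define B where "B = \<bar>s\<bar> + \<bar>d\<bar> + (\<bar>j0\<bar> + \<bar>j1\<bar>) * (\<bar>b0\<bar> + \<bar>b1\<bar>) + (\<bar>b0\<bar> + \<bar>b1\<bar>)"
  have "cmod w \<le> B" if \<eta>: "\<eta> \<in> {j0<..<j1}" and w: "w \<in> K \<eta>" for \<eta> w
  proof -
    have i: "\<bar>Im w\<bar> \<le> \<bar>b0\<bar> + \<bar>b1\<bar>" using w by (auto simp: slant_box_def left_strip_def)
    have "\<bar>\<eta> * Im w\<bar> \<le> (\<bar>j0\<bar> + \<bar>j1\<bar>) * (\<bar>b0\<bar> + \<bar>b1\<bar>)" unfolding abs_mult using i \<eta> by (intro mult_mono) auto
    moreover have "- s < Re w + \<eta> * Im w" "Re w \<le> d" using w s[of \<eta>] \<eta> by (auto simp: slant_box_def left_strip_def slant_def)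
    ultimately have "\<bar>Re w\<bar> \<le> \<bar>s\<bar> + \<bar>d\<bar> + (\<bar>j0\<bar> + \<bar>j1\<bar>) * (\<bar>b0\<bar> + \<bar>b1\<bar>)" by linarith
    then show ?thesis using i cmod_le[of w] unfolding B_def by linarith
  qed
  then show ?thesis by (intro boundedI[of _ B]) auto
qed

lemma norm_branch_le_Im: 
  assumes "j0 < \<eta>" "\<eta> < j1" "w \<in> K \<eta>"
  shows "cmod (branch p w) \<le> C + (1 + \<bar>j0\<bar> + \<bar>j1\<bar>) * \<bar>Im (branch p w)\<bar>"
proof -
  have "(1 + \<bar>\<eta>\<bar>) * \<bar>Im (branch p w)\<bar> \<le> (1 + \<bar>j0\<bar> + \<bar>j1\<bar>) * \<bar>Im (branch p w)\<bar>"
    by (intro mult_right_mono) (use assms in auto)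
  then show ?thesis using bounded_slant_Im[of "branch p w" \<eta>] bd[OF assms] by linarith
qed

end

text \<open>A slope \<open>\<eta>0\<close> with the single supporting point \<open>e0\<close>.\<close>

locale fan_tip = fan F F' P p b0 b1 d N j0 j1 C for F F' P p b0 b1 d N j0 j1 C +
  fixes \<eta>0 :: real and e0 :: complex
  assumes \<eta>0: "j0 < \<eta>0" "\<eta>0 < j1" and e0: "e0 \<in> N" "slant \<eta>0 e0 = support N \<eta>0"
    and uniq: "\<And>e. e \<in> N \<Longrightarrow> slant \<eta>0 e = support N \<eta>0 \<Longrightarrow> e = e0"
begin

text \<open>Otherwise the branch would have a finite limit along some sequence tending to \<open>e0\<close> and extend to it.\<close>

lemma near_tip_far:
  "\<exists>r>0. \<exists>\<delta>>0. \<forall>\<eta> w. \<bar>\<eta> - \<eta>0\<bar> < \<delta> \<longrightarrow> w \<in> K \<eta> \<longrightarrow> dist w e0 < r \<longrightarrow> cmod (branch p w) > R"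
proof (rule ccontr)
  assume neg: "\<not> ?thesis"
  have "\<exists>\<eta> w. \<bar>\<eta> - \<eta>0\<bar> < 1 / real (Suc n) \<and> w \<in> K \<eta> \<and> dist w e0 < 1 / real (Suc n) \<and> cmod (branch p w) \<le> R" for n
  proof -
    have "1 / real (Suc n) > 0" by simp
    then show ?thesis using neg by (meson not_le)
  qed
  then obtain \<eta>n wn where w: "\<And>n. \<bar>\<eta>n n - \<eta>0\<bar> < 1 / real (Suc n)" "\<And>n. wn n \<in> K (\<eta>n n)"
    "\<And>n. dist (wn n) e0 < 1 / real (Suc n)" "\<And>n. cmod (branch p (wn n)) \<le> R" by metis
  have l1: "\<eta>n \<longlonglongrightarrow> \<eta>0"
    by (rule LIMSEQ_dist_inverse) (use w(1) in \<open>simp add: dist_real_def\<close>)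
  have l2: "wn \<longlonglongrightarrow> e0" by (rule LIMSEQ_dist_inverse) (rule w(3))
  have "bounded (range (\<lambda>n. branch p (wn n)))" by (rule boundedI[of _ R]) (use w(4) in auto)
  then obtain q r where r: "strict_mono (r :: nat \<Rightarrow> nat)" "((\<lambda>n. branch p (wn n)) \<circ> r) \<longlonglongrightarrow> q"
    using bounded_imp_convergent_subsequence by blast
  have "e0 \<in> lift_dom p"
    by (rule escape_lim(1)[OF \<eta>0, of "\<eta>n \<circ> r" "wn \<circ> r" e0 q])
      (use LIMSEQ_subseq_LIMSEQ[OF l1 r(1)] LIMSEQ_subseq_LIMSEQ[OF l2 r(1)] r(2) w(2) in \<open>auto simp: o_def\<close>)
  then show False using N_lift_dom[OF e0(1)] by simp
qed

text \<open>A sequence in the boxes with unbounded lifts clusters at an obstacle on the supporting line for \<open>\<eta>0\<close>,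
  and \<open>e0\<close> is the only one.\<close>

lemma far_near_tip:
  assumes r: "r > 0"
  shows "\<exists>R. \<exists>\<delta>>0. \<forall>\<eta> w. \<bar>\<eta> - \<eta>0\<bar> < \<delta> \<longrightarrow> w \<in> K \<eta> \<longrightarrow> cmod (branch p w) > R \<longrightarrow> dist w e0 < r"
proof (rule ccontr)
  assume neg: "\<not> ?thesis"
  have "\<exists>\<eta> w. \<bar>\<eta> - \<eta>0\<bar> < 1 / real (Suc n) \<and> w \<in> K \<eta> \<and> cmod (branch p w) > real n \<and> dist w e0 \<ge> r" for n
  proof -
    have "1 / real (Suc n) > 0" by simp
    then show ?thesis using neg by (meson not_le)
  qed
  then obtain \<eta>n wn where w: "\<And>n. \<bar>\<eta>n n - \<eta>0\<bar> < 1 / real (Suc n)" "\<And>n. wn n \<in> K (\<eta>n n)"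
    "\<And>n. cmod (branch p (wn n)) > real n" "\<And>n. dist (wn n) e0 \<ge> r" by metis
  have l1: "\<eta>n \<longlonglongrightarrow> \<eta>0"
    by (rule LIMSEQ_dist_inverse) (use w(1) in \<open>simp add: dist_real_def\<close>)
  have "eventually (\<lambda>n. j0 < \<eta>n n \<and> \<eta>n n < j1) sequentially"
    using order_tendstoD[OF l1] \<eta>0 by (auto intro: eventually_conj)
  then obtain n0 where n0: "\<And>n. n \<ge> n0 \<Longrightarrow> j0 < \<eta>n n \<and> \<eta>n n < j1" unfolding eventually_sequentially by auto
  define s where "s n = n + n0" for n
  have sm: "strict_mono s" unfolding s_def by (auto simp: strict_mono_def)
  have "bounded (range (wn \<circ> s))"
    by (rule bounded_subset[OF bounded_K]) (use w(2) n0 in \<open>fastforce simp: s_def\<close>)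
  then obtain l r' where l: "strict_mono (r' :: nat \<Rightarrow> nat)" "((wn \<circ> s) \<circ> r') \<longlonglongrightarrow> l"
    using bounded_imp_convergent_subsequence by blast
  define m where "m = s \<circ> r'"
  have m: "strict_mono m" "(\<lambda>n. wn (m n)) \<longlonglongrightarrow> l" unfolding m_def using strict_mono_o[OF sm l(1)] l(2) by (auto simp: o_def)
  have lm: "(\<lambda>n. \<eta>n (m n)) \<longlonglongrightarrow> \<eta>0" using LIMSEQ_subseq_LIMSEQ[OF l1 m(1)] by (simp add: o_def)
  have lb: "l \<in> left_strip b0 b1 d" "support N \<eta>0 \<le> slant \<eta>0 l"
    using limit_in_closed_box[OF lm w(2) m(2)] by auto
  have "l \<notin> lift_dom p"
  proof
    assume "l \<in> lift_dom p"
    then have "(\<lambda>n. branch p (wn (m n))) \<longlonglongrightarrow> branch p l" using isCont_tendsto_compose[OF isCont_branch m(2)] by auto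
    then have "bounded (range (\<lambda>n. branch p (wn (m n))))" by (rule convergent_imp_bounded)
    then obtain B where B: "\<And>n. cmod (branch p (wn (m n))) \<le> B" by (auto simp: bounded_iff)
    obtain k :: nat where k: "B \<le> real k" using real_arch_simple by blast
    show False using B[of k] w(3)[of "m k"] k seq_suble[OF m(1), of k] by (meson le_less_trans less_le_not_le of_nat_mono order_trans)
  qed
  then have lN: "l \<in> N" using mem[OF \<eta>0 lb(1)] lb(2) by auto
  then have "l = e0" using uniq support_upper[OF N(1) lN, of \<eta>0] lb(2) by (meson order_antisym)
  moreover have "dist l e0 \<ge> r"
    by (rule LIMSEQ_le_const[OF tendsto_dist[OF m(2) tendsto_const]]) (use w(4) in auto)
  ultimately show False using r by simp
qed

lemma maximizers_near_tip:
  assumes r: "r > 0"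
  shows "\<exists>\<delta>>0. \<forall>\<eta> e. \<bar>\<eta> - \<eta>0\<bar> < \<delta> \<longrightarrow> e \<in> N \<longrightarrow> slant \<eta> e = support N \<eta> \<longrightarrow> dist e e0 < r"
proof (rule ccontr)
  assume neg: "\<not> ?thesis"
  have "\<exists>\<eta> e. \<bar>\<eta> - \<eta>0\<bar> < 1 / real (Suc n) \<and> e \<in> N \<and> slant \<eta> e = support N \<eta> \<and> dist e e0 \<ge> r" for n
  proof -
    have "1 / real (Suc n) > 0" by simp
    then show ?thesis using neg by (meson not_le)
  qed
  then obtain \<eta>n en where w: "\<And>n. \<bar>\<eta>n n - \<eta>0\<bar> < 1 / real (Suc n)" "\<And>n. en n \<in> N"
    "\<And>n. slant (\<eta>n n) (en n) = support N (\<eta>n n)" "\<And>n. dist (en n) e0 \<ge> r" by metis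
  have l1: "\<eta>n \<longlonglongrightarrow> \<eta>0"
    by (rule LIMSEQ_dist_inverse) (use w(1) in \<open>simp add: dist_real_def\<close>)
  have "seq_compact N" using N(1) compact_imp_seq_compact by blast
  then obtain l m where m: "l \<in> N" "strict_mono m" "(en \<circ> m) \<longlonglongrightarrow> l"
    using w(2) unfolding seq_compact_def by metis
  have "slant \<eta>0 l = support N \<eta>0"
    by (rule maximizer_limit(2)[of "en \<circ> m" "\<eta>n \<circ> m"]) (use w m LIMSEQ_subseq_LIMSEQ[OF l1 m(2)] in auto)
  then have "l = e0" using uniq m(1) by auto
  moreover have "dist l e0 \<ge> r"
    by (rule LIMSEQ_le_const[OF tendsto_dist[OF m(3) tendsto_const]]) (use w(4) in auto)
  ultimately show False using r by simp
qed

text \<open>Near the tip the lifts are large but have bounded slants, so their imaginary parts are large. The parts of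
  the boxes near the tip are convex and share the point \<open>v\<close>, so the sign of the imaginary part is the same on all of them.\<close>

lemma tip_sign:
  "\<exists>\<epsilon>. (\<epsilon> = 1 \<or> \<epsilon> = - 1) \<and> (\<forall>Y. \<exists>r>0. \<exists>\<delta>>0. \<forall>\<eta> w. \<bar>\<eta> - \<eta>0\<bar> < \<delta> \<longrightarrow> w \<in> K \<eta> \<longrightarrow> dist w e0 < r \<longrightarrow> \<epsilon> * Im (branch p w) \<ge> Y)"
proof -
  define B where "B = 1 + \<bar>j0\<bar> + \<bar>j1\<bar>"
  have B: "B \<ge> 1" unfolding B_def by auto
  have big: "\<exists>r>0. \<exists>\<delta>>0. \<forall>\<eta> w. \<bar>\<eta> - \<eta>0\<bar> < \<delta> \<longrightarrow> w \<in> K \<eta> \<longrightarrow> dist w e0 < r \<longrightarrow> \<bar>Im (branch p w)\<bar> \<ge> Y" for Y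
  proof -
    obtain r \<delta> where rd: "r > 0" "\<delta> > 0" "\<And>\<eta> w. \<bar>\<eta> - \<eta>0\<bar> < \<delta> \<Longrightarrow> w \<in> K \<eta> \<Longrightarrow> dist w e0 < r \<Longrightarrow> cmod (branch p w) > C + B * Y"
      using near_tip_far[of "C + B * Y"] by blast
    define \<delta>' where "\<delta>' = min \<delta> (min (\<eta>0 - j0) (j1 - \<eta>0))"
    have "\<bar>Im (branch p w)\<bar> \<ge> Y" if h: "\<bar>\<eta> - \<eta>0\<bar> < \<delta>'" "w \<in> K \<eta>" "dist w e0 < r" for \<eta> w
    proof -
      have "C + B * Y < C + B * \<bar>Im (branch p w)\<bar>"
        using rd(3)[of \<eta> w] norm_branch_le_Im[of \<eta> w] h unfolding \<delta>'_def B_def by force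
      then have "B * Y < B * \<bar>Im (branch p w)\<bar>" by simp
      then show ?thesis using B by (simp add: mult_less_cancel_left_pos)
    qed
    moreover have "\<delta>' > 0" unfolding \<delta>'_def using rd(2) \<eta>0 by auto
    ultimately show ?thesis using rd(1) by blast
  qed
  obtain r \<delta> where rd: "r > 0" "\<delta> > 0" "\<And>\<eta> w. \<bar>\<eta> - \<eta>0\<bar> < \<delta> \<Longrightarrow> w \<in> K \<eta> \<Longrightarrow> dist w e0 < r \<Longrightarrow> \<bar>Im (branch p w)\<bar> \<ge> 1"
    using big[of 1] by blast
  obtain v where v: "v \<in> K \<eta>0" "dist v e0 < r"
  proof -
    have Fp: "F p \<in> K \<eta>0" using escape_boxD(2)[OF hr[OF \<eta>0]] .
    have os: "open_segment (F p) e0 \<subseteq> K \<eta>0"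
      by (rule open_segment_slant_box[OF Fp]) (use e0 N_box in auto)
    have ne: "F p \<noteq> e0" using Fp e0(2) by (auto simp: slant_box_def)
    then have "e0 \<in> closure (open_segment (F p) e0)" by simp
    then show ?thesis using os that rd(1) unfolding closure_approachable by blast
  qed
  have "((\<lambda>\<eta>. slant \<eta> v - support N \<eta>) \<longlongrightarrow> slant \<eta>0 v - support N \<eta>0) (nhds \<eta>0)"
    by (intro tendsto_diff tendsto_slant tendsto_const filterlim_ident tendsto_support[OF N(1,2)])
  then have "eventually (\<lambda>\<eta>. slant \<eta> v - support N \<eta> > 0) (nhds \<eta>0)"
    by (rule order_tendstoD) (use v in \<open>auto simp: slant_box_def\<close>)
  then obtain \<delta>1 where d1: "\<delta>1 > 0" "\<And>\<eta>. \<bar>\<eta> - \<eta>0\<bar> < \<delta>1 \<Longrightarrow> v \<in> K \<eta>"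
    using v(1) unfolding eventually_nhds_metric by (auto simp: dist_real_def slant_box_def)
  define \<delta>2 where "\<delta>2 = min (min \<delta> \<delta>1) (min (\<eta>0 - j0) (j1 - \<eta>0))"
  have d2: "\<delta>2 > 0" unfolding \<delta>2_def using rd d1 \<eta>0 by auto
  define \<epsilon> where "\<epsilon> = sgn (Im (branch p v))"
  have "\<bar>Im (branch p v)\<bar> \<ge> 1" using rd(3)[of \<eta>0 v] rd(2) v by auto
  then have eps: "\<epsilon> = 1 \<or> \<epsilon> = - 1" "\<epsilon> * Im (branch p v) > 0" unfolding \<epsilon>_def by (auto simp: sgn_if)
  have pos: "\<epsilon> * Im (branch p w) > 0" if h: "\<bar>\<eta> - \<eta>0\<bar> < \<delta>2" "w \<in> K \<eta>" "dist w e0 < r" for \<eta> w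
  proof (rule ccontr)
    assume n: "\<not> ?thesis"
    define S where "S = K \<eta> \<inter> ball e0 r"
    have jn: "j0 < \<eta>" "\<eta> < j1" using h(1) unfolding \<delta>2_def by auto
    have "connected S" unfolding S_def by (intro convex_connected convex_Int slant_box_convex convex_ball)
    moreover have "continuous_on S (\<lambda>w. \<epsilon> * Im (branch p w))" 
      by (intro continuous_intros continuous_on_branch) (use K_lift_dom[OF jn] S_def in auto)
    ultimately have "connected ((\<lambda>w. \<epsilon> * Im (branch p w)) ` S)" by (rule connected_continuous_image[rotated])
    moreover have "w \<in> S" "v \<in> S" unfolding S_def using h d1(2)[of \<eta>] v(2) by (auto simp: dist_commute \<delta>2_def)
    ultimately have "0 \<in> (\<lambda>w. \<epsilon> * Im (branch p w)) ` S"
      using n eps(2) connected_contains_Icc[of "(\<lambda>w. \<epsilon> * Im (branch p w)) ` S" "\<epsilon> * Im (branch p w)" "\<epsilon> * Im (branch p v)"] by force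
    then obtain x where "x \<in> S" "\<epsilon> * Im (branch p x) = 0" by auto
    then have "\<bar>Im (branch p x)\<bar> = 0" "x \<in> S" using eps(1) by auto
    moreover have "\<bar>Im (branch p x)\<bar> \<ge> 1" using rd(3)[of \<eta> x] \<open>x \<in> S\<close> h(1) unfolding S_def \<delta>2_def by (auto simp: dist_commute)
    ultimately show False by linarith
  qed
  have "\<exists>r>0. \<exists>\<delta>>0. \<forall>\<eta> w. \<bar>\<eta> - \<eta>0\<bar> < \<delta> \<longrightarrow> w \<in> K \<eta> \<longrightarrow> dist w e0 < r \<longrightarrow> \<epsilon> * Im (branch p w) \<ge> Y" for Y
  proof -
    obtain r' \<delta>' where rd': "r' > 0" "\<delta>' > 0" "\<And>\<eta> w. \<bar>\<eta> - \<eta>0\<bar> < \<delta>' \<Longrightarrow> w \<in> K \<eta> \<Longrightarrow> dist w e0 < r' \<Longrightarrow> \<bar>Im (branch p w)\<bar> \<ge> Y"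
      using big[of Y] by blast
    have "\<epsilon> * Im (branch p w) \<ge> Y" if "\<bar>\<eta> - \<eta>0\<bar> < min \<delta>2 \<delta>'" "w \<in> K \<eta>" "dist w e0 < min r r'" for \<eta> w
      using pos[of \<eta> w] rd'(3)[of \<eta> w] that eps(1) by auto
    moreover have "min \<delta>2 \<delta>' > 0" "min r r' > 0" using d2 rd rd' by auto
    ultimately show ?thesis by blast
  qed
  then show ?thesis using eps(1) by blast
qed

end

section \<open>No gaps between the obstacles\<close>

lemma first_exit_levels:
  fixes f :: "real \<Rightarrow> real"
  assumes c: "continuous_on {a<..<b} f" and a: "filterlim f at_top (at_right a)" and b: "filterlim f at_top (at_left b)"
    and m: "a < m" "m < b" "f m < y"
  obtains s t where "a < s" "s < m" "m < t" "t < b" "f s = y" "f t = y" "\<And>x. s < x \<Longrightarrow> x < t \<Longrightarrow> f x < y"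
proof -
  have "eventually (\<lambda>x. f x > y) (at_right a)" using a by (simp add: filterlim_at_top_dense)
  then obtain u0 where u0: "u0 > a" "\<And>x. a < x \<Longrightarrow> x < u0 \<Longrightarrow> f x > y"
    unfolding eventually_at_right_field by blast
  have "eventually (\<lambda>x. f x > y) (at_left b)" using b by (simp add: filterlim_at_top_dense)
  then obtain v0 where v0: "v0 < b" "\<And>x. v0 < x \<Longrightarrow> x < b \<Longrightarrow> f x > y"
    unfolding eventually_at_left_field by blast
  define u where "u = (a + min u0 m) / 2"
  define v where "v = (max v0 m + b) / 2"
  have u: "a < u" "u < m" "f u > y" using u0 m unfolding u_def by (auto simp: min_def max_def field_simps)
  have v: "m < v" "v < b" "f v > y" using v0 m unfolding v_def by (auto simp: min_def max_def field_simps)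
  define S where "S = {x \<in> {u..m}. f x = y}"
  define T where "T = {x \<in> {m..v}. f x = y}"
  have cS: "continuous_on {u..m} f" by (rule continuous_on_subset[OF c]) (use u m in auto)
  have cT: "continuous_on {m..v} f" by (rule continuous_on_subset[OF c]) (use v m in auto)
  have "closed (f -` {y} \<inter> {u..m})" "closed (f -` {y} \<inter> {m..v})"
    using continuous_closed_preimage[OF cS, of "{y}"] continuous_closed_preimage[OF cT, of "{y}"]
    by (simp_all add: Int_commute)
  then have clS: "closed S" and clT: "closed T" unfolding S_def T_def vimage_def by (simp_all add: Int_def conj_commute)
  have S0: "S \<noteq> {}" using IVT2'[of f m y u] u m cS unfolding S_def by force
  have T0: "T \<noteq> {}" using IVT'[of f m y v] v m cT unfolding T_def by force
  have bS: "bdd_above S" and bT: "bdd_below T" unfolding S_def T_def by auto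
  define s where "s = Sup S"
  define t where "t = Inf T"
  have s: "s \<in> S" unfolding s_def by (rule closed_contains_Sup[OF S0 bS clS])
  have t: "t \<in> T" unfolding t_def by (rule closed_contains_Inf[OF T0 bT clT])
  have sm: "a < s" "s < m" "f s = y" using s u m(3) unfolding S_def by (auto simp: less_le)
  have tm: "m < t" "t < b" "f t = y" using t v m(3) unfolding T_def by (auto simp: less_le)
  have "f x < y" if x: "s < x" "x < t" for x
  proof (rule ccontr)
    assume n: "\<not> f x < y"
    show False
    proof (cases "x \<le> m")
      case True
      then obtain z where "x \<le> z" "z \<le> m" "f z = y"
        using IVT2'[of f m y x] n m(3) continuous_on_subset[OF cS, of "{x..m}"] x(1) s unfolding S_def by force
      then have "z \<in> S" using x(1) s unfolding S_def by auto
      then have "z \<le> s" unfolding s_def using bS by (rule cSup_upper)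
      then show False using \<open>x \<le> z\<close> x(1) by simp
    next
      case False
      then obtain z where "m \<le> z" "z \<le> x" "f z = y"
        using IVT'[of f m y x] n m(3) continuous_on_subset[OF cT, of "{m..x}"] x(2) t unfolding T_def by force
      then have "z \<in> T" using x(2) t unfolding T_def by auto
      then have "t \<le> z" unfolding t_def using bT by (rule cInf_lower)
      then show False using \<open>z \<le> x\<close> x(2) by simp
    qed
  qed
  then show ?thesis using that sm tm by blast
qed

lemma convex_Re_abs_Im: "convex {z. \<bar>Re z\<bar> \<le> C \<and> L \<le> Im z}"
proof -
  have "{z. \<bar>Re z\<bar> \<le> C \<and> L \<le> Im z} = {z. Re z \<le> C} \<inter> {z. - C \<le> Re z} \<inter> {z. L \<le> Im z}" by auto
  then show ?thesis
    by (simp add: convex_Int convex_halfspace_Re_le convex_halfspace_Re_ge convex_halfspace_Im_ge)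
qed

text \<open>The arc \<open>\<gamma>\<close> runs upwards to infinity at both ends inside the strip \<open>\<bar>Re z\<bar> \<le> C\<close>. Cut at a large height \<open>y\<close> and
  closed by a horizontal segment, it becomes a Jordan curve. The set \<open>A\<close> on one side of the arc
  contains a point below the curve and is therefore outside; hence \<open>B\<close>, which
  borders the arc from the other side, is inside. A given point \<open>x\<close> of \<open>B\<close> is joined to the arc by a path
  below the height \<open>y\<close>, provided \<open>y\<close> is large, and the inside of the curve lies in the strip.\<close>

lemma under_arc_in_strip:
  fixes \<gamma> :: "real \<Rightarrow> complex"
  assumes c: "continuous_on {a<..<b} \<gamma>" and inj: "inj_on \<gamma> {a<..<b}"
    and strip: "\<And>t. a < t \<Longrightarrow> t < b \<Longrightarrow> \<bar>Re (\<gamma> t)\<bar> \<le> C \<and> L \<le> Im (\<gamma> t)"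
    and ends: "filterlim (\<lambda>t. Im (\<gamma> t)) at_top (at_right a)" "filterlim (\<lambda>t. Im (\<gamma> t)) at_top (at_left b)"
    and m: "a < m1" "m1 < m" "m < m2" "m2 < b"
    and A: "path_connected A" "A \<inter> \<gamma> ` {a<..<b} = {}" "z \<in> A" "Im z < L"
    and B: "path_connected B" "B \<inter> \<gamma> ` {a<..<b} = {}"
    and O': "open O'" "\<gamma> m \<in> O'" "bounded O'" "O' \<subseteq> A1 \<union> B1 \<union> \<gamma> ` {m1..m2}"
    and A1: "A1 \<subseteq> A" "connected A1" "A1 \<noteq> {}" "A1 \<subseteq> O'" and B1: "B1 \<subseteq> B" "connected B1" "B1 \<noteq> {}" "B1 \<subseteq> O'"
    and x: "x \<in> B"
  shows "\<bar>Re x\<bar> \<le> C"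
proof -
  obtain a1 where a1: "a1 \<in> A1" using A1(3) by auto
  obtain x1 where x1: "x1 \<in> B1" using B1(3) by auto
  obtain g1 where g1: "path g1" "path_image g1 \<subseteq> A" "pathstart g1 = z" "pathfinish g1 = a1"
    using A(1,3) a1 A1(1) unfolding path_connected_def by blast
  obtain g2 where g2: "path g2" "path_image g2 \<subseteq> B" "pathstart g2 = x1" "pathfinish g2 = x"
    using B(1) x x1 B1(1) unfolding path_connected_def by blast
  have "continuous_on {m1..m2} \<gamma>" by (rule continuous_on_subset[OF c]) (use m in auto)
  then have "bounded (\<gamma> ` {m1..m2})" by (intro compact_imp_bounded compact_continuous_image) auto
  then have "bounded (path_image g1 \<union> path_image g2 \<union> O' \<union> \<gamma> ` {m1..m2})"
    using O'(3) bounded_path_image[OF g1(1)] bounded_path_image[OF g2(1)]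
    by (auto simp: bounded_Un)
  then obtain y where y: "\<And>z. z \<in> path_image g1 \<union> path_image g2 \<union> O' \<union> \<gamma> ` {m1..m2} \<Longrightarrow> cmod z < y"
    unfolding bounded_iff by (metis gt_ex le_less_trans)
  have yI: "Im z < y" if "z \<in> path_image g1 \<union> path_image g2 \<union> O' \<union> \<gamma> ` {m1..m2}" for z
    using y[OF that] abs_Im_le_cmod[of z] by linarith
  have cI: "continuous_on {a<..<b} (\<lambda>t. Im (\<gamma> t))" by (intro continuous_intros c)
  obtain s t where st: "a < s" "s < m" "m < t" "t < b" "Im (\<gamma> s) = y" "Im (\<gamma> t) = y"
    "\<And>x. s < x \<Longrightarrow> x < t \<Longrightarrow> Im (\<gamma> x) < y"
    by (rule first_exit_levels[OF cI ends, of m y]) (use m yI[of "\<gamma> m"] O'(2) in auto)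
  have mst: "s < m1" "m2 < t"
  proof -
    show "s < m1" using yI[of "\<gamma> s"] st(2,5) m by (cases "s < m1") auto
    show "m2 < t" using yI[of "\<gamma> t"] st(3,6) m by (cases "m2 < t") auto
  qed
  define h where "h = \<gamma> \<circ> (\<lambda>u. s + u * (t - s))"
  define J where "J = h +++ linepath (\<gamma> t) (\<gamma> s)"
  have ab: "s + u * (t - s) \<in> {s..t}" if "u \<in> {0..1}" for u
  proof -
    have "u * (t - s) \<le> 1 * (t - s)" using that st by (intro mult_right_mono) auto
    then have "s + u * (t - s) \<le> s + 1 * (t - s)" by (rule add_left_mono)
    moreover have "u * (t - s) \<ge> 0" using that st by simp
    ultimately show ?thesis by simp
  qed
  have img: "(\<lambda>u. s + u * (t - s)) ` {0..1} = {s..t}"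
  proof
    show "(\<lambda>u. s + u * (t - s)) ` {0..1} \<subseteq> {s..t}" using ab by auto
    show "{s..t} \<subseteq> (\<lambda>u. s + u * (t - s)) ` {0..1}"
    proof
      fix x assume "x \<in> {s..t}"
      then show "x \<in> (\<lambda>u. s + u * (t - s)) ` {0..1}" using st
        by (intro image_eqI[of _ _ "(x - s) / (t - s)"]) auto
    qed
  qed
  have sub: "{s..t} \<subseteq> {a<..<b}" using st by auto
  have ph: "path_image h = \<gamma> ` {s..t}" unfolding h_def path_image_def image_comp[symmetric] img ..
  have ah: "arc h"
    unfolding arc_def path_def h_def
  proof
    show "continuous_on {0..1} (\<gamma> \<circ> (\<lambda>u. s + u * (t - s)))"
      by (intro continuous_on_compose continuous_intros) (unfold img, rule continuous_on_subset[OF c sub])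
    show "inj_on (\<gamma> \<circ> (\<lambda>u. s + u * (t - s))) {0..1}"
    proof (rule comp_inj_on)
      show "inj_on (\<lambda>u. s + u * (t - s)) {0..1}" using st by (auto simp: inj_on_def)
      show "inj_on \<gamma> ((\<lambda>u. s + u * (t - s)) ` {0..1})" unfolding img by (rule inj_on_subset[OF inj sub])
    qed
  qed
  have ne: "\<gamma> t \<noteq> \<gamma> s" using inj_onD[OF inj, of t s] st by auto
  have hs: "pathstart h = \<gamma> s" "pathfinish h = \<gamma> t" unfolding h_def pathstart_def pathfinish_def by auto
  have ImL: "Im v = y" if vs: "v \<in> closed_segment (\<gamma> t) (\<gamma> s)" for v
  proof -
    obtain u where "v = (1 - u) *\<^sub>R \<gamma> t + u *\<^sub>R \<gamma> s" using vs by (auto simp: in_segment)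
    then have "Im v = (1 - u) * y + u * y" using st by simp
    then show ?thesis by (simp add: algebra_simps)
  qed
  have hseg: "\<gamma> ` {s..t} \<inter> closed_segment (\<gamma> t) (\<gamma> s) \<subseteq> {\<gamma> s, \<gamma> t}"
  proof
    fix v assume v: "v \<in> \<gamma> ` {s..t} \<inter> closed_segment (\<gamma> t) (\<gamma> s)"
    then obtain x where x: "x \<in> {s..t}" "v = \<gamma> x" by auto
    have "\<not> (s < x \<and> x < t)" using st(7)[of x] ImL[of v] v x by auto
    then have "x = s \<or> x = t" using x(1) by auto
    then show "v \<in> {\<gamma> s, \<gamma> t}" using x(2) by auto
  qed
  have sp: "simple_path J" unfolding J_def
    by (rule simple_path_join_loop[OF ah arc_linepath[OF ne]]) (use hs hseg ph in auto)
  have lp: "pathfinish J = pathstart J" unfolding J_def using hs by simp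
  have pJ: "path_image J = \<gamma> ` {s..t} \<union> closed_segment (\<gamma> t) (\<gamma> s)"
    unfolding J_def using hs ph by (subst path_image_join) auto
  note JJ = Jordan_inside_outside[OF sp lp]
  define Q where "Q = {z. \<bar>Re z\<bar> \<le> C \<and> L \<le> Im z}"
  have gQ: "\<gamma> u \<in> Q" if "u \<in> {s..t}" for u using strip[of u] that st unfolding Q_def by auto
  have "closed_segment (\<gamma> t) (\<gamma> s) \<subseteq> Q"
  proof (rule closed_segment_subset)
    show "\<gamma> t \<in> Q" "\<gamma> s \<in> Q" using gQ st by auto
    show "convex Q" unfolding Q_def by (rule convex_Re_abs_Im)
  qed
  then have JQ: "path_image J \<subseteq> Q" unfolding pJ using gQ by auto
  have inQ: "inside (path_image J) \<subseteq> Q"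
  proof
    fix v assume v: "v \<in> inside (path_image J)"
    show "v \<in> Q"
    proof (rule ccontr)
      assume "v \<notin> Q"
      then have "v \<in> outside Q" using convex_in_outside[of Q v] convex_Re_abs_Im unfolding Q_def by auto
      then have "v \<in> outside (path_image J)" using outside_mono[OF JQ] by auto
      then show False using v inside_Int_outside[of "path_image J"] by blast
    qed
  qed
  have avoid: "E \<inter> path_image J = {}" if "E \<subseteq> path_image g1 \<union> path_image g2 \<union> O'" "E \<inter> \<gamma> ` {a<..<b} = {}" for E
  proof -
    have "v \<notin> path_image J" if v: "v \<in> E" for v
    proof
      assume "v \<in> path_image J"
      then consider "v \<in> \<gamma> ` {s..t}" | "v \<in> closed_segment (\<gamma> t) (\<gamma> s)" unfolding pJ by auto
      then show False
      proof cases
        case 1 then show False using v \<open>E \<inter> \<gamma> ` {a<..<b} = {}\<close> sub by auto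
      next
        case 2 then have "Im v = y" by (rule ImL)
        moreover have "Im v < y" by (rule yI) (use v \<open>E \<subseteq> _\<close> in auto)
        ultimately show False by simp
      qed
    qed
    then show ?thesis by auto
  qed
  have conn: "u \<in> inside (path_image J) \<longleftrightarrow> v \<in> inside (path_image J)"
    if "connected E" "E \<inter> path_image J = {}" "u \<in> E" "v \<in> E" for E u v
  proof -
    have "connected_component (- path_image J) u v" "connected_component (- path_image J) v u"
      unfolding connected_component_def using that by (auto intro!: exI[of _ E])
    then show ?thesis using inside_same_component by blast
  qed
  have zout: "z \<notin> inside (path_image J)" using inQ A(4) unfolding Q_def by auto
  have e1: "path_image g1 \<inter> path_image J = {}" by (rule avoid) (use g1(2) A(2) in auto)
  have "a1 \<notin> inside (path_image J)"
    using conn[OF connected_path_image[OF g1(1)] e1, of z a1] zout g1(3,4) pathstart_in_path_image pathfinish_in_path_image by metis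
  moreover have e2: "A1 \<inter> path_image J = {}" by (rule avoid) (use A1 A(2) in auto)
  ultimately have A1out: "v \<notin> inside (path_image J)" if "v \<in> A1" for v
    using conn[OF A1(2) e2 a1 that] by simp
  have "\<gamma> m \<in> frontier (inside (path_image J))" using JJ st unfolding pJ by auto
  then have "\<gamma> m \<in> closure (inside (path_image J))" unfolding frontier_def by auto
  then obtain o' where o': "o' \<in> O'" "o' \<in> inside (path_image J)"
    using O'(1,2) by (meson closure_iff_nhds_not_empty disjoint_iff order_refl)
  have "o' \<notin> \<gamma> ` {m1..m2}"
  proof
    assume "o' \<in> \<gamma> ` {m1..m2}"
    then have "o' \<in> path_image J" unfolding pJ using mst by auto
    then show False using o'(2) by (auto simp: inside_def)
  qed
  then have oB: "o' \<in> B1" using o' A1out O'(4) by auto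
  have e3: "B1 \<inter> path_image J = {}" by (rule avoid) (use B1 B(2) in auto)
  have "x1 \<in> inside (path_image J)" using conn[OF B1(2) e3 oB x1] o'(2) by simp
  moreover have e4: "path_image g2 \<inter> path_image J = {}" by (rule avoid) (use g2(2) B(2) in auto)
  ultimately have "x \<in> inside (path_image J)"
    using conn[OF connected_path_image[OF g2(1)] e4, of x1 x] g2(3,4) pathstart_in_path_image pathfinish_in_path_image by metis
  then show ?thesis using inQ unfolding Q_def by auto
qed

lemma slant_box_mono: "b0 \<le> b0' \<Longrightarrow> slant_box b0' b1 d \<eta> c \<subseteq> slant_box b0 b1 d \<eta> c"
  by (auto simp: slant_box_def left_strip_def)

context loc_homeo
begin

lemma bounded_branch_imp_lift_dom:
  assumes h: "escape_box p b0 b1 d \<eta> c" and w: "w \<in> left_strip b0 b1 d" "c \<le> slant \<eta> w"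
    and wn: "\<And>n::nat. wn n \<in> slant_box b0 b1 d \<eta> c" "wn \<longlonglongrightarrow> w" and bd: "\<And>n. cmod (branch p (wn n)) \<le> B"
  shows "w \<in> lift_dom p"
proof -
  have "bounded (range (\<lambda>n. branch p (wn n)))" by (rule boundedI[of _ B]) (use bd in auto)
  then obtain q r where r: "strict_mono (r :: nat \<Rightarrow> nat)" "((\<lambda>n. branch p (wn n)) \<circ> r) \<longlonglongrightarrow> q"
    using bounded_imp_convergent_subsequence by blast
  show ?thesis
    by (rule lift_dom_extend_lim(1)[OF slant_box_convex escape_boxD(1)[OF h] open_segment_slant_box[OF escape_boxD(2)[OF h] w] escape_boxD(2)[OF h], of "wn \<circ> r" q])
      (use wn LIMSEQ_subseq_LIMSEQ[OF wn(2) r(1)] r(2) in \<open>auto simp: o_def\<close>)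
qed

lemma slant_box_approach:
  assumes h: "escape_box p b0 b1 d \<eta> c" and w: "w \<in> left_strip b0 b1 d" "c \<le> slant \<eta> w"
  obtains wn where "\<And>n::nat. wn n \<in> open_segment (F p) w \<or> wn n = w \<and> F p = w" "\<And>n. wn n \<in> slant_box b0 b1 d \<eta> c" "wn \<longlonglongrightarrow> w"
proof (cases "F p = w")
  case True then show ?thesis using that[of "\<lambda>_. w"] escape_boxD(2)[OF h] by auto
next
  case False
  then have "w \<in> closure (open_segment (F p) w)" by simp
  then obtain wn where "\<And>n::nat. wn n \<in> open_segment (F p) w" "wn \<longlonglongrightarrow> w" unfolding closure_sequential by blast
  then show ?thesis using that[of wn] open_segment_slant_box[OF escape_boxD(2)[OF h] w] by blast
qed

end

context fan
begin

text \<open>A point of the closed box to which the branch extends is approached from inside the box.\<close>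

lemma closed_box_approx:
  assumes \<eta>: "j0 < \<eta>" "\<eta> < j1" and w: "w \<in> left_strip b0 b1 d" "support N \<eta> \<le> slant \<eta> w" "w \<in> lift_dom p"
  obtains wn where "\<And>n::nat. wn n \<in> K \<eta>" "wn \<longlonglongrightarrow> w" "(\<lambda>n. branch p (wn n)) \<longlonglongrightarrow> branch p w"
proof -
  obtain wn where wn: "\<And>n::nat. wn n \<in> K \<eta>" "wn \<longlonglongrightarrow> w"
    using slant_box_approach[OF hr[OF \<eta>] w(1,2)] by metis
  then show ?thesis using that isCont_tendsto_compose[OF isCont_branch[OF w(3)] wn(2)] by blast
qed

lemma bound_on_closed_box:
  assumes \<eta>: "j0 < \<eta>" "\<eta> < j1" and w: "w \<in> left_strip b0 b1 d" "support N \<eta> \<le> slant \<eta> w" "w \<in> lift_dom p"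
  shows "\<bar>slant \<eta> (branch p w)\<bar> \<le> C"
proof -
  obtain wn where wn: "\<And>n::nat. wn n \<in> K \<eta>" "wn \<longlonglongrightarrow> w" "(\<lambda>n. branch p (wn n)) \<longlonglongrightarrow> branch p w"
    using closed_box_approx[OF assms] by metis
  have "(\<lambda>n. \<bar>slant \<eta> (branch p (wn n))\<bar>) \<longlonglongrightarrow> \<bar>slant \<eta> (branch p w)\<bar>"
    by (intro tendsto_rabs tendsto_slant wn(3) tendsto_const)
  then show ?thesis by (rule LIMSEQ_le_const2) (use bd[OF \<eta> wn(1)] in auto)
qed

text \<open>Points of the gap are not in the box; each is replaced by a point of the box nearby whose lift is near,
  too, and then \<open>bounded_branch_imp_lift_dom\<close> applies.\<close>

lemma gap_end_escape:
  assumes \<eta>: "j0 < \<eta>" "\<eta> < j1" and s: "Complex (support N \<eta> - \<eta> * s) s \<in> N"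
    and t: "\<And>n. Complex (support N \<eta> - \<eta> * t n) (t n) \<in> left_strip b0 b1 d" "\<And>n::nat. Complex (support N \<eta> - \<eta> * t n) (t n) \<in> lift_dom p" "t \<longlonglongrightarrow> s"
    and B: "\<And>n. cmod (branch p (Complex (support N \<eta> - \<eta> * t n) (t n))) \<le> B"
  shows False
proof -
  define g where "g x = Complex (support N \<eta> - \<eta> * x) x" for x
  have og: "slant \<eta> (g x) = support N \<eta>" for x by (simp add: g_def slant_def)
  have "\<exists>w. w \<in> K \<eta> \<and> dist w (g (t n)) < 1 / real (Suc n) \<and> cmod (branch p w) < B + 1" for n
  proof -
    obtain wn where wn: "\<And>k::nat. wn k \<in> K \<eta>" "wn \<longlonglongrightarrow> g (t n)" "(\<lambda>k. branch p (wn k)) \<longlonglongrightarrow> branch p (g (t n))"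
      using closed_box_approx[OF \<eta> t(1)[of n, folded g_def] _ t(2)[of n, folded g_def]] og by force
    have "eventually (\<lambda>k. dist (wn k) (g (t n)) < 1 / real (Suc n)) sequentially"
      using wn(2) by (rule tendstoD) simp
    moreover have "eventually (\<lambda>k. cmod (branch p (wn k)) < B + 1) sequentially"
      using tendsto_norm[OF wn(3)] by (rule order_tendstoD) (use B[of n] in \<open>auto simp: g_def\<close>)
    ultimately have "eventually (\<lambda>k. dist (wn k) (g (t n)) < 1 / real (Suc n) \<and> cmod (branch p (wn k)) < B + 1) sequentially"
      by eventually_elim auto
    then show ?thesis using wn(1) eventually_happens'[OF sequentially_bot] by blast
  qed
  then obtain w where w: "\<And>n. w n \<in> K \<eta>" "\<And>n. dist (w n) (g (t n)) < 1 / real (Suc n)" "\<And>n. cmod (branch p (w n)) < B + 1" by metis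
  have z: "(\<lambda>n. 1 / real (Suc n)) \<longlonglongrightarrow> 0" using LIMSEQ_inverse_real_of_nat by (simp add: inverse_eq_divide)
  have "(\<lambda>n. w n - g (t n)) \<longlonglongrightarrow> 0"
    by (rule Lim_null_comparison[OF _ z], rule always_eventually) (use w(2) in \<open>auto simp: dist_norm intro: less_imp_le\<close>)
  moreover have "(\<lambda>n. g (t n)) \<longlonglongrightarrow> g s" unfolding g_def by (intro tendsto_intros tendsto_Complex t(3))
  ultimately have "(\<lambda>n. (w n - g (t n)) + g (t n)) \<longlonglongrightarrow> 0 + g s" by (rule tendsto_add)
  then have lw: "w \<longlonglongrightarrow> g s" by simp
  have gs: "g s \<in> N" using s g_def by simp
  have "g s \<in> lift_dom p"
    by (rule bounded_branch_imp_lift_dom[OF hr[OF \<eta>] N_box[OF gs] _ w(1) lw, of "B + 1"]) (use og w(3) in \<open>auto intro: less_imp_le\<close>)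
  then show False using N_lift_dom[OF gs] by simp
qed

text \<open>Let the branch extend to an open segment of the left side between two obstacles. Cut the box off
  below the middle of this gap and then decrease the slope a little. This gives an escape box with slope
  \<open>\<eta>'\<close> that may contain points beyond the gap. Its obstacle \<open>e\<close> on the new left side
  is approached by points whose lifts have bounded slant for \<open>\<eta>'\<close> by \<open>escape_box_bounded\<close>. They also
  have bounded slant for \<open>\<eta>\<close>: either the points lie in the original box, or they lie
  beyond the gap, where \<open>under_arc_in_strip\<close> applies. Two different slants determine a point,
  so the lifts stay bounded and \<open>e\<close> is no obstacle.\<close>

lemma no_gap:
  assumes \<eta>: "j0 < \<eta>" "\<eta> < j1" and Fp: "Im (F p) = b1" and ab: "a < b"
    and gap: "\<And>t. a < t \<Longrightarrow> t < b \<Longrightarrow> Complex (support N \<eta> - \<eta> * t) t \<in> lift_dom p"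
    and ends: "Complex (support N \<eta> - \<eta> * a) a \<in> N" "Complex (support N \<eta> - \<eta> * b) b \<in> N"
    and eps: "\<epsilon> = 1 \<or> \<epsilon> = - 1"
    and L: "\<epsilon> * Im p < L" "\<And>t. a < t \<Longrightarrow> t < b \<Longrightarrow> L \<le> \<epsilon> * Im (branch p (Complex (support N \<eta> - \<eta> * t) t))"
  shows False
proof -
  define c where "c = support N \<eta>"
  define g where "g x = Complex (c - \<eta> * x) x" for x
  have og: "slant \<eta> (g x) = c" for x by (simp add: g_def slant_def)
  have gI [simp]: "Im (g x) = x" for x by (simp add: g_def)
  have gOm: "g t \<in> lift_dom p" if "a < t" "t < b" for t using gap[OF that] g_def c_def by simp
  have gN: "g a \<in> N" "g b \<in> N" using ends g_def c_def by auto
  have gLow: "L \<le> \<epsilon> * Im (branch p (g t))" if "a < t" "t < b" for t using L(2)[OF that] g_def c_def by simp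
  have h: "escape_box p b0 b1 d \<eta> c" unfolding c_def by (rule hr[OF \<eta>])
  have ab': "b0 < a" "b < b1"
    using escape_box_notin_Im[OF h N_box N_lift_dom og] gN by auto
  have gline: "w = g (Im w)" if "slant \<eta> w = c" for w using that by (simp add: g_def slant_def complex_eq_iff)
  have gbox: "g t \<in> left_strip b0 b1 d" if "a \<le> t" "t \<le> b" for t
    using escape_box_line[OF h, of t] that ab' unfolding left_strip_def by (auto simp: g_def)
  have bdg: "\<bar>slant \<eta> (branch p (g t))\<bar> \<le> C" if "a < t" "t < b" for t
    by (rule bound_on_closed_box[OF \<eta> gbox _ gOm]) (use that og c_def in auto)
  have normg: "cmod (branch p (g t)) \<le> C + (1 + \<bar>\<eta>\<bar>) * \<bar>\<epsilon> * Im (branch p (g t))\<bar>" if "a < t" "t < b" for t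
    using bounded_slant_Im[of "branch p (g t)" \<eta>] bdg[OF that] eps by auto
  have lim: "\<exists>\<delta>>0. \<forall>t. a < t \<and> t < b \<and> \<bar>t - s\<bar> < \<delta> \<longrightarrow> Y < \<epsilon> * Im (branch p (g t))" if s: "g s \<in> N" for s Y
  proof (rule ccontr)
    assume neg: "\<not> ?thesis"
    have "\<exists>t. a < t \<and> t < b \<and> \<bar>t - s\<bar> < 1 / real (Suc n) \<and> \<epsilon> * Im (branch p (g t)) \<le> Y" for n
    proof -
      have "1 / real (Suc n) > 0" by simp
      then show ?thesis using neg by (meson not_le)
    qed
    then obtain t where t: "\<And>n. a < t n" "\<And>n. t n < b" "\<And>n. \<bar>t n - s\<bar> < 1 / real (Suc n)" "\<And>n. \<epsilon> * Im (branch p (g (t n))) \<le> Y"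
      by metis
    have ts: "t \<longlonglongrightarrow> s"
      by (rule LIMSEQ_dist_inverse) (use t(3) in \<open>simp add: dist_real_def\<close>)
    have bnd: "cmod (branch p (g (t n))) \<le> C + (1 + \<bar>\<eta>\<bar>) * (\<bar>L\<bar> + \<bar>Y\<bar>)" for n
    proof -
      have "\<bar>\<epsilon> * Im (branch p (g (t n)))\<bar> \<le> \<bar>L\<bar> + \<bar>Y\<bar>" using gLow[OF t(1,2)] t(4)[of n] by (smt (verit))
      then have "(1 + \<bar>\<eta>\<bar>) * \<bar>\<epsilon> * Im (branch p (g (t n)))\<bar> \<le> (1 + \<bar>\<eta>\<bar>) * (\<bar>L\<bar> + \<bar>Y\<bar>)" by (intro mult_left_mono) auto
      then show ?thesis using normg[OF t(1,2), of n] by linarith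
    qed
    show False
    proof (rule gap_end_escape[OF \<eta>, folded c_def, folded g_def, OF s _ _ ts bnd])
      fix n show "g (t n) \<in> left_strip b0 b1 d" "g (t n) \<in> lift_dom p" 
        using gbox[of "t n"] gOm[of "t n"] t(1,2)[of n] by auto
    qed
  qed
  \<comment> \<open>The upper part of the box, with the upper end of the gap as an obstacle and with its lower corner in the gap.\<close>
  define b0' where "b0' = (a + b) / 2"
  have b0': "a < b0'" "b0' < b" using ab unfolding b0'_def by auto
  have h2: "escape_box p b0' b1 d \<eta> c"
    unfolding escape_box_def
  proof (intro conjI ballI)
    show "slant_box b0' b1 d \<eta> c \<subseteq> lift_dom p" using slant_box_mono[of b0 b0' b1 d \<eta> c] escape_boxD(1)[OF h] b0' ab' by auto
    show "F p \<in> slant_box b0' b1 d \<eta> c" using escape_boxD(2)[OF h] Fp b0' ab' by (auto simp: slant_box_def left_strip_def)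
    fix x assume x: "x \<in> {b0', b1}"
    show "c - \<eta> * x < d" by (rule escape_box_line[OF h]) (use x b0' ab' in auto)
    have "Complex (c - \<eta> * b0') b0' \<in> lift_dom p" using gOm[OF b0'] unfolding g_def .
    then show "Complex (c - \<eta> * x) x \<in> lift_dom p" using x escape_boxD(6)[OF h] by blast
  next
    show "\<exists>e. e \<in> left_strip b0' b1 d \<and> slant \<eta> e = c \<and> e \<notin> lift_dom p"
      using gN(2) N_box[OF gN(2)] N_lift_dom[OF gN(2)] og b0' by (intro exI[of _ "g b"]) (auto simp: left_strip_def)
  qed
  define N2 where "N2 = obstacle p b0' b1 d \<eta> (c - 1)"
  have N2: "compact N2" "N2 \<noteq> {}" unfolding N2_def using compact_obstacle escape_box_tilt(1)[OF h2 refl] by auto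
  have gbN2: "g b \<in> N2"
    unfolding N2_def obstacle_def using N_box[OF gN(2)] N_lift_dom[OF gN(2)] og b0' by (auto simp: left_strip_def)
  obtain \<delta>2 where d2: "\<delta>2 > 0" "\<And>\<eta>'. dist \<eta>' \<eta> < \<delta>2 \<Longrightarrow> escape_box p b0' b1 d \<eta>' (support N2 \<eta>')"
    using escape_box_tilt(3)[OF h2 N2_def] unfolding eventually_nhds_metric by blast
  define \<eta>' where "\<eta>' = \<eta> - \<delta>2 / 2"
  have \<eta>': "\<eta>' < \<eta>" "dist \<eta>' \<eta> < \<delta>2" unfolding \<eta>'_def using d2(1) by (auto simp: dist_real_def)
  define c' where "c' = support N2 \<eta>'"
  have h': "escape_box p b0' b1 d \<eta>' c'" unfolding c'_def by (rule d2(2)[OF \<eta>'(2)])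
  define K2 where "K2 = slant_box b0' b1 d \<eta>' c'"
  obtain C2 where C2: "\<And>w. w \<in> K2 \<Longrightarrow> \<bar>slant \<eta>' (branch p w)\<bar> \<le> C2" using escape_box_bounded[OF h'] unfolding K2_def by metis
  obtain e where e: "e \<in> N2" "slant \<eta>' e = c'" using support_attained[OF N2] unfolding c'_def by metis
  have e2: "e \<in> left_strip b0' b1 d" "e \<notin> lift_dom p" using e(1) unfolding N2_def obstacle_def by auto
  have ecle: "slant \<eta> e \<le> c"
  proof (rule ccontr)
    assume "\<not> ?thesis"
    then have "e \<in> slant_box b0' b1 d \<eta> c" using e2 by (auto simp: slant_box_def)
    then show False using escape_boxD(1)[OF h2] e2 by auto
  qed
  have c'ge: "slant \<eta>' (g b) \<le> c'" unfolding c'_def by (rule support_upper[OF N2(1) gbN2])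
  obtain wn where wn: "\<And>n::nat. wn n \<in> open_segment (F p) e \<or> wn n = e \<and> F p = e" "\<And>n. wn n \<in> K2" "wn \<longlonglongrightarrow> e"
    using slant_box_approach[OF h' e2(1)] e(2) unfolding K2_def by force
  have both: False if w: "eventually (\<lambda>n. \<bar>slant \<eta> (branch p (wn n))\<bar> \<le> C) sequentially"
  proof -
    obtain n0 where n0: "\<And>n. n \<ge> n0 \<Longrightarrow> \<bar>slant \<eta> (branch p (wn n))\<bar> \<le> C" using w unfolding eventually_sequentially by auto
    define \<kappa> where "\<kappa> = (C + C2) / (\<eta> - \<eta>')"
    have "cmod (branch p (wn (n + n0))) \<le> C + (1 + \<bar>\<eta>\<bar>) * \<kappa>" for n
    proof -
      define q where "q = branch p (wn (n + n0))"
      have o: "\<bar>slant \<eta> q\<bar> \<le> C" "\<bar>slant \<eta>' q\<bar> \<le> C2" using n0[of "n + n0"] C2[OF wn(2)] unfolding q_def by auto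
      have "(\<eta> - \<eta>') * Im q = slant \<eta> q - slant \<eta>' q" by (simp add: slant_def algebra_simps)
      then have "\<bar>(\<eta> - \<eta>') * Im q\<bar> \<le> C + C2" using o by linarith
      then have "\<bar>Im q\<bar> \<le> \<kappa>" unfolding \<kappa>_def using \<eta>'(1) by (simp add: abs_mult field_simps)
      then have "(1 + \<bar>\<eta>\<bar>) * \<bar>Im q\<bar> \<le> (1 + \<bar>\<eta>\<bar>) * \<kappa>" by (intro mult_left_mono) auto
      then show ?thesis using bounded_slant_Im[of q \<eta>] o(1) unfolding q_def by linarith
    qed
    then have "e \<in> lift_dom p"
      using bounded_branch_imp_lift_dom[OF h' e2(1), of "\<lambda>n. wn (n + n0)"] e(2) wn(2) LIMSEQ_ignore_initial_segment[OF wn(3)]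
      unfolding K2_def by auto
    then show False using e2 by simp
  qed
  show False
  proof (cases "slant \<eta> e = c")
    case True
    have "e = g (Im e)" by (rule gline[OF True])
    moreover have "Im e \<le> b"
    proof -
      have "slant \<eta>' (g b) = c + (\<eta>' - \<eta>) * b" "slant \<eta>' e = c + (\<eta>' - \<eta>) * Im e"
        using slant_change[of \<eta>' "g b" \<eta>] slant_change[of \<eta>' e \<eta>] og True by auto
      then have "(\<eta> - \<eta>') * (b - Im e) \<ge> 0" using c'ge e(2) by (simp add: algebra_simps)
      then show ?thesis using \<eta>'(1) by (simp add: zero_le_mult_iff)
    qed
    moreover have "\<not> (a < Im e \<and> Im e < b)" using gOm[of "Im e"] \<open>e = g (Im e)\<close> e2(2) by auto
    moreover have "b0' \<le> Im e" using e2(1) by (auto simp: left_strip_def)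
    ultimately have eb: "e = g b" using b0' by (metis leI less_le_trans order_antisym)
    have "wn n \<in> K \<eta>" for n
    proof -
      have "open_segment (F p) e \<subseteq> slant_box b0 b1 d \<eta> c"
        by (rule open_segment_slant_box[OF escape_boxD(2)[OF h]]) (use eb N_box gN og in auto)
      then show ?thesis using wn(1)[of n] escape_boxD(2)[OF h] unfolding c_def by auto
    qed
    then have "\<And>n. \<bar>slant \<eta> (branch p (wn n))\<bar> \<le> C" using bd[OF \<eta>] by blast
    then show False using both by simp
  next
    case False
    then have elt: "slant \<eta> e < c" using ecle by simp
    define V where "V = K2 \<inter> {w. slant \<eta> w < c}"
    have "convex {w. slant \<eta> w < c}" using convex_halfspace_lt[of "Complex 1 \<eta>" c] by (simp add: slant_inner)
    then have cV: "convex V" unfolding V_def K2_def by (intro convex_Int slant_box_convex)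
    have VOm: "V \<subseteq> lift_dom p" using escape_boxD(1)[OF h'] unfolding V_def K2_def by auto
    \<comment> \<open>The lower corner lies to the right of the new left side, so the new box reaches beyond the gap near this corner.\<close>
    have gm0: "c' < slant \<eta>' (g b0')"
    proof -
      have "(\<eta> - \<eta>') * (Im e - b0') \<ge> 0" using \<eta>'(1) e2(1) by (intro mult_nonneg_nonneg) (auto simp: left_strip_def)
      then have "c' < c + (\<eta>' - \<eta>) * b0'"
        using e(2) slant_change[of \<eta>' e \<eta>] elt by (simp add: algebra_simps)
      then show ?thesis using slant_change[of \<eta>' "g b0'" \<eta>] og by simp
    qed
    have "((\<lambda>t. slant \<eta>' (g t)) \<longlongrightarrow> slant \<eta>' (g b0')) (at_right b0')"
      unfolding slant_def g_def by (auto intro!: tendsto_intros)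
    then have "eventually (\<lambda>t. c' < slant \<eta>' (g t)) (at_right b0')" using gm0 by (rule order_tendstoD)
    then obtain m' where m': "m' > b0'" "\<And>t. b0' < t \<Longrightarrow> t < m' \<Longrightarrow> c' < slant \<eta>' (g t)"
      unfolding eventually_at_right_field by blast
    define m where "m = (b0' + min m' b) / 2"
    have m: "b0' < m" "m < b" "c' < slant \<eta>' (g m)" "a < m"
    proof -
      show "b0' < m" "m < b" using m'(1) b0' unfolding m_def by (auto simp: min_def field_simps)
      then show "a < m" using b0' by simp
      show "c' < slant \<eta>' (g m)" by (rule m'(2)) (use m'(1) b0' in \<open>auto simp: m_def min_def field_simps\<close>)
    qed
    define I where "I = lift_dom p \<inter> {w. b0' < Im w \<and> Im w < b \<and> Re w < d \<and> c' < slant \<eta>' w}"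
    have "open I" unfolding I_def
      by (intro open_Int open_lift_dom open_Collect_conj open_Collect_less continuous_intros)
    moreover have "g m \<in> I" unfolding I_def using gOm[OF m(4,2)] m escape_box_line[OF h, of m] ab' b0' by (auto simp: g_def)
    ultimately obtain \<rho>' where \<rho>': "\<rho>' > 0" "cball (g m) \<rho>' \<subseteq> I" unfolding open_contains_cball by blast
    define \<rho> where "\<rho> = min \<rho>' (min ((m - a) / 2) ((b - m) / 2))"
    have \<rho>: "\<rho> > 0" "cball (g m) \<rho> \<subseteq> I" "a < m - \<rho>" "m + \<rho> < b"
    proof -
      show "\<rho> > 0" "cball (g m) \<rho> \<subseteq> I" using \<rho>' m unfolding \<rho>_def by (auto intro: subset_trans[rotated])
      show "a < m - \<rho>" "m + \<rho> < b" using m unfolding \<rho>_def by (auto simp: min_def field_simps)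
    qed
    have bI: "ball (g m) \<rho> \<subseteq> I" using \<rho>(2) ball_subset_cball by blast
    define \<Phi> where "\<Phi> w = Complex (slant \<eta> (branch p w)) (\<epsilon> * Im (branch p w))" for w
    have conP: "continuous_on S \<Phi>" if "S \<subseteq> lift_dom p" for S
      unfolding \<Phi>_def Complex_eq by (intro continuous_intros continuous_on_branch that)
    have e0: "\<epsilon> \<noteq> 0" using eps by auto
    have injP: "inj_on \<Phi> (lift_dom p)"
    proof (rule inj_onI)
      fix x y assume xy: "x \<in> lift_dom p" "y \<in> lift_dom p" "\<Phi> x = \<Phi> y"
      then have "Im (branch p x) = Im (branch p y)" "slant \<eta> (branch p x) = slant \<eta> (branch p y)" using e0 unfolding \<Phi>_def by auto
      then have "branch p x = branch p y" by (simp add: slant_def complex_eq_iff)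
      then show "x = y" using xy inj_on_branch by (meson inj_onD)
    qed
    have disj: "\<Phi> ` X \<inter> \<Phi> ` Z = {}" if "X \<subseteq> lift_dom p" "Z \<subseteq> lift_dom p" "X \<inter> Z = {}" for X Z
      using that injP by (metis image_empty inj_on_image_Int)
    define \<Gamma> where "\<Gamma> = g ` {a<..<b}"
    have GOm: "\<Gamma> \<subseteq> lift_dom p" unfolding \<Gamma>_def using gOm by auto
    have cg: "continuous_on S g" for S unfolding g_def Complex_eq by (intro continuous_intros)
    have KOm: "K \<eta> \<subseteq> lift_dom p" by (rule K_lift_dom[OF \<eta>])
    define A1 where "A1 = ball (g m) \<rho> \<inter> {w. c < slant \<eta> w}"
    define B1 where "B1 = ball (g m) \<rho> \<inter> {w. slant \<eta> w < c}"
    have A1K: "A1 \<subseteq> K \<eta>" using bI b0' ab' unfolding A1_def I_def slant_box_def left_strip_def c_def[symmetric] by auto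
    have B1V: "B1 \<subseteq> V" using bI ab' unfolding B1_def I_def V_def K2_def slant_box_def left_strip_def by auto
    have bOm: "ball (g m) \<rho> \<subseteq> lift_dom p" using bI unfolding I_def by auto
    have cmpB: "bounded (\<Phi> ` ball (g m) \<rho>)"
    proof -
      have "compact (\<Phi> ` cball (g m) \<rho>)" by (intro compact_continuous_image conP) (use \<rho>(2) I_def in auto)
      then show ?thesis by (meson ball_subset_cball bounded_subset compact_imp_bounded image_mono)
    qed
    have opn: "open (\<Phi> ` ball (g m) \<rho>)"
      by (rule invariance_of_domain[OF conP[OF bOm] open_ball inj_on_subset[OF injP bOm]])
    have strip: "\<bar>Re x\<bar> \<le> C" if x: "x \<in> \<Phi> ` V" for x
    proof (rule under_arc_in_strip[where \<gamma>="\<Phi> \<circ> g" and a=a and b=b and m=m and ?m1.0="m - \<rho>" and ?m2.0="m + \<rho>"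
          and A="\<Phi> ` K \<eta>" and B="\<Phi> ` V" and z="\<Phi> (F p)" and L=L and O'="\<Phi> ` ball (g m) \<rho>" and ?A1.0="\<Phi> ` A1" and ?B1.0="\<Phi> ` B1"])
      show "continuous_on {a<..<b} (\<Phi> \<circ> g)"
        by (rule continuous_on_compose[OF cg conP]) (use GOm \<Gamma>_def in auto)
      show "inj_on (\<Phi> \<circ> g) {a<..<b}"
      proof (rule comp_inj_on)
        show "inj_on g {a<..<b}" by (rule inj_onI) (metis gI)
        show "inj_on \<Phi> (g ` {a<..<b})" by (rule inj_on_subset[OF injP]) (use GOm \<Gamma>_def in auto)
      qed
      fix t assume t: "a < t" "t < b"
      show "\<bar>Re ((\<Phi> \<circ> g) t)\<bar> \<le> C \<and> L \<le> Im ((\<Phi> \<circ> g) t)"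
        using bdg[OF t] gLow[OF t] unfolding \<Phi>_def by simp
    next
      show "filterlim (\<lambda>t. Im ((\<Phi> \<circ> g) t)) at_top (at_right a)"
        unfolding filterlim_at_top_dense
      proof
        fix Y
        obtain \<delta> where "\<delta> > 0" "\<And>t. a < t \<and> t < b \<and> \<bar>t - a\<bar> < \<delta> \<Longrightarrow> Y < \<epsilon> * Im (branch p (g t))" using lim[OF gN(1), of Y] by blast
        then show "eventually (\<lambda>t. Y < Im ((\<Phi> \<circ> g) t)) (at_right a)"
          unfolding eventually_at_right_field \<Phi>_def using ab by (intro exI[of _ "min b (a + \<delta>)"]) auto
      qed
      show "filterlim (\<lambda>t. Im ((\<Phi> \<circ> g) t)) at_top (at_left b)"
        unfolding filterlim_at_top_dense
      proof
        fix Y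
        obtain \<delta> where "\<delta> > 0" "\<And>t. a < t \<and> t < b \<and> \<bar>t - b\<bar> < \<delta> \<Longrightarrow> Y < \<epsilon> * Im (branch p (g t))" using lim[OF gN(2), of Y] by blast
        then show "eventually (\<lambda>t. Y < Im ((\<Phi> \<circ> g) t)) (at_left b)"
          unfolding eventually_at_left_field \<Phi>_def using ab by (intro exI[of _ "max a (b - \<delta>)"]) auto
      qed
      show "a < m - \<rho>" "m - \<rho> < m" "m < m + \<rho>" "m + \<rho> < b" using \<rho> by auto
      show "path_connected (\<Phi> ` K \<eta>)" by (intro path_connected_continuous_image conP KOm convex_imp_path_connected slant_box_convex)
      show "\<Phi> ` K \<eta> \<inter> (\<Phi> \<circ> g) ` {a<..<b} = {}"
        unfolding image_comp[symmetric] by (rule disj) (use KOm GOm og in \<open>auto simp: \<Gamma>_def slant_box_def c_def\<close>)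
      show "\<Phi> (F p) \<in> \<Phi> ` K \<eta>" using escape_boxD(2)[OF h] c_def by auto
      show "Im (\<Phi> (F p)) < L" using L(1) unfolding \<Phi>_def by (simp add: lift_dom_base)
      show "path_connected (\<Phi> ` V)" by (intro path_connected_continuous_image conP VOm convex_imp_path_connected cV)
      show "\<Phi> ` V \<inter> (\<Phi> \<circ> g) ` {a<..<b} = {}"
        unfolding image_comp[symmetric] by (rule disj) (use VOm GOm og in \<open>auto simp: \<Gamma>_def V_def\<close>)
      show "open (\<Phi> ` ball (g m) \<rho>)" by (rule opn)
      show "(\<Phi> \<circ> g) m \<in> \<Phi> ` ball (g m) \<rho>" using \<rho>(1) by auto
      show "bounded (\<Phi> ` ball (g m) \<rho>)" by (rule cmpB)
      show "\<Phi> ` ball (g m) \<rho> \<subseteq> \<Phi> ` A1 \<union> \<Phi> ` B1 \<union> (\<Phi> \<circ> g) ` {m - \<rho>..m + \<rho>}"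
      proof -
        have "w \<in> A1 \<union> B1 \<union> g ` {m - \<rho>..m + \<rho>}" if w: "w \<in> ball (g m) \<rho>" for w
        proof (cases "slant \<eta> w = c")
          case True
          have "\<bar>Im (g m - w)\<bar> < \<rho>" using w abs_Im_le_cmod[of "g m - w"] by (simp add: dist_norm)
          then have "Im w \<in> {m - \<rho>..m + \<rho>}" by auto
          then show ?thesis using gline[OF True] by blast
        qed (use w in \<open>auto simp: A1_def B1_def\<close>)
        then have "ball (g m) \<rho> \<subseteq> A1 \<union> B1 \<union> g ` {m - \<rho>..m + \<rho>}" by blast
        then have "\<Phi> ` ball (g m) \<rho> \<subseteq> \<Phi> ` (A1 \<union> B1 \<union> g ` {m - \<rho>..m + \<rho>})" by (rule image_mono)
        then show ?thesis by (simp only: image_Un image_comp)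
      qed
      show "\<Phi> ` A1 \<subseteq> \<Phi> ` K \<eta>" "\<Phi> ` B1 \<subseteq> \<Phi> ` V" using A1K B1V by auto
      have "convex A1" unfolding A1_def by (intro convex_Int convex_ball convex_slant_gt)
      then show "connected (\<Phi> ` A1)" using A1K KOm by (intro connected_continuous_image conP convex_connected) auto
      have "convex B1" unfolding B1_def by (intro convex_Int convex_ball \<open>convex {w. slant \<eta> w < c}\<close>)
      then show "connected (\<Phi> ` B1)" using B1V VOm by (intro connected_continuous_image conP convex_connected) auto
      have om1: "slant \<eta> (of_real x) = x" for x by (simp add: slant_def)
      have "g m + of_real (\<rho> / 2) \<in> A1" "g m - of_real (\<rho> / 2) \<in> B1"
        unfolding A1_def B1_def using \<rho>(1) og by (auto simp: slant_add slant_diff om1 dist_norm simp del: of_real_divide)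
      then show "\<Phi> ` A1 \<noteq> {}" "\<Phi> ` B1 \<noteq> {}" by auto
      show "\<Phi> ` A1 \<subseteq> \<Phi> ` ball (g m) \<rho>" "\<Phi> ` B1 \<subseteq> \<Phi> ` ball (g m) \<rho>" unfolding A1_def B1_def by auto
      show "x \<in> \<Phi> ` V" by (rule x)
    qed
    have "(\<lambda>n. slant \<eta> (wn n)) \<longlonglongrightarrow> slant \<eta> e" by (intro tendsto_slant wn(3) tendsto_const)
    then have "eventually (\<lambda>n. slant \<eta> (wn n) < c) sequentially" using elt by (rule order_tendstoD)
    then have "eventually (\<lambda>n. \<bar>slant \<eta> (branch p (wn n))\<bar> \<le> C) sequentially"
    proof eventually_elim
      case (elim n)
      then have "wn n \<in> V" unfolding V_def using wn(2) by auto
      then show ?case using strip[of "\<Phi> (wn n)"] unfolding \<Phi>_def by auto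
    qed
    then show False by (rule both)
  qed
qed

end

section \<open>The branch covers a half strip\<close>

context fan
begin

text \<open>If \<open>w\<close> lies on the supporting line for \<open>\<eta>\<close> and beyond no other supporting line, its imaginary part lies
  between those of two supporting points, the limits of supporting points for slopes tending to \<open>\<eta>\<close> from
  below and from above.\<close>

lemma subgradient_maximizer:
  assumes \<eta>: "j0 < \<eta>" "\<eta> < j1" and w: "\<And>\<eta>'. j0 < \<eta>' \<Longrightarrow> \<eta>' < j1 \<Longrightarrow> slant \<eta>' w \<le> support N \<eta>'" "slant \<eta> w = support N \<eta>"
    and s: "s = 1 \<or> s = - 1"
  obtains e where "e \<in> N" "slant \<eta> e = support N \<eta>" "s * (Im e - Im w) \<ge> 0"
proof -
  have "\<exists>e. e \<in> N \<and> slant \<eta>' e = support N \<eta>'" for \<eta>' using support_attained[OF N(1,2)] by metis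
  then obtain E where E: "\<And>\<eta>'. E \<eta>' \<in> N" "\<And>\<eta>'. slant \<eta>' (E \<eta>') = support N \<eta>'" by metis
  define h where "h n = \<eta> + s / real (Suc n)" for n
  have hl: "h \<longlonglongrightarrow> \<eta>"
    using tendsto_add[OF tendsto_const tendsto_mult[OF tendsto_const LIMSEQ_inverse_real_of_nat], of \<eta> s]
    unfolding h_def by (simp add: divide_inverse)
  have "seq_compact N" using N(1) compact_imp_seq_compact by blast
  then obtain l m where m: "l \<in> N" "strict_mono m" "((\<lambda>n. E (h n)) \<circ> m) \<longlonglongrightarrow> l"
    using E(1) unfolding seq_compact_def by metis
  have hm: "(h \<circ> m) \<longlonglongrightarrow> \<eta>" using LIMSEQ_subseq_LIMSEQ[OF hl m(2)] .
  have ol: "slant \<eta> l = support N \<eta>"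
    by (rule maximizer_limit(2)[OF _ _ hm m(3)]) (use E in auto)
  have "eventually (\<lambda>n. j0 < (h \<circ> m) n \<and> (h \<circ> m) n < j1) sequentially"
    using order_tendstoD[OF hm] \<eta> by (auto intro: eventually_conj)
  then have ev: "eventually (\<lambda>n. s * (Im (((\<lambda>n. E (h n)) \<circ> m) n) - Im w) \<ge> 0) sequentially"
  proof eventually_elim
    case (elim n)
    define x where "x = h (m n)"
    have "slant x w \<le> slant x (E x)" using w(1)[of x] elim E unfolding x_def by auto
    moreover have "slant \<eta> (E x) \<le> slant \<eta> w" using support_upper[OF N(1) E(1), of \<eta> x] w(2) by simp
    ultimately have "(x - \<eta>) * (Im (E x) - Im w) \<ge> 0" by (simp add: slant_def algebra_simps)
    moreover define \<kappa> where "\<kappa> = 1 / real (Suc (m n))"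
    have "x - \<eta> = \<kappa> * s" unfolding x_def h_def \<kappa>_def by simp
    ultimately have "\<kappa> * (s * (Im (E x) - Im w)) \<ge> 0" by (simp only: mult.assoc)
    moreover have "\<kappa> > 0" unfolding \<kappa>_def by simp
    ultimately have "s * (Im (E x) - Im w) \<ge> 0" by (simp only: zero_le_mult_iff) auto
    then show ?case by (simp add: x_def)
  qed
  have "(\<lambda>n. s * (Im (((\<lambda>n. E (h n)) \<circ> m) n) - Im w)) \<longlonglongrightarrow> s * (Im l - Im w)"
    by (intro tendsto_intros m(3))
  then have "s * (Im l - Im w) \<ge> 0" by (rule tendsto_lowerbound[OF _ ev]) simp
  then show ?thesis using that m(1) ol by blast
qed

end

context fan_tip
begin

text \<open>The half strip is connected and meets the image of the boxes, so it suffices that this image is open and closed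
  in it. In the half strip the slopes of the boxes involved are close to \<open>\<eta>0\<close>, because a small
  change of the slope has a large effect at large height. It follows that the points lie
  near the tip, in the interior of the strip, which gives openness. A limit \<open>q\<close> of points of the image lies
  over a point \<open>w\<close> of a closed box to which the branch extends. If \<open>w\<close> belongs to no box
  of the fan, it lies in a gap between two obstacles, and this contradicts \<open>no_gap\<close>.\<close>

lemma half_strip_covered:
  assumes Fp: "Im (F p) = b1"
    and eps: "\<epsilon> = 1 \<or> \<epsilon> = - 1"
    and sgn: "\<And>Y. \<exists>r>0. \<exists>\<delta>>0. \<forall>\<eta> w. \<bar>\<eta> - \<eta>0\<bar> < \<delta> \<longrightarrow> w \<in> K \<eta> \<longrightarrow> dist w e0 < r \<longrightarrow> \<epsilon> * Im (branch p w) \<ge> Y"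
  shows "\<exists>Y. \<forall>q. \<bar>slant \<eta>0 q\<bar> \<le> A \<longrightarrow> Y \<le> \<epsilon> * Im q \<longrightarrow> q \<in> branch p ` (\<Union>\<eta>\<in>{j0<..<j1}. K \<eta>)"
proof -
  \<comment> \<open>Lifts of points near the tip are higher than \<open>p\<close>, as \<open>no_gap\<close> requires of the lift of a gap.\<close>
  define L where "L = \<epsilon> * Im p + 1"
  obtain r0 d0 where r0: "r0 > 0" "d0 > 0" "\<And>\<eta> w. \<bar>\<eta> - \<eta>0\<bar> < d0 \<Longrightarrow> w \<in> K \<eta> \<Longrightarrow> dist w e0 < r0 \<Longrightarrow> \<epsilon> * Im (branch p w) \<ge> L"
    using sgn[of L] by blast
  obtain d1 where d1: "d1 > 0" "\<And>\<eta> e. \<bar>\<eta> - \<eta>0\<bar> < d1 \<Longrightarrow> e \<in> N \<Longrightarrow> slant \<eta> e = support N \<eta> \<Longrightarrow> dist e e0 < r0"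
    using maximizers_near_tip[OF r0(1)] by blast
  define I where "I = {w. b0 < Im w \<and> Im w < b1 \<and> Re w < d}"
  have oI: "open I" unfolding I_def by (intro open_Collect_conj open_Collect_less continuous_intros)
  have "e0 \<in> I"
  proof -
    have "b0 < Im e0" "Im e0 < b1" using escape_box_notin_Im[OF hr[OF \<eta>0] N_box N_lift_dom] e0 by auto
    moreover have "Re e0 = support N \<eta>0 - \<eta>0 * Im e0" using e0 by (simp add: slant_def)
    ultimately show ?thesis using escape_box_line[OF hr[OF \<eta>0], of "Im e0"] unfolding I_def by auto
  qed
  then obtain r1 where r1: "r1 > 0" "ball e0 r1 \<subseteq> I" using oI open_contains_ball by blast
  obtain R d2 where d2: "d2 > 0" "\<And>\<eta> w. \<bar>\<eta> - \<eta>0\<bar> < d2 \<Longrightarrow> w \<in> K \<eta> \<Longrightarrow> cmod (branch p w) > R \<Longrightarrow> dist w e0 < r1"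
    using far_near_tip[OF r1(1)] by blast
  define \<delta> where "\<delta> = min (min d0 d1) (min d2 (min (\<eta>0 - j0) (j1 - \<eta>0)))"
  have \<delta>: "\<delta> > 0" "\<delta> \<le> d0" "\<delta> \<le> d1" "\<delta> \<le> d2" unfolding \<delta>_def using r0 d1 d2 \<eta>0 by auto
  have \<delta>j: "j0 < \<eta>" "\<eta> < j1" if "\<bar>\<eta> - \<eta>0\<bar> < \<delta>" for \<eta> using that unfolding \<delta>_def by auto
  define A' where "A' = max A C"
  \<comment> \<open>At this height a lift has slant at most \<open>A'\<close> for \<open>\<eta>0\<close> and at most \<open>C\<close> for \<open>\<eta>\<close> only if the slopes differ by at most \<open>\<delta> / 2\<close>.\<close>
  define Y where "Y = 2 * (\<bar>A'\<bar> + \<bar>C\<bar>) / \<delta> + \<bar>R\<bar> + 1"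
  have "2 * (\<bar>A'\<bar> + \<bar>C\<bar>) / \<delta> \<ge> 0" using \<delta>(1) by simp
  then have Y: "Y \<ge> 1" "Y > R" unfolding Y_def by linarith+
  have tilt: "\<bar>\<eta> - \<eta>0\<bar> \<le> \<delta> / 2" if "\<bar>slant \<eta> q\<bar> \<le> C" "\<bar>slant \<eta>0 q\<bar> \<le> A'" "Y \<le> \<epsilon> * Im q" for \<eta> q
  proof -
    have "\<bar>(\<eta> - \<eta>0) * Im q\<bar> \<le> \<bar>A'\<bar> + \<bar>C\<bar>" using that(1,2) slant_change[of \<eta> q \<eta>0] by linarith
    moreover have "Y \<le> \<bar>Im q\<bar>" using that(3) eps by auto
    then have "\<bar>\<eta> - \<eta>0\<bar> * Y \<le> \<bar>(\<eta> - \<eta>0) * Im q\<bar>" unfolding abs_mult by (rule mult_left_mono) simp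
    moreover have "\<bar>\<eta> - \<eta>0\<bar> * (2 * (\<bar>A'\<bar> + \<bar>C\<bar>) / \<delta>) + \<bar>\<eta> - \<eta>0\<bar> \<le> \<bar>\<eta> - \<eta>0\<bar> * Y"
      unfolding Y_def by (simp add: distrib_left)
    ultimately have le: "\<bar>\<eta> - \<eta>0\<bar> * (2 * (\<bar>A'\<bar> + \<bar>C\<bar>) / \<delta>) + \<bar>\<eta> - \<eta>0\<bar> \<le> \<bar>A'\<bar> + \<bar>C\<bar>" by linarith
    show ?thesis
    proof (cases "\<bar>A'\<bar> + \<bar>C\<bar> = 0")
      case True
      have "\<bar>\<eta> - \<eta>0\<bar> \<le> 0" using le unfolding True by simp
      then show ?thesis using \<delta>(1) by simp
    next
      case False
      then have ac: "\<bar>A'\<bar> + \<bar>C\<bar> > 0" by simp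
      have "\<bar>\<eta> - \<eta>0\<bar> * (2 * (\<bar>A'\<bar> + \<bar>C\<bar>) / \<delta>) \<le> \<bar>A'\<bar> + \<bar>C\<bar>" using le by linarith
      moreover have eqk: "x * (2 * k / \<delta>) = (x * (2 / \<delta>)) * k" for x k :: real by simp
      ultimately have "(\<bar>\<eta> - \<eta>0\<bar> * (2 / \<delta>)) * (\<bar>A'\<bar> + \<bar>C\<bar>) \<le> 1 * (\<bar>A'\<bar> + \<bar>C\<bar>)"
        by (simp only: eqk mult_1)
      then have "\<bar>\<eta> - \<eta>0\<bar> * (2 / \<delta>) \<le> 1" using ac by (simp only: mult_le_cancel_right_pos)
      then show ?thesis using \<delta>(1) by (simp add: field_simps)
    qed
  qed
  define U where "U = (\<Union>\<eta>\<in>{j0<..<j1}. K \<eta>)"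
  have UOm: "U \<subseteq> lift_dom p" unfolding U_def by (intro UN_least K_lift_dom) auto
  define Z where "Z = {q. \<bar>slant \<eta>0 q\<bar> \<le> A' \<and> Y \<le> \<epsilon> * Im q}"
  have "Z = {q. slant \<eta>0 q \<le> A'} \<inter> {q. - A' \<le> slant \<eta>0 q} \<inter> {q. Complex 0 \<epsilon> \<bullet> q \<ge> Y}"
    unfolding Z_def by (auto simp: inner_complex_def)
  then have conZ: "connected Z"
    by (auto intro!: convex_connected convex_Int convex_halfspace_ge simp: slant_inner convex_halfspace_le convex_halfspace_ge)
  have ZI: "\<bar>\<eta> - \<eta>0\<bar> \<le> \<delta> / 2" "w \<in> I" if "w \<in> K \<eta>" "j0 < \<eta>" "\<eta> < j1" "branch p w \<in> Z" for w \<eta>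
  proof -
    show t: "\<bar>\<eta> - \<eta>0\<bar> \<le> \<delta> / 2" by (rule tilt[OF bd[OF that(2,3,1)]]) (use that(4) Z_def in auto)
    have "cmod (branch p w) > R" using that(4) Y(2) eps abs_Im_le_cmod[of "branch p w"] unfolding Z_def by auto
    then have "dist w e0 < r1" by (intro d2(2)[of \<eta> w]) (use t \<delta> that in auto)
    then show "w \<in> I" using r1(2) by (auto simp: dist_commute)
  qed
  define D where "D = branch p ` (U \<inter> I)"
  have "open (U \<inter> I)"
  proof -
    have "U \<inter> I = (\<Union>\<eta>\<in>{j0<..<j1}. I \<inter> {w. support N \<eta> < slant \<eta> w})"
      unfolding U_def slant_box_def left_strip_def I_def by auto
    moreover have "open {w. support N \<eta> < slant \<eta> w}" for \<eta> by (intro open_Collect_less continuous_intros)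
    ultimately show ?thesis using oI by (simp only:) (intro open_UN ballI open_Int)
  qed
  then have oD: "open D" unfolding D_def by (rule open_branch_image) (use UOm in auto)
  have UZ: "branch p w \<in> D" if "w \<in> U" "branch p w \<in> Z" for w
    using that ZI unfolding D_def U_def by auto
  have op: "openin (top_of_set Z) (Z \<inter> D)" using oD by (simp add: openin_open_Int)
  have cl: "closedin (top_of_set Z) (Z \<inter> D)"
  proof -
    have "q \<in> D" if qZ: "q \<in> Z" and qc: "q \<in> closure (Z \<inter> D)" for q
    proof -
    obtain qn where qn: "\<forall>n::nat. qn n \<in> Z \<inter> D" "qn \<longlonglongrightarrow> q" using qc unfolding closure_sequential by blast
    have "\<forall>n. \<exists>w \<eta>. w \<in> K \<eta> \<and> j0 < \<eta> \<and> \<eta> < j1 \<and> qn n = branch p w" using qn(1) unfolding D_def U_def by fastforce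
    then obtain wn hn where wn: "\<And>n. wn n \<in> K (hn n)" "\<And>n. j0 < hn n" "\<And>n. hn n < j1" "\<And>n. qn n = branch p (wn n)" by metis
    have hd: "hn n \<in> {\<eta>0 - \<delta>/2..\<eta>0 + \<delta>/2}" for n
    proof -
      have "branch p (wn n) \<in> Z" using qn(1) wn(4)[of n] by (metis IntD1)
      then have "\<bar>hn n - \<eta>0\<bar> \<le> \<delta> / 2" using ZI(1)[OF wn(1-3)[of n]] by simp
      then show ?thesis unfolding abs_le_iff by auto
    qed
    have "seq_compact {\<eta>0 - \<delta>/2..\<eta>0 + \<delta>/2}" using compact_Icc compact_imp_seq_compact by blast
    then obtain \<eta> m where m: "\<eta> \<in> {\<eta>0 - \<delta>/2..\<eta>0 + \<delta>/2}" "strict_mono m" "(hn \<circ> m) \<longlonglongrightarrow> \<eta>"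
      using hd unfolding seq_compact_def by metis
    have ed: "\<bar>\<eta> - \<eta>0\<bar> < \<delta>" using m(1) \<delta>(1) by auto
    note ej = \<delta>j[OF ed]
    define w where "w = F q"
    have Fw: "F (qn n) = wn n" for n using subsetD[OF K_lift_dom[OF wn(2,3)] wn(1), of n] wn(4)[of n] by simp
    have "(\<lambda>n. F (qn n)) \<longlonglongrightarrow> F q"
      using cont_F qn(2) by (metis isCont_tendsto_compose UNIV_I continuous_on_eq_continuous_at open_UNIV)
    then have lw: "(wn \<circ> m) \<longlonglongrightarrow> w" unfolding Fw w_def using LIMSEQ_subseq_LIMSEQ[OF _ m(2)] by blast
    have lq: "(\<lambda>n. branch p ((wn \<circ> m) n)) \<longlonglongrightarrow> q" using LIMSEQ_subseq_LIMSEQ[OF qn(2) m(2)] wn(4) by (simp add: o_def)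
    have wK: "(wn \<circ> m) n \<in> K ((hn \<circ> m) n)" for n using wn(1) by simp
    have wOm: "w \<in> lift_dom p" "branch p w = q" using escape_lim[OF ej m(3) wK lw lq] by auto
    have wb: "w \<in> left_strip b0 b1 d" "support N \<eta> \<le> slant \<eta> w" using limit_in_closed_box[OF m(3) wK lw] by auto
    have "w \<in> U"
    proof (rule ccontr)
      assume nU: "w \<notin> U"
      then have sub: "slant \<eta>' w \<le> support N \<eta>'" if "j0 < \<eta>'" "\<eta>' < j1" for \<eta>'
        using that wb(1) unfolding U_def slant_box_def by (metis (mono_tags, lifting) UN_iff greaterThanLessThan_iff mem_Collect_eq not_le)
      have we: "slant \<eta> w = support N \<eta>" using wb(2) sub[OF ej] by simp
      obtain e1 where e1: "e1 \<in> N" "slant \<eta> e1 = support N \<eta>" "- 1 * (Im e1 - Im w) \<ge> 0"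
        by (rule subgradient_maximizer[OF ej sub we, of "- 1"]) auto
      obtain e2 where e2: "e2 \<in> N" "slant \<eta> e2 = support N \<eta>" "1 * (Im e2 - Im w) \<ge> 0"
        by (rule subgradient_maximizer[OF ej sub we, of 1]) auto
      define c where "c = support N \<eta>"
      define g where "g x = Complex (c - \<eta> * x) x" for x
      have gline: "v = g (Im v)" if "slant \<eta> v = c" for v using that by (simp add: g_def slant_def complex_eq_iff)
      have og: "slant \<eta> (g x) = c" for x by (simp add: g_def slant_def)
      have cg: "continuous_on S g" for S unfolding g_def Complex_eq by (intro continuous_intros)
      have ge: "g (Im e1) = e1" "g (Im e2) = e2" "g (Im w) = w" using gline e1 e2 we c_def by metis+
      have dN: "N \<subseteq> - lift_dom p" using N(3) by auto
      define T where "T = {x. g x \<notin> lift_dom p}"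
      have "closed T"
      proof -
        have "T = g -` (- lift_dom p)" unfolding T_def by auto
        moreover have "continuous_on UNIV g" by (rule cg)
        ultimately show ?thesis using open_lift_dom by (simp add: continuous_on_closed_vimage closed_Compl)
      qed
      define S1 where "S1 = T \<inter> {Im e1..Im w}"
      define S2 where "S2 = T \<inter> {Im w..Im e2}"
      have S: "closed S1" "closed S2" "bdd_above S1" "bdd_below S2" "Im e1 \<in> S1" "Im e2 \<in> S2"
        unfolding S1_def S2_def using \<open>closed T\<close> e1 e2 N_lift_dom ge by (auto simp: T_def)
      define a where "a = Sup S1"
      define b where "b = Inf S2"
      have aS: "a \<in> S1" unfolding a_def by (rule closed_contains_Sup) (use S in auto)
      have bS: "b \<in> S2" unfolding b_def by (rule closed_contains_Inf) (use S in auto)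
      have wT: "Im w \<notin> T" unfolding T_def using ge wOm by simp
      have ab: "a < Im w" "Im w < b" "Im e1 \<le> a" "b \<le> Im e2"
        using aS bS wT unfolding S1_def S2_def by (auto simp: less_le)
      have gap: "g t \<in> lift_dom p" if t: "a < t" "t < b" for t
      proof (rule ccontr)
        assume n: "g t \<notin> lift_dom p"
        show False
        proof (cases "t \<le> Im w")
          case True
          then have "t \<in> S1" unfolding S1_def T_def using n t ab by auto
          then have "t \<le> a" unfolding a_def using S(3) by (rule cSup_upper)
          then show False using t by simp
        next
          case False
          then have "t \<in> S2" unfolding S2_def T_def using n t ab by auto
          then have "b \<le> t" unfolding b_def using S(4) by (rule cInf_lower)
          then show False using t by simp
        qed
      qed
      have seg: "g t \<in> closed_segment (g x) (g y)" if "x \<le> t" "t \<le> y" for t x y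
      proof (cases "x = y")
        case True then show ?thesis using that by simp
      next
        case False
        define u where "u = (t - x) / (y - x)"
        have u: "0 \<le> u" "u \<le> 1" "u * (y - x) = t - x" using False that unfolding u_def by auto
        have "t = (1 - u) * x + u * y" using u(3) by (simp add: algebra_simps)
        then have "g t = (1 - u) *\<^sub>R g x + u *\<^sub>R g y" unfolding g_def
          by (simp add: complex_eq_iff) (simp add: algebra_simps)
        then show ?thesis using u unfolding in_segment by blast
      qed
      have gb: "g t \<in> left_strip b0 b1 d" "g t \<in> ball e0 r0" if "Im e1 \<le> t" "t \<le> Im e2" for t
      proof -
        have s: "g t \<in> closed_segment e1 e2" using seg[OF that] ge by simp
        then show "g t \<in> left_strip b0 b1 d"
          using closed_segment_subset[OF N_box[OF e1(1)] N_box[OF e2(1)] left_strip_convex] by auto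
        have "e1 \<in> ball e0 r0" "e2 \<in> ball e0 r0"
          using d1(2)[of \<eta> e1] d1(2)[of \<eta> e2] ed \<delta>(3) e1 e2 by (auto simp: dist_commute)
        then show "g t \<in> ball e0 r0" using closed_segment_subset[of e1 "ball e0 r0" e2] s convex_ball by blast
      qed
      have gN: "g a \<in> N" "g b \<in> N"
      proof -
        have "g a \<notin> lift_dom p" "g b \<notin> lift_dom p" using aS bS unfolding S1_def S2_def T_def by auto
        then show "g a \<in> N" "g b \<in> N" using gb(1)[of a] gb(1)[of b] ab og c_def
          by (auto intro!: mem[OF ej])
      qed
      have Lg: "L \<le> \<epsilon> * Im (branch p (g t))" if t: "a < t" "t < b" for t
      proof -
        have gt: "g t \<in> left_strip b0 b1 d" "g t \<in> ball e0 r0" using gb[of t] t ab by auto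
        obtain vn where vn: "\<And>n::nat. vn n \<in> K \<eta>" "vn \<longlonglongrightarrow> g t" "(\<lambda>n. branch p (vn n)) \<longlonglongrightarrow> branch p (g t)"
          using closed_box_approx[OF ej gt(1) _ gap[OF t]] og c_def by force
        have "eventually (\<lambda>n. vn n \<in> ball e0 r0) sequentially"
          using topological_tendstoD[OF vn(2) open_ball gt(2)] .
        then have ev: "eventually (\<lambda>n. L \<le> \<epsilon> * Im (branch p (vn n))) sequentially"
          by eventually_elim (use r0(3)[OF _ vn(1)] ed \<delta>(2) in \<open>auto simp: dist_commute\<close>)
        have "(\<lambda>n. \<epsilon> * Im (branch p (vn n))) \<longlonglongrightarrow> \<epsilon> * Im (branch p (g t))" by (intro tendsto_intros vn(3))
        then show ?thesis by (rule tendsto_lowerbound[OF _ ev]) simp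
      qed
      show False
        by (rule no_gap[OF ej Fp, folded c_def, folded g_def, of a b \<epsilon> L])
           (use ab gap gN eps Lg in \<open>auto simp: L_def\<close>)
    qed
    then show "q \<in> D" using UZ[of w] wOm(2) qZ by auto
    qed
    then have "Z \<inter> D = Z \<inter> closure (Z \<inter> D)" using closure_subset by blast
    then show ?thesis by (metis closed_closure closedin_closed_Int)
  qed
  have "Z \<inter> D \<noteq> {}"
  proof -
    obtain r \<delta>' where r: "r > 0" "\<delta>' > 0" "\<And>\<eta> w. \<bar>\<eta> - \<eta>0\<bar> < \<delta>' \<Longrightarrow> w \<in> K \<eta> \<Longrightarrow> dist w e0 < r \<Longrightarrow> \<epsilon> * Im (branch p w) \<ge> Y"
      using sgn[of Y] by blast
    obtain wn where wn: "\<And>n::nat. wn n \<in> K \<eta>0" "wn \<longlonglongrightarrow> e0"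
      using slant_box_approach[OF hr[OF \<eta>0] N_box[OF e0(1)]] e0(2) by (metis order_refl)
    obtain n where "dist (wn n) e0 < r" using tendstoD[OF wn(2) r(1)] eventually_happens'[OF sequentially_bot] by blast
    with r(2) wn(1) have "\<epsilon> * Im (branch p (wn n)) \<ge> Y" by (intro r(3)[of \<eta>0 "wn n"]) auto
    moreover have "\<bar>slant \<eta>0 (branch p (wn n))\<bar> \<le> A'" using bd[OF \<eta>0 wn(1)] unfolding A'_def by (meson max.coboundedI2)
    ultimately have "branch p (wn n) \<in> Z" unfolding Z_def by auto
    moreover have "wn n \<in> U" unfolding U_def using wn(1) \<eta>0 by (intro UN_I[of \<eta>0]) auto
    ultimately show ?thesis using UZ by auto
  qed
  then have "Z \<inter> D = Z" using conZ op cl unfolding connected_clopen by blast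
  then have "q \<in> branch p ` U" if "\<bar>slant \<eta>0 q\<bar> \<le> A" "Y \<le> \<epsilon> * Im q" for q
    using that unfolding Z_def D_def A'_def by auto
  then show ?thesis unfolding U_def by blast
qed

end

section \<open>Orientation of a map of a half strip\<close>

lemma winding_number_exp_lift:
  assumes "path h" "\<And>t. t \<in> {0..1} \<Longrightarrow> \<gamma> t - a = exp (h t)"
  shows "winding_number \<gamma> a = (pathfinish h - pathstart h) / (2 * of_real pi * \<i>)"
proof -
  have "winding_number \<gamma> a = winding_number (\<lambda>t. \<gamma> t - a) 0" by (rule winding_number_offset)
  also have "\<dots> = winding_number (exp \<circ> h) 0" by (rule winding_number_cong) (use assms(2) in auto)
  also have "\<dots> = (pathfinish h - pathstart h) / (2 * of_real pi * \<i>)" by (rule winding_number_compose_exp[OF assms(1)])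
  finally show ?thesis .
qed

text \<open>A factor that has a continuous logarithm along the loop does not change the winding number, and
  conjugation changes its sign.\<close>

lemma winding_number_rect_lift:
  assumes q: "q \<in> box a1 a3" and u: "continuous_on (path_image (rectpath a1 a3)) u"
    and f: "\<And>z. z \<in> path_image (rectpath a1 a3) \<Longrightarrow> f z - c = (z - q) * exp (u z)"
  shows "winding_number (f \<circ> rectpath a1 a3) c = 1"
    "\<And>k. (\<And>z. z \<in> path_image (rectpath a1 a3) \<Longrightarrow> f' z - c = k * cnj (z - q) * exp (u' z)) \<Longrightarrow> k \<noteq> 0 \<Longrightarrow>
      continuous_on (path_image (rectpath a1 a3)) u' \<Longrightarrow> winding_number (f' \<circ> rectpath a1 a3) c = - 1"
proof -
  let ?R = "rectpath a1 a3"
  have nq: "q \<notin> path_image ?R"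
  proof -
    have "Re a1 \<le> Re a3" "Im a1 \<le> Im a3" using q by (auto simp: in_box_complex_iff)
    then show ?thesis using q path_image_rectpath_cbox_minus_box[of a1 a3] by auto
  qed
  obtain h where h: "path h" "pathfinish h - pathstart h = 2 * of_real pi * \<i> * winding_number ?R q"
    "\<And>t. t \<in> {0..1} \<Longrightarrow> ?R t = q + exp (h t)"
    using winding_number_as_continuous_log[OF path_rectpath nq] by metis
  have h1: "h 1 - h 0 = 2 * of_real pi * \<i>" using h(2) winding_number_rectpath[OF q] by (simp add: pathfinish_def pathstart_def)
  have R: "?R t \<in> path_image ?R" if "t \<in> {0..1}" for t using that by (auto simp: path_image_def)
  have R01: "?R 1 = ?R 0" using pathfinish_rectpath[of a1 a3] pathstart_rectpath[of a1 a3] by (simp add: pathfinish_def pathstart_def)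
  have pu: "path (\<lambda>t. v (?R t))" if "continuous_on (path_image ?R) v" for v :: "complex \<Rightarrow> complex"
    using path_continuous_image[OF path_rectpath that] by (simp add: o_def)
  have "winding_number (f \<circ> ?R) c = (pathfinish (\<lambda>t. h t + u (?R t)) - pathstart (\<lambda>t. h t + u (?R t))) / (2 * of_real pi * \<i>)"
  proof (rule winding_number_exp_lift)
    show "path (\<lambda>t. h t + u (?R t))" using h(1) pu[OF u] unfolding path_def by (intro continuous_intros)
    show "(f \<circ> ?R) t - c = exp (h t + u (?R t))" if "t \<in> {0..1}" for t
      using f[OF R[OF that]] h(3)[OF that] by (simp add: exp_add)
  qed
  then show "winding_number (f \<circ> ?R) c = 1" using h1 R01 by (simp add: pathfinish_def pathstart_def)
  fix k assume f': "\<And>z. z \<in> path_image ?R \<Longrightarrow> f' z - c = k * cnj (z - q) * exp (u' z)" and k: "k \<noteq> 0"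
    and u': "continuous_on (path_image ?R) u'"
  define l where "l t = Ln k + cnj (h t) + u' (?R t)" for t
  have "winding_number (f' \<circ> ?R) c = (pathfinish l - pathstart l) / (2 * of_real pi * \<i>)"
  proof (rule winding_number_exp_lift)
    show "path l" using h(1) pu[OF u'] unfolding path_def l_def by (intro continuous_intros)
    show "(f' \<circ> ?R) t - c = exp (l t)" if "t \<in> {0..1}" for t
      using f'[OF R[OF that]] h(3)[OF that] k by (simp add: exp_add l_def exp_cnj)
  qed
  moreover have "l 1 - l 0 = cnj (h 1 - h 0)" unfolding l_def using R01 by simp
  ultimately show "winding_number (f' \<circ> ?R) c = - 1" unfolding h1 by (simp add: pathfinish_def pathstart_def)
qed

text \<open>The difference quotient \<open>h z = (f z - f q) / (z - q)\<close> stays near \<open>q\<close> in a disc about \<open>\<alpha>\<close> that does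
  not contain zero, but need not have a limit at \<open>q\<close>. Interpolating between \<open>h\<close> and \<open>\<alpha>\<close> on a small disc
  about \<open>q\<close> gives a continuous function without zeros on the rectangle, which therefore has a
  logarithm. So \<open>f z - f q\<close> winds around zero like \<open>z - q\<close>.\<close>

lemma orientation_preserving_winding:
  fixes f :: "complex \<Rightarrow> complex"
  assumes f: "continuous_on (cbox a1 a3) f" "inj_on f (cbox a1 a3)" and q: "q \<in> box a1 a3"
    and d: "(f has_derivative (\<lambda>k. \<alpha> * k + \<beta> * cnj k)) (at q)" "cmod \<beta> < cmod \<alpha>"
  shows "winding_number (f \<circ> rectpath a1 a3) (f q) = 1"
proof -
  let ?B = "cbox a1 a3"
  define s where "s = (cmod \<alpha> - cmod \<beta>) / 2"
  have s: "s > 0" unfolding s_def using d(2) by simp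
  obtain \<delta>1 where d1: "\<delta>1 > 0" "\<And>z. cmod (z - q) < \<delta>1 \<Longrightarrow>
     cmod (f z - f q - (\<alpha> * (z - q) + \<beta> * cnj (z - q))) \<le> s * cmod (z - q)"
    using d(1) s unfolding has_derivative_at_alt by meson
  obtain \<delta>2 where d2: "\<delta>2 > 0" "ball q \<delta>2 \<subseteq> box a1 a3" using q open_box open_contains_ball by metis
  define \<delta> where "\<delta> = min \<delta>1 \<delta>2"
  have \<delta>: "\<delta> > 0" "\<delta> \<le> \<delta>1" "\<delta> \<le> \<delta>2" unfolding \<delta>_def using d1 d2 by auto
  define h where "h z = (f z - f q) / (z - q)" for z
  define t where "t z = min 1 (cmod (z - q) / \<delta>)" for z
  define g where "g z = \<alpha> + of_real (t z) * (h z - \<alpha>)" for z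
  have hb: "cmod (h z - \<alpha>) < cmod \<alpha>" if z: "z \<noteq> q" "cmod (z - q) < \<delta>" for z
  proof -
    have "h z - \<alpha> = ((f z - f q - (\<alpha> * (z - q) + \<beta> * cnj (z - q))) + \<beta> * cnj (z - q)) / (z - q)"
      unfolding h_def using z(1) by (simp add: field_simps)
    then have "cmod (h z - \<alpha>) = cmod ((f z - f q - (\<alpha> * (z - q) + \<beta> * cnj (z - q))) + \<beta> * cnj (z - q)) / cmod (z - q)"
      by (simp add: norm_divide)
    also have "\<dots> \<le> (s * cmod (z - q) + cmod \<beta> * cmod (z - q)) / cmod (z - q)"
    proof (rule divide_right_mono)
      have "cmod (\<beta> * cnj (z - q)) = cmod \<beta> * cmod (z - q)" by (simp add: norm_mult del: complex_cnj_diff)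
      then show "cmod ((f z - f q - (\<alpha> * (z - q) + \<beta> * cnj (z - q))) + \<beta> * cnj (z - q)) \<le> s * cmod (z - q) + cmod \<beta> * cmod (z - q)"
        using norm_triangle_mono[OF d1(2)[of z] order_refl, of "\<beta> * cnj (z - q)"] z \<delta> by simp
    qed simp
    also have "\<dots> = s + cmod \<beta>" using z(1) by (simp add: field_simps)
    also have "\<dots> < cmod \<alpha>" unfolding s_def using d(2) by (simp add: field_simps)
    finally show ?thesis .
  qed
  have t01: "0 \<le> t z" "t z \<le> 1" for z unfolding t_def using \<delta> by auto
  have gnz: "g z \<noteq> 0" if z: "z \<in> ?B" for z
  proof (cases "z = q")
    case True then show ?thesis unfolding g_def t_def using d(2) by auto
  next
    case False
    show ?thesis
    proof (cases "cmod (z - q) < \<delta>")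
      case True
      have "cmod (of_real (t z) * (h z - \<alpha>)) \<le> 1 * cmod (h z - \<alpha>)"
        unfolding norm_mult using t01[of z] by (intro mult_right_mono) auto
      also have "\<dots> < cmod \<alpha>" using hb[OF False True] by simp
      finally show ?thesis unfolding g_def by (metis add.inverse_inverse add_eq_0_iff less_irrefl norm_minus_cancel)
    next
      case F2: False
      then have "t z = 1" unfolding t_def using \<delta>(1) by auto
      moreover have "f z \<noteq> f q" using f(2) z q False box_subset_cbox by (metis inj_onD subsetD)
      ultimately show ?thesis unfolding g_def h_def using False by simp
    qed
  qed
  have gc: "continuous_on ?B g"
    unfolding continuous_on_eq_continuous_within
  proof
    fix z assume z: "z \<in> ?B"
    show "continuous (at z within ?B) g"
    proof (cases "z = q")
      case False
      have "continuous (at z within ?B) f" using f(1) z unfolding continuous_on_eq_continuous_within by auto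
      moreover have "continuous (at z within ?B) t" unfolding t_def using \<delta>(1)
        by (intro continuous_min continuous_intros) auto
      ultimately show ?thesis unfolding g_def h_def using False by (intro continuous_intros) auto
    next
      case True
      have "(g \<longlongrightarrow> \<alpha>) (at q)"
      proof (rule LIM_zero_cancel, rule Lim_null_comparison)
        show "((\<lambda>z. (cmod (z - q) / \<delta>) * cmod \<alpha>) \<longlongrightarrow> 0) (at q)"
          using \<delta>(1) by (auto intro!: tendsto_eq_intros)
        show "\<forall>\<^sub>F z in at q. norm (g z - \<alpha>) \<le> (cmod (z - q) / \<delta>) * cmod \<alpha>"
          unfolding eventually_at
        proof (intro exI[of _ \<delta>] conjI ballI impI)
          fix z assume z: "z \<noteq> q \<and> dist z q < \<delta>"
          have "norm (g z - \<alpha>) = t z * cmod (h z - \<alpha>)" unfolding g_def using t01[of z] by (simp add: norm_mult)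
          also have "\<dots> \<le> (cmod (z - q) / \<delta>) * cmod \<alpha>"
            using hb[of z] z \<delta>(1) by (intro mult_mono) (auto simp: t_def dist_norm)
          finally show "norm (g z - \<alpha>) \<le> (cmod (z - q) / \<delta>) * cmod \<alpha>" .
        qed (use \<delta> in auto)
      qed
      moreover have "g q = \<alpha>" unfolding g_def t_def by simp
      ultimately have "isCont g q" by (simp add: isCont_def)
      then show ?thesis using True continuous_at_imp_continuous_within by blast
    qed
  qed
  obtain u where u: "continuous_on ?B u" "\<And>z. z \<in> ?B \<Longrightarrow> g z = exp (u z)"
    using continuous_logarithm_on_contractible[OF gc convex_imp_contractible[OF convex_box(1)] gnz] by metis
  have sides: "Re a1 \<le> Re a3" "Im a1 \<le> Im a3" using q by (auto simp: in_box_complex_iff)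
  have PB: "path_image (rectpath a1 a3) = ?B - box a1 a3" by (rule path_image_rectpath_cbox_minus_box[OF sides])
  show ?thesis
  proof (rule winding_number_rect_lift(1)[OF q])
    show "continuous_on (path_image (rectpath a1 a3)) u" by (rule continuous_on_subset[OF u(1)]) (auto simp: PB)
    fix z assume z: "z \<in> path_image (rectpath a1 a3)"
    then have zB: "z \<in> ?B" "z \<notin> box a1 a3" unfolding PB by auto
    then have "z \<notin> ball q \<delta>" using d2(2) subset_ball[OF \<delta>(3), of q] by blast
    then have "cmod (z - q) \<ge> \<delta>" by (simp add: dist_norm norm_minus_commute)
    then have "t z = 1" unfolding t_def using \<delta>(1) by auto
    moreover have "z \<noteq> q" using zB q by auto
    ultimately show "f z - f q = (z - q) * exp (u z)" unfolding u(2)[OF zB(1), symmetric] g_def h_def by simp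
  qed
qed

lemma Ln_diff_minus:
  assumes "Im z > 0 \<and> Im w > 0 \<or> Im z < 0 \<and> Im w < 0"
  shows "Ln (- z) - Ln (- w) = Ln z - Ln w"
proof -
  have "z \<noteq> 0" "w \<noteq> 0" using assms by auto
  then show ?thesis using assms by (auto simp: Ln_minus)
qed

text \<open>For a small positive \<open>c\<close> the boundary of a high rectangle is mapped to a loop that winds around \<open>c\<close> once
  clockwise: the left edge goes to the upper half plane, the right edge to the lower one, the top
  to the left of \<open>c\<close>, and the bottom edge crosses the real axis only to the right of \<open>c\<close>. The loop is
  compared with \<open>\<psi> z = - \<i> * cnj (z - z0)\<close>, which has the same properties. By injectivity the
  winding number is the same about all values taken inside the rectangle, so an orientation preserving
  derivative at \<open>q\<close>, which would give winding number \<open>1\<close>, is impossible.\<close>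

lemma half_strip_orientation:
  fixes f :: "complex \<Rightarrow> complex"
  assumes A: "A > 0" and S: "S = {z. \<bar>Re z\<bar> \<le> A \<and> Y \<le> Im z}"
    and f: "continuous_on S f" "inj_on f S"
    and l: "\<And>z. z \<in> S \<Longrightarrow> Re z = - A \<Longrightarrow> Im (f z) > 0"
    and r: "\<And>z. z \<in> S \<Longrightarrow> Re z = A \<Longrightarrow> Im (f z) < 0"
    and b: "\<And>z. z \<in> S \<Longrightarrow> Im (f z) = 0 \<Longrightarrow> Re (f z) > 0"
    and t: "\<And>e. e > 0 \<Longrightarrow> \<exists>y. \<forall>z\<in>S. y \<le> Im z \<longrightarrow> cmod (f z) < e"
    and q: "\<bar>Re q\<bar> < A" "Y < Im q"
    and d: "(f has_derivative (\<lambda>k. \<alpha> * k + \<beta> * cnj k)) (at q)"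
  shows "cmod \<alpha> \<le> cmod \<beta>"
proof (rule ccontr)
  assume "\<not> ?thesis"
  then have ab: "cmod \<beta> < cmod \<alpha>" by simp
  define bot where "bot = cbox (Complex (- A) Y) (Complex A Y)"
  have botS: "bot \<subseteq> S" unfolding bot_def S in_cbox_complex_iff subset_iff by auto
  obtain c where c: "c > 0" "\<And>z. z \<in> bot \<Longrightarrow> Im (f z) = 0 \<Longrightarrow> c < Re (f z)"
  proof -
    define E where "E = bot \<inter> (bot \<inter> (\<lambda>z. Im (f z)) -` {0})"
    have cb: "continuous_on bot f" by (rule continuous_on_subset[OF f(1) botS])
    have "closed (bot \<inter> (\<lambda>z. Im (f z)) -` {0})"
      by (rule continuous_closed_preimage) (use cb in \<open>auto intro!: continuous_intros simp: bot_def closed_cbox\<close>)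
    then have cE: "compact E" unfolding E_def by (intro compact_Int_closed) (auto simp: bot_def compact_cbox)
    show ?thesis
    proof (cases "E = {}")
      case True then show ?thesis using that[of 1] unfolding E_def by auto
    next
      case False
      have "continuous_on E (\<lambda>z. Re (f z))"
        by (intro continuous_intros continuous_on_subset[OF cb]) (auto simp: E_def)
      then obtain x where x: "x \<in> E" "\<forall>y\<in>E. Re (f x) \<le> Re (f y)"
        using continuous_attains_inf[OF cE False] by blast
      have "Re (f x) > 0" using b[of x] x(1) botS unfolding E_def by auto
      then show ?thesis using that[of "Re (f x) / 2"] x(2) unfolding E_def by force
    qed
  qed
  obtain y0 where y0: "\<And>z. z \<in> S \<Longrightarrow> y0 \<le> Im z \<Longrightarrow> cmod (f z) < c" using t[OF c(1)] by blast
  define y where "y = max y0 (Im q + 1)"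
  have y: "y > Im q" "y > Y" "\<And>z. z \<in> S \<Longrightarrow> y \<le> Im z \<Longrightarrow> cmod (f z) < c" using y0 q unfolding y_def by auto
  define a1 where "a1 = Complex (- A) Y"
  define a3 where "a3 = Complex A y"
  define B where "B = cbox a1 a3"
  have BS: "B \<subseteq> S" unfolding B_def a1_def a3_def S in_cbox_complex_iff subset_iff by auto
  have qB: "q \<in> box a1 a3" unfolding a1_def a3_def in_box_complex_iff using q y by auto
  have cB: "continuous_on B f" "inj_on f B" using f BS continuous_on_subset inj_on_subset by blast+
  have sides: "Re a1 \<le> Re a3" "Im a1 \<le> Im a3" unfolding a1_def a3_def using A y by auto
  let ?R = "rectpath a1 a3"
  define dB where "dB = path_image ?R"
  have PB: "dB = B - box a1 a3" unfolding dB_def B_def by (rule path_image_rectpath_cbox_minus_box[OF sides])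
  have dBS: "dB \<subseteq> S" using PB BS by auto
  have dcB: "continuous_on dB f" using continuous_on_subset[OF f(1) dBS] .
  have wq: "winding_number (f \<circ> ?R) (f q) = 1"
    by (rule orientation_preserving_winding[OF cB[unfolded B_def] qB d ab])
  define z0 where "z0 = Complex 0 ((Y + y) / 2)"
  have z0B: "z0 \<in> box a1 a3" unfolding z0_def a1_def a3_def in_box_complex_iff using A y by auto
  define \<psi> where "\<psi> z = - \<i> * cnj (z - z0)" for z
  have Re\<psi>: "Re (\<psi> z) = (Y + y) / 2 - Im z" and Im\<psi>: "Im (\<psi> z) = - Re z" for z
    unfolding \<psi>_def z0_def by auto
  define top where "top = dB \<inter> {z. Im z = y}"
  define rest where "rest = dB \<inter> {z. Re z = - A \<or> Re z = A \<or> Im z = Y}"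
  have dBeq: "dB = top \<union> rest"
    unfolding top_def rest_def PB B_def a1_def a3_def by (auto simp: in_cbox_complex_iff in_box_complex_iff)
  have "compact dB" unfolding dB_def by (simp add: compact_path_image)
  then have cdB: "closed dB" by (rule compact_imp_closed)
  have cl: "closed top" "closed rest" unfolding top_def rest_def
    by (intro closed_Int cdB closed_Collect_eq closed_Collect_disj continuous_intros)+
  have rest_nr: "f z - c \<notin> \<real>\<^sub>\<le>\<^sub>0" "\<psi> z \<notin> \<real>\<^sub>\<le>\<^sub>0" if z: "z \<in> rest" for z
  proof -
    have zS: "z \<in> S" "z \<in> B" using z PB BS unfolding rest_def by auto
    consider "Re z = - A" | "Re z = A" | "Im z = Y" using z unfolding rest_def by auto
    then have "(Im (f z) \<noteq> 0 \<or> c < Re (f z)) \<and> (Im (\<psi> z) \<noteq> 0 \<or> Re (\<psi> z) > 0)"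
    proof cases
      case 1 then show ?thesis using l[OF zS(1)] A unfolding Im\<psi> by auto
    next
      case 2 then show ?thesis using r[OF zS(1)] A unfolding Im\<psi> by auto
    next
      case 3
      then have "z \<in> bot" using zS(2) unfolding B_def bot_def a1_def a3_def by (auto simp: in_cbox_complex_iff)
      then show ?thesis using c(2)[of z] 3 y unfolding Re\<psi> by auto
    qed
    then show "f z - c \<notin> \<real>\<^sub>\<le>\<^sub>0" "\<psi> z \<notin> \<real>\<^sub>\<le>\<^sub>0" by (auto simp: complex_nonpos_Reals_iff)
  qed
  have top_nr: "- (f z - c) \<notin> \<real>\<^sub>\<le>\<^sub>0" "- \<psi> z \<notin> \<real>\<^sub>\<le>\<^sub>0" if z: "z \<in> top" for z
  proof -
    have zS: "z \<in> S" "Im z = y" using z dBS unfolding top_def by auto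
    have "Re (f z) < c" using y(3)[OF zS(1)] zS(2) abs_Re_le_cmod[of "f z"] by auto
    moreover have "Re (\<psi> z) < 0" unfolding Re\<psi> using zS y by auto
    ultimately show "- (f z - c) \<notin> \<real>\<^sub>\<le>\<^sub>0" "- \<psi> z \<notin> \<real>\<^sub>\<le>\<^sub>0" by (auto simp: complex_nonpos_Reals_iff)
  qed
  define v where "v z = (if z \<in> top then Ln (- (f z - c)) - Ln (- \<psi> z) else Ln (f z - c) - Ln (\<psi> z))" for z
  have vrest: "v z = Ln (f z - c) - Ln (\<psi> z)" if z: "z \<in> rest" for z
  proof (cases "z \<in> top")
    case True
    have zS: "z \<in> S" "Im z = y" using True dBS unfolding top_def by auto
    then have "Re z = - A \<or> Re z = A" using z y unfolding rest_def by auto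
    then have "Im (f z - c) > 0 \<and> Im (\<psi> z) > 0 \<or> Im (f z - c) < 0 \<and> Im (\<psi> z) < 0"
      using l[OF zS(1)] r[OF zS(1)] A unfolding Im\<psi> by auto
    from Ln_diff_minus[OF this] show ?thesis using True unfolding v_def by simp
  qed (simp add: v_def)
  have c\<psi>: "continuous_on X \<psi>" for X unfolding \<psi>_def by (intro continuous_intros)
  have vc: "continuous_on dB v"
    unfolding dBeq
  proof (rule continuous_on_closed_Un[OF cl])
    have ft: "continuous_on top f" "continuous_on rest f" using continuous_on_subset[OF dcB] dBeq by auto
    have "continuous_on top (\<lambda>z. Ln (- (f z - c)) - Ln (- \<psi> z))"
      by (intro continuous_intros ft c\<psi>) (use top_nr in auto)
    then show "continuous_on top v" by (rule continuous_on_eq) (simp add: v_def)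
    have "continuous_on rest (\<lambda>z. Ln (f z - c) - Ln (\<psi> z))"
      by (intro continuous_intros ft c\<psi>) (use rest_nr in auto)
    then show "continuous_on rest v" by (rule continuous_on_eq) (simp add: vrest)
  qed
  have fv: "f z - c = \<psi> z * exp (v z)" if z: "z \<in> dB" for z
  proof (cases "z \<in> top")
    case True
    have "- (f z - c) \<noteq> 0" "- \<psi> z \<noteq> 0" using top_nr[OF True] by auto
    then have "exp (v z) = (- (f z - c)) / (- \<psi> z)" unfolding v_def using True by (simp add: exp_diff)
    then show ?thesis using \<open>- \<psi> z \<noteq> 0\<close> by simp
  next
    case False
    then have zr: "z \<in> rest" using z dBeq by auto
    have "f z - c \<noteq> 0" "\<psi> z \<noteq> 0" using rest_nr[OF zr] by auto
    then have "exp (v z) = (f z - c) / \<psi> z" unfolding vrest[OF zr] by (simp add: exp_diff)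
    then show ?thesis using \<open>\<psi> z \<noteq> 0\<close> by simp
  qed
  have wc: "winding_number (f \<circ> ?R) (of_real c) = - 1"
    by (rule winding_number_rect_lift(2)[OF z0B, of "\<lambda>_. 0" "\<lambda>z. z - z0 + of_real c" "of_real c" f "- \<i>" v])
      (use fv vc in \<open>auto simp: \<psi>_def dB_def\<close>)
  have cnot: "of_real c \<notin> f ` dB"
  proof
    assume "of_real c \<in> f ` dB"
    then obtain z where z: "z \<in> dB" "f z = of_real c" by auto
    then have "\<psi> z = 0" using fv[OF z(1)] by simp
    then show False using z(1) top_nr(2) rest_nr(2) unfolding dBeq by force
  qed
  have pf: "path (f \<circ> ?R)" by (rule path_continuous_image) (use dcB dB_def in auto)
  have lf: "pathfinish (f \<circ> ?R) = pathstart (f \<circ> ?R)" by (simp add: pathfinish_compose pathstart_compose)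
  have "of_real c \<in> f ` box a1 a3"
  proof (rule ccontr)
    assume n: "of_real c \<notin> f ` box a1 a3"
    have nz: "f z - of_real c \<noteq> 0" if "z \<in> B" for z using that n cnot unfolding PB by force
    have fc: "continuous_on B (\<lambda>z. f z - of_real c)" by (intro continuous_intros cB(1))
    have "contractible B" unfolding B_def by (rule convex_imp_contractible[OF convex_box(1)])
    from continuous_logarithm_on_contractible[OF fc this nz]
    obtain u where u: "continuous_on B u" "\<And>z. z \<in> B \<Longrightarrow> f z - of_real c = exp (u z)" by blast
    have "continuous_on dB u" by (rule continuous_on_subset[OF u(1)]) (auto simp: PB)
    then have pu: "path (u \<circ> ?R)" by (intro path_continuous_image) (auto simp: dB_def)
    have "winding_number (f \<circ> ?R) (of_real c) = (pathfinish (u \<circ> ?R) - pathstart (u \<circ> ?R)) / (2 * of_real pi * \<i>)"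
    proof (rule winding_number_exp_lift[OF pu])
      fix s :: real assume "s \<in> {0..1}"
      then have "?R s \<in> dB" unfolding dB_def path_image_def by auto
      then show "(f \<circ> ?R) s - of_real c = exp ((u \<circ> ?R) s)" using u(2) unfolding PB by auto
    qed
    also have "\<dots> = 0" by (simp add: pathfinish_compose pathstart_compose)
    finally show False using wc by simp
  qed
  moreover have "f q \<in> f ` box a1 a3" using qB by auto
  moreover have "connected (f ` box a1 a3)"
    by (intro connected_continuous_image continuous_on_subset[OF cB(1)] convex_connected convex_box(2))
      (auto simp: B_def box_subset_cbox)
  moreover have "f ` box a1 a3 \<inter> path_image (f \<circ> ?R) = {}"
  proof -
    have "f z \<noteq> f w" if "z \<in> box a1 a3" "w \<in> dB" for z w
      using that cB(2) box_subset_cbox[of a1 a3] unfolding PB B_def inj_on_def by blast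
    then show ?thesis unfolding path_image_compose dB_def[symmetric] by auto
  qed
  ultimately have "winding_number (f \<circ> ?R) (of_real c) = winding_number (f \<circ> ?R) (f q)"
    by (intro winding_number_eq[OF pf lf]) auto
  then show False using wc wq by simp
qed

section \<open>Orientation against expansion of area\<close>

definition complex_det :: "(complex \<Rightarrow> complex) \<Rightarrow> real" where
  "complex_det L = Re (L 1) * Im (L \<i>) - Im (L 1) * Re (L \<i>)"

lemma linear_complex_expand:
  assumes "linear L"
  shows "L z = Re z *\<^sub>R L 1 + Im z *\<^sub>R L \<i>"
proof -
  have "L (Re z *\<^sub>R 1 + Im z *\<^sub>R \<i>) = Re z *\<^sub>R L 1 + Im z *\<^sub>R L \<i>"
    by (simp only: linear_add[OF assms] linear_scale[OF assms])
  moreover have "Re z *\<^sub>R 1 + Im z *\<^sub>R \<i> = z" by (simp add: complex_eq_iff)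
  ultimately show ?thesis by simp
qed

lemma complex_det_zero_kernel:
  assumes L: "linear L" and z: "complex_det L = 0"
  shows "\<exists>v. v \<noteq> 0 \<and> L v = 0"
proof -
  let ?a = "Re (L 1)" and ?b = "Im (L 1)" and ?c = "Re (L \<i>)" and ?d = "Im (L \<i>)"
  have eq: "?a * ?d = ?b * ?c" using z unfolding complex_det_def by simp
  have 1: "L (Complex ?c (- ?a)) = 0"
    unfolding linear_complex_expand[OF L, of "Complex ?c (- ?a)"] using eq by (simp add: complex_eq_iff mult.commute)
  have 2: "L (Complex ?d (- ?b)) = 0"
    unfolding linear_complex_expand[OF L, of "Complex ?d (- ?b)"] using eq by (simp add: complex_eq_iff mult.commute)
  show ?thesis
  proof (cases "?a = 0 \<and> ?c = 0 \<and> ?b = 0 \<and> ?d = 0")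
    case True
    then have "L 1 = 0" by (simp add: complex_eq_iff)
    then show ?thesis by (intro exI[of _ 1]) auto
  next
    case False
    then have "Complex ?c (- ?a) \<noteq> 0 \<or> Complex ?d (- ?b) \<noteq> 0" by (auto simp: complex_eq_iff)
    then show ?thesis using 1 2 by blast
  qed
qed

text \<open>With nonpositive determinant the characteristic polynomial has real roots; the determinant is their product.\<close>

lemma negative_det_eigenvalues:
  assumes L: "linear L" and D: "complex_det L \<le> 0" and mu: "\<mu> > 0" "\<And>l. real_eigenvalue L l \<Longrightarrow> \<bar>l\<bar> \<ge> \<mu>"
  shows "\<bar>complex_det L\<bar> \<ge> \<mu>\<^sup>2"
proof -
  define t where "t = Re (L 1) + Im (L \<i>)"
  have eig: "real_eigenvalue L l" if l: "l\<^sup>2 - t * l + complex_det L = 0" for l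
  proof -
    have lin: "linear (\<lambda>z. L z - l *\<^sub>R z)" using L by (intro linear_compose_sub linear_compose_scale_right linear_ident) auto
    have "complex_det (\<lambda>z. L z - l *\<^sub>R z) = l\<^sup>2 - t * l + complex_det L"
      unfolding complex_det_def t_def by (simp add: power2_eq_square algebra_simps)
    then obtain v where "v \<noteq> 0" "L v - l *\<^sub>R v = 0" using complex_det_zero_kernel[OF lin] l by auto
    then show ?thesis unfolding real_eigenvalue_def by auto
  qed
  define s where "s = sqrt (t\<^sup>2 - 4 * complex_det L)"
  have s: "s\<^sup>2 = t\<^sup>2 - 4 * complex_det L" unfolding s_def using D order_trans[of "4 * complex_det L" 0 "t\<^sup>2"] by simp
  have r1: "((t + s) / 2)\<^sup>2 - t * ((t + s) / 2) + complex_det L = 0" using s by (simp add: power2_eq_square field_simps)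
  have r2: "((t - s) / 2)\<^sup>2 - t * ((t - s) / 2) + complex_det L = 0" using s by (simp add: power2_eq_square field_simps)
  have "\<mu> * \<mu> \<le> \<bar>(t + s) / 2\<bar> * \<bar>(t - s) / 2\<bar>"
    using mu(2)[OF eig[OF r1]] mu(2)[OF eig[OF r2]] mu(1) by (intro mult_mono) auto
  also have "\<dots> = \<bar>(t + s) / 2 * ((t - s) / 2)\<bar>" by (simp add: abs_mult)
  also have "(t + s) / 2 * ((t - s) / 2) = complex_det L" using s by (simp add: power2_eq_square field_simps)
  finally show ?thesis by (simp add: power2_eq_square)
qed

text \<open>A real linear map of the complex plane preserves the orientation exactly if its complex linear part dominates its antilinear part.\<close>

lemma linear_complex_conj_form:
  assumes "linear M"
  shows "M k = ((M 1 - \<i> * M \<i>) / 2) * k + ((M 1 + \<i> * M \<i>) / 2) * cnj k"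
    "(cmod ((M 1 - \<i> * M \<i>) / 2))\<^sup>2 - (cmod ((M 1 + \<i> * M \<i>) / 2))\<^sup>2 = complex_det M"
proof -
  show "M k = ((M 1 - \<i> * M \<i>) / 2) * k + ((M 1 + \<i> * M \<i>) / 2) * cnj k"
    by (subst linear_complex_expand[OF assms]) (simp add: complex_eq_iff field_simps)
  show "(cmod ((M 1 - \<i> * M \<i>) / 2))\<^sup>2 - (cmod ((M 1 + \<i> * M \<i>) / 2))\<^sup>2 = complex_det M"
    unfolding cmod_power2 complex_det_def by (simp add: power2_eq_square field_simps)
qed

definition c2v :: "complex \<Rightarrow> real^2" where "c2v z = vector [Re z, Im z]"
definition v2c :: "real^2 \<Rightarrow> complex" where "v2c v = Complex (v $ 1) (v $ 2)"

lemma v2c_c2v [simp]: "v2c (c2v z) = z" by (simp add: v2c_def c2v_def)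
lemma c2v_v2c [simp]: "c2v (v2c v) = v" by (simp add: v2c_def c2v_def vec_eq_iff forall_2)

lemma linear_c2v: "linear c2v"
  by (rule linearI) (auto simp: c2v_def vec_eq_iff forall_2)

lemma linear_v2c: "linear v2c"
  by (rule linearI) (auto simp: v2c_def complex_eq_iff)

lemma bounded_linear_c2v: "bounded_linear c2v" and bounded_linear_v2c: "bounded_linear v2c"
  using linear_c2v linear_v2c by (auto simp: linear_conv_bounded_linear)

lemma norm_c2v [simp]: "norm (c2v z) = cmod z"
  by (simp add: norm_vec_def L2_set_def sum_2 c2v_def cmod_def)

lemma dist_c2v [simp]: "dist (c2v z) (c2v w) = dist z w"
  by (metis dist_norm linear_c2v linear_diff norm_c2v)

lemma det_matrix_c2v:
  assumes "linear L"
  shows "det (matrix (\<lambda>x. c2v (L (v2c x)))) = complex_det L"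
proof -
  have a: "v2c (axis 1 1) = 1" "v2c (axis 2 1) = \<i>" by (auto simp: v2c_def axis_def complex_eq_iff)
  show ?thesis by (simp add: det_2 matrix_def a complex_det_def c2v_def mult.commute)
qed

text \<open>The area of the image is the integral of the absolute Jacobian, also for injective maps that are
  merely differentiable.\<close>

lemma area_expansion:
  fixes F :: "complex \<Rightarrow> complex"
  assumes der: "\<And>q. q \<in> cball z \<rho> \<Longrightarrow> (F has_derivative F' q) (at q)" and inj: "inj_on F (cball z \<rho>)"
    and m: "\<And>q. q \<in> cball z \<rho> \<Longrightarrow> m \<le> \<bar>complex_det (F' q)\<bar>" and sub: "F ` cball z \<rho> \<subseteq> cball e r" and pos: "\<rho> > 0" "r > 0"
  shows "m * \<rho>\<^sup>2 \<le> r\<^sup>2"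
proof -
  define f where "f x = c2v (F (v2c x))" for x
  define f' where "f' x k = c2v (F' (v2c x) (v2c k))" for x k
  define S where "S = cball (c2v z) \<rho>"
  have vS: "v2c x \<in> cball z \<rho>" if "x \<in> S" for x using that unfolding S_def by (metis c2v_v2c dist_c2v mem_cball)
  have derf: "(f has_derivative f' x) (at x within S)" if "x \<in> S" for x
  proof -
    have "(v2c has_derivative v2c) (at x within S)" by (rule bounded_linear_imp_has_derivative[OF bounded_linear_v2c])
    then have "((\<lambda>x. F (v2c x)) has_derivative (\<lambda>k. F' (v2c x) (v2c k))) (at x within S)"
      using der[OF vS[OF that]] by (rule has_derivative_compose)
    then show ?thesis unfolding f_def f'_def by (rule bounded_linear.has_derivative[OF bounded_linear_c2v])
  qed
  have injf: "inj_on f S"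
  proof (rule inj_onI)
    fix x y assume xy: "x \<in> S" "y \<in> S" "f x = f y"
    then have "F (v2c x) = F (v2c y)" unfolding f_def by (metis v2c_c2v)
    then have "v2c x = v2c y" using inj vS xy by (auto dest: inj_onD)
    then show "x = y" by (metis c2v_v2c)
  qed
  have lin: "linear (F' q)" if "q \<in> cball z \<rho>" for q using der[OF that] has_derivative_linear by blast
  have det: "det (matrix (f' x)) = complex_det (F' (v2c x))" if "x \<in> S" for x
    unfolding f'_def using det_matrix_c2v[OF lin[OF vS[OF that]]] .
  have Sm: "S \<in> lmeasurable" "S \<in> sets lebesgue" unfolding S_def by auto
  have "continuous_on S f" unfolding continuous_on_eq_continuous_within using derf has_derivative_continuous by blast
  then have "compact (f ` S)" unfolding S_def by (intro compact_continuous_image) auto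
  then have fm: "f ` S \<in> lmeasurable" by (rule lmeasurable_compact)
  have int: "(\<lambda>x. \<bar>det (matrix (f' x))\<bar>) integrable_on S"
    using measurable_differentiable_image_eq[OF Sm(2) derf injf] fm by blast
  have eq: "measure lebesgue (f ` S) = integral S (\<lambda>x. \<bar>det (matrix (f' x))\<bar>)"
    by (rule measure_differentiable_image_eq[OF Sm(2) derf injf int])
  have "m * measure lebesgue S = integral S (\<lambda>x. m)"
    using lmeasure_integral[OF Sm(1)] Henstock_Kurzweil_Integration.integral_mult_right[of S m "\<lambda>x. 1"] by simp
  also have "\<dots> \<le> integral S (\<lambda>x. \<bar>det (matrix (f' x))\<bar>)"
  proof (rule integral_le[OF _ int])
    show "(\<lambda>x. m) integrable_on S" unfolding S_def by (rule integrable_on_const) auto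
    show "m \<le> \<bar>det (matrix (f' x))\<bar>" if "x \<in> S" for x using det[OF that] m[OF vS[OF that]] by simp
  qed
  also have "\<dots> = measure lebesgue (f ` S)" using eq by simp
  also have "\<dots> \<le> measure lebesgue (cball (c2v e) r)"
  proof (rule measure_mono_fmeasurable)
    show "f ` S \<subseteq> cball (c2v e) r"
    proof
      fix y assume "y \<in> f ` S"
      then obtain x where x: "x \<in> S" "y = f x" by auto
      then have "F (v2c x) \<in> cball e r" using vS sub by blast
      then show "y \<in> cball (c2v e) r" unfolding x(2) f_def by simp
    qed
  qed (use fm in auto)
  finally have le: "m * measure lebesgue S \<le> measure lebesgue (cball (c2v e) r)" .
  have vol: "measure lebesgue (cball (v :: real^2) s) = unit_ball_vol 2 * s\<^sup>2" if "s > 0" for v s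
    using content_cball[of s v] that by simp
  have "m * (unit_ball_vol 2 * \<rho>\<^sup>2) \<le> unit_ball_vol 2 * r\<^sup>2"
    using le unfolding S_def vol[OF pos(1)] vol[OF pos(2)] .
  then have "unit_ball_vol 2 * (m * \<rho>\<^sup>2) \<le> unit_ball_vol 2 * r\<^sup>2" by (simp add: ac_simps)
  moreover have "unit_ball_vol 2 > 0" by simp
  ultimately show ?thesis by (simp only: mult_le_cancel_left_pos)
qed

context fan_tip
begin

context
  fixes \<epsilon> :: real
  assumes Fp: "Im (F p) = b1" and eps: "\<epsilon> = 1 \<or> \<epsilon> = - 1"
    and sgn: "\<And>Y. \<exists>r>0. \<exists>\<delta>>0. \<forall>\<eta> w. \<bar>\<eta> - \<eta>0\<bar> < \<delta> \<longrightarrow> w \<in> K \<eta> \<longrightarrow> dist w e0 < r \<longrightarrow> \<epsilon> * Im (branch p w) \<ge> Y"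
begin

text \<open>This restates \<open>half_strip_covered\<close> in terms of \<open>F\<close>; in particular \<open>F\<close> is injective on the half strip.\<close>

lemma strip_branch:
  obtains Y where "Y > 0" "\<And>q. \<bar>slant \<eta>0 q\<bar> \<le> A \<Longrightarrow> Y \<le> \<epsilon> * Im q \<Longrightarrow>
    \<exists>\<eta>. j0 < \<eta> \<and> \<eta> < j1 \<and> F q \<in> K \<eta> \<and> branch p (F q) = q"
proof -
  obtain Y where Y: "\<And>q. \<bar>slant \<eta>0 q\<bar> \<le> A \<Longrightarrow> Y \<le> \<epsilon> * Im q \<Longrightarrow> q \<in> branch p ` (\<Union>\<eta>\<in>{j0<..<j1}. K \<eta>)"
    using half_strip_covered[OF Fp eps sgn] by blast
  have "\<exists>\<eta>. j0 < \<eta> \<and> \<eta> < j1 \<and> F q \<in> K \<eta> \<and> branch p (F q) = q" if q: "\<bar>slant \<eta>0 q\<bar> \<le> A" "max Y 1 \<le> \<epsilon> * Im q" for q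
  proof -
    obtain \<eta> w where w: "j0 < \<eta>" "\<eta> < j1" "w \<in> K \<eta>" "q = branch p w" using Y[of q] q by auto
    have "F q = w" using w K_lift_dom[OF w(1,2)] by (auto simp: subset_iff)
    then show ?thesis using w by metis
  qed
  then show ?thesis using that[of "max Y 1"] by simp
qed

text \<open>At large height only slopes near \<open>\<eta>0\<close> occur, and \<open>far_near_tip\<close> applies.\<close>

lemma strip_limit:
  assumes r: "r > 0"
  shows "\<exists>Y. \<forall>q. \<bar>slant \<eta>0 q\<bar> \<le> A \<longrightarrow> Y \<le> \<epsilon> * Im q \<longrightarrow> dist (F q) e0 < r"
proof -
  obtain Y0 where Y0: "Y0 > 0" "\<And>q. \<bar>slant \<eta>0 q\<bar> \<le> A \<Longrightarrow> Y0 \<le> \<epsilon> * Im q \<Longrightarrow>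
    \<exists>\<eta>. j0 < \<eta> \<and> \<eta> < j1 \<and> F q \<in> K \<eta> \<and> branch p (F q) = q" using strip_branch[of A] by blast
  obtain R \<delta> where R: "\<delta> > 0" "\<And>\<eta> w. \<bar>\<eta> - \<eta>0\<bar> < \<delta> \<Longrightarrow> w \<in> K \<eta> \<Longrightarrow> cmod (branch p w) > R \<Longrightarrow> dist w e0 < r"
    using far_near_tip[OF r] by blast
  define Y where "Y = Y0 + \<bar>R\<bar> + (\<bar>A\<bar> + \<bar>C\<bar>) / \<delta> + 1"
  have pos: "(\<bar>A\<bar> + \<bar>C\<bar>) / \<delta> \<ge> 0" using R(1) by simp
  have "dist (F q) e0 < r" if q: "\<bar>slant \<eta>0 q\<bar> \<le> A" "Y \<le> \<epsilon> * Im q" for q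
  proof -
    have q0: "Y0 \<le> \<epsilon> * Im q" using q(2) pos unfolding Y_def by linarith
    obtain \<eta> where h: "j0 < \<eta>" "\<eta> < j1" "F q \<in> K \<eta>" "branch p (F q) = q" using Y0(2)[OF q(1) q0] by auto
    have Iq: "\<bar>Im q\<bar> \<ge> Y" using q(2) eps by auto
    have "\<bar>slant \<eta> q\<bar> \<le> C" using bd[OF h(1-3)] h(4) by simp
    then have ac: "\<bar>\<eta> - \<eta>0\<bar> * \<bar>Im q\<bar> \<le> \<bar>A\<bar> + \<bar>C\<bar>"
      using q(1) slant_change[of \<eta> q \<eta>0] unfolding abs_mult[symmetric] by linarith
    have "\<bar>\<eta> - \<eta>0\<bar> < \<delta>"
    proof (rule ccontr)
      assume "\<not> ?thesis"
      then have "\<delta> * Y \<le> \<bar>\<eta> - \<eta>0\<bar> * \<bar>Im q\<bar>" using Iq R(1) Y0(1) pos by (intro mult_mono) (auto simp: Y_def)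
      moreover have "\<delta> * ((\<bar>A\<bar> + \<bar>C\<bar>) / \<delta>) < \<delta> * Y" using R(1) Y0(1) unfolding Y_def by (intro mult_strict_left_mono) auto
      moreover have "\<delta> * ((\<bar>A\<bar> + \<bar>C\<bar>) / \<delta>) = \<bar>A\<bar> + \<bar>C\<bar>" using R(1) by simp
      ultimately show False using ac by linarith
    qed
    moreover have "cmod (branch p (F q)) > R" using Iq abs_Im_le_cmod[of q] Y0(1) pos unfolding h(4) Y_def by linarith
    ultimately show ?thesis using R(2)[of \<eta> "F q"] h(3) by auto
  qed
  then show ?thesis by blast
qed

text \<open>The point \<open>F q\<close> lies to the right of the line with slope \<open>\<eta>\<close> through the tip. If the slant of \<open>q\<close> for \<open>\<eta>0\<close>
  exceeds the bound \<open>C\<close>, then \<open>F q\<close> is not in the box of slope \<open>\<eta>0\<close>, so it lies in the sector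
  between the two lines. The sign of \<open>\<eta> - \<eta>0\<close> decides in which one, and it can be read off
  from the slants of \<open>q\<close>.\<close>

lemma strip_position:
  assumes h: "j0 < \<eta>" "\<eta> < j1" "F q \<in> K \<eta>" "branch p (F q) = q" and Iq: "\<epsilon> * Im q > 0"
  shows "slant \<eta>0 q < - C \<Longrightarrow> \<epsilon> * Im (F q - e0) > 0" "slant \<eta>0 q > C \<Longrightarrow> \<epsilon> * Im (F q - e0) < 0"
    "Im (F q - e0) = 0 \<Longrightarrow> slant \<eta>0 (F q - e0) > 0"
proof -
  have o: "\<bar>slant \<eta> q\<bar> \<le> C" using bd[OF h(1-3)] h(4) by simp
  have pos: "slant \<eta> (F q - e0) > 0"
    using h(3) support_upper[OF N(1) e0(1), of \<eta>] by (auto simp: slant_box_def slant_diff)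
  then show "slant \<eta>0 (F q - e0) > 0" if "Im (F q - e0) = 0" using that slant_change[of \<eta> "F q - e0" \<eta>0] by simp
  have nK: "slant \<eta>0 (F q - e0) \<le> 0" if "C < \<bar>slant \<eta>0 q\<bar>"
  proof (rule ccontr)
    assume "\<not> ?thesis"
    then have "F q \<in> K \<eta>0" using h(3) e0(2) by (auto simp: slant_box_def slant_diff)
    then show False using bd[OF \<eta>0] h(4) that by force
  qed
  have ch: "slant \<eta> q = slant \<eta>0 q + (\<eta> - \<eta>0) * Im q" by (rule slant_change)
  have ch2: "slant \<eta> (F q - e0) = slant \<eta>0 (F q - e0) + (\<eta> - \<eta>0) * Im (F q - e0)" by (rule slant_change)
  show "\<epsilon> * Im (F q - e0) > 0" if a: "slant \<eta>0 q < - C"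
  proof -
    have "(\<eta> - \<eta>0) * Im q > 0" using ch o a by linarith
    moreover have "(\<eta> - \<eta>0) * Im (F q - e0) > 0" using ch2 pos nK a by linarith
    ultimately show ?thesis using Iq eps by (auto simp: zero_less_mult_iff mult_less_0_iff)
  qed
  show "\<epsilon> * Im (F q - e0) < 0" if a: "slant \<eta>0 q > C"
  proof -
    have "(\<eta> - \<eta>0) * Im q < 0" using ch o a by linarith
    moreover have "(\<eta> - \<eta>0) * Im (F q - e0) > 0" using ch2 pos nK a by linarith
    ultimately show ?thesis using Iq eps by (auto simp: zero_less_mult_iff mult_less_0_iff)
  qed
qed

text \<open>In the coordinates \<open>slant \<eta>0\<close> and \<open>\<epsilon> * Im\<close>, used in the source and, centred at the tip, in the target, the
  map satisfies the hypotheses of \<open>half_strip_orientation\<close>. The same change of coordinates on both sides does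
  not affect the determinant.\<close>

lemma strip_orientation:
  assumes A: "A > C" "A > 0"
  shows "\<exists>Y. \<forall>q. \<bar>slant \<eta>0 q\<bar> < A \<longrightarrow> Y < \<epsilon> * Im q \<longrightarrow> complex_det (F' q) \<le> 0"
proof -
  obtain Y where Y: "Y > 0" "\<And>q. \<bar>slant \<eta>0 q\<bar> \<le> A \<Longrightarrow> Y \<le> \<epsilon> * Im q \<Longrightarrow>
    \<exists>\<eta>. j0 < \<eta> \<and> \<eta> < j1 \<and> F q \<in> K \<eta> \<and> branch p (F q) = q" using strip_branch[of A] by blast
  have ee: "\<epsilon> * \<epsilon> = 1" using eps by auto
  define T where "T q = Complex (slant \<eta>0 q) (\<epsilon> * Im q)" for q
  define \<tau> where "\<tau> z = Complex (Re z - \<eta>0 * (\<epsilon> * Im z)) (\<epsilon> * Im z)" for z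
  have \<tau>: "slant \<eta>0 (\<tau> z) = Re z" "\<epsilon> * Im (\<tau> z) = Im z" for z
    using ee by (auto simp: \<tau>_def slant_def simp flip: mult.assoc)
  have lT: "linear T" by (rule linearI) (auto simp: T_def slant_def complex_eq_iff algebra_simps)
  have l\<tau>: "linear \<tau>" by (rule linearI) (auto simp: \<tau>_def complex_eq_iff algebra_simps)
  have bT: "bounded_linear T" and b\<tau>: "bounded_linear \<tau>" using lT l\<tau> by (auto simp: linear_conv_bounded_linear)
  have T\<tau>: "\<tau> (T q) = q" for q unfolding T_def \<tau>_def slant_def using ee by (auto simp: complex_eq_iff simp flip: mult.assoc)
  define f where "f z = T (F (\<tau> z) - e0)" for z
  define S where "S = {z. \<bar>Re z\<bar> \<le> A \<and> Y \<le> Im z}"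
  have SZ: "\<exists>\<eta>. j0 < \<eta> \<and> \<eta> < j1 \<and> F (\<tau> z) \<in> K \<eta> \<and> branch p (F (\<tau> z)) = \<tau> z" "\<epsilon> * Im (\<tau> z) > 0" if "z \<in> S" for z
    using Y(2)[of "\<tau> z"] Y(1) that \<tau> unfolding S_def by auto
  have cf: "continuous_on S f"
    unfolding f_def
    by (intro linear_continuous_on_compose[OF _ lT] continuous_intros continuous_on_compose2[OF cont_F]
         linear_continuous_on[OF b\<tau>]) auto
  have inf: "inj_on f S"
  proof (rule inj_onI)
    fix z w assume zw: "z \<in> S" "w \<in> S" "f z = f w"
    then have "F (\<tau> z) = F (\<tau> w)" unfolding f_def by (metis T\<tau> diff_add_cancel)
    then have "\<tau> z = \<tau> w" using SZ(1)[OF zw(1)] SZ(1)[OF zw(2)] by metis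
    then have "Re z = Re w" "Im z = Im w" using \<tau>[of z] \<tau>[of w] by metis+
    then show "z = w" by (rule complex_eqI)
  qed
  have "complex_det (F' q) \<le> 0" if q: "\<bar>slant \<eta>0 q\<bar> < A" "Y < \<epsilon> * Im q" for q
  proof -
    define L where "L = F' q"
    have lL: "linear L" unfolding L_def using der[of q] has_derivative_linear by blast
    define M where "M k = T (L (\<tau> k))" for k
    have lM: "linear M" unfolding M_def using linear_compose[OF linear_compose[OF l\<tau> lL] lT] by (simp add: o_def)
    have dM: "(f has_derivative M) (at (T q))"
    proof -
      have "(\<tau> has_derivative \<tau>) (at (T q))" by (rule bounded_linear_imp_has_derivative[OF b\<tau>])
      moreover have "(F has_derivative L) (at (\<tau> (T q)))" unfolding T\<tau> L_def by (rule der)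
      ultimately have "((\<lambda>z. F (\<tau> z)) has_derivative (\<lambda>k. L (\<tau> k))) (at (T q))" by (rule has_derivative_compose)
      then have "((\<lambda>z. F (\<tau> z) - e0) has_derivative (\<lambda>k. L (\<tau> k))) (at (T q))"
        by (auto intro!: derivative_eq_intros)
      then show ?thesis unfolding f_def M_def by (rule bounded_linear.has_derivative[OF bT])
    qed
    have "cmod ((M 1 - \<i> * M \<i>) / 2) \<le> cmod ((M 1 + \<i> * M \<i>) / 2)"
    proof (rule half_strip_orientation[OF A(2) S_def cf inf])
      show "\<bar>Re (T q)\<bar> < A" "Y < Im (T q)" using q unfolding T_def by auto
      show "(f has_derivative (\<lambda>k. (M 1 - \<i> * M \<i>) / 2 * k + (M 1 + \<i> * M \<i>) / 2 * cnj k)) (at (T q))"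
        using dM linear_complex_conj_form(1)[OF lM] by (metis (no_types, lifting) ext)
      fix z assume z: "z \<in> S"
      obtain \<eta> where h: "j0 < \<eta>" "\<eta> < j1" "F (\<tau> z) \<in> K \<eta>" "branch p (F (\<tau> z)) = \<tau> z" using SZ(1)[OF z] by auto
      note sp = strip_position[OF h SZ(2)[OF z]]
      show "0 < Im (f z)" if "Re z = - A" using sp(1) that A \<tau>(1)[of z] unfolding f_def T_def by simp
      show "Im (f z) < 0" if "Re z = A" using sp(2) that A \<tau>(1)[of z] unfolding f_def T_def by simp
      show "0 < Re (f z)" if "Im (f z) = 0" using sp(3) that eps unfolding f_def T_def by auto
    next
      fix e :: real assume e: "e > 0"
      obtain B where B: "B > 0" "\<And>x. norm (T x) \<le> norm x * B" using bounded_linear.pos_bounded[OF bT] by blast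
      obtain y where y: "\<And>q. \<bar>slant \<eta>0 q\<bar> \<le> A \<Longrightarrow> y \<le> \<epsilon> * Im q \<Longrightarrow> dist (F q) e0 < e / B"
        using strip_limit[of "e / B" A] e B(1) by auto
      have "cmod (f z) < e" if "z \<in> S" "y \<le> Im z" for z
      proof -
        have "dist (F (\<tau> z)) e0 < e / B" by (rule y) (use that \<tau> S_def in auto)
        then have "norm (F (\<tau> z) - e0) * B < e" using B(1) by (simp add: dist_norm field_simps)
        then show ?thesis using B(2)[of "F (\<tau> z) - e0"] unfolding f_def by linarith
      qed
      then show "\<exists>y. \<forall>z\<in>S. y \<le> Im z \<longrightarrow> cmod (f z) < e" by blast
    qed
    then have "(cmod ((M 1 - \<i> * M \<i>) / 2))\<^sup>2 \<le> (cmod ((M 1 + \<i> * M \<i>) / 2))\<^sup>2" by (intro power_mono) auto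
    then have "complex_det M \<le> 0" using linear_complex_conj_form(2)[OF lM] by linarith
    moreover have "complex_det M = complex_det L"
    proof -
      have t1: "\<tau> 1 = 1" by (simp add: \<tau>_def complex_eq_iff)
      have "\<tau> \<i> = Complex (- (\<eta>0 * \<epsilon>)) \<epsilon>" by (simp add: \<tau>_def complex_eq_iff)
      then have "L (\<tau> \<i>) = (- (\<eta>0 * \<epsilon>)) *\<^sub>R L 1 + \<epsilon> *\<^sub>R L \<i>"
        using linear_complex_expand[OF lL, of "\<tau> \<i>"] by simp
      then have re: "Re (L (\<tau> \<i>)) = \<epsilon> * Re (L \<i>) - \<eta>0 * \<epsilon> * Re (L 1)"
        and im: "Im (L (\<tau> \<i>)) = \<epsilon> * Im (L \<i>) - \<eta>0 * \<epsilon> * Im (L 1)" by simp_all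
      have "complex_det M = (\<epsilon> * \<epsilon>) * complex_det L"
        unfolding complex_det_def M_def t1 T_def slant_def complex.sel re im by (simp add: algebra_simps)
      then show ?thesis using ee by simp
    qed
    ultimately show ?thesis unfolding L_def by simp
  qed
  then show ?thesis by blast
qed

text \<open>The discs of radius \<open>\<rho>\<close> about points of slant \<open>- 3 * a / 2\<close> lie in the substrip of slants between \<open>- 2 * a\<close> and
  \<open>- a\<close>. There the \<open>W\<close>-condition, applied in the direction \<open>u\<close> of decreasing slant, bounds the eigenvalues
  from below by \<open>\<mu>\<close>, independently of the height.\<close>

lemma tip_contradiction: False
proof -
  define n where "n = sqrt (1 + \<eta>0\<^sup>2)"
  have n: "n \<ge> 1" unfolding n_def by simp
  define u where "u = complex_of_real (- 1 / n) * Complex 1 \<eta>0"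
  have "cmod (Complex 1 \<eta>0) = n" unfolding n_def cmod_def by simp
  then have "cmod u = \<bar>- 1 / n\<bar> * n" unfolding u_def norm_mult norm_of_real by (rule arg_cong)
  then have u1: "cmod u = 1" using n by auto
  have ru: "Re (cnj u * z) = - slant \<eta>0 z / n" for z unfolding u_def slant_def using n by (simp add: field_simps)
  obtain c r0 where c: "c > 0" "r0 > 0"
    "\<And>q l. Re (cnj u * q) \<ge> r0 \<Longrightarrow> F q \<in> ball e0 1 \<Longrightarrow> real_eigenvalue (F' q) l \<Longrightarrow> \<bar>l\<bar> \<ge> c / P (Re (cnj u * q))"
    using eigenvalue_bound[OF u1 bounded_ball, of e0 1] by metis
  define a where "a = n * r0 + \<bar>C\<bar> + 1"
  have "n * r0 > 0" using n c(2) by simp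
  then have a: "a > 0" "a > C" "a \<ge> n * r0" unfolding a_def by linarith+
  define \<mu> where "\<mu> = c / P (2 * a / n)"
  have Pp: "P (2 * a / n) > 0" by (rule P_pos) (use a n in auto)
  have \<mu>: "\<mu> > 0" unfolding \<mu>_def using c(1) Pp by simp
  \<comment> \<open>By \<open>slant_abs_le\<close> a disc of this radius has slants within \<open>a / 2\<close> of its centre.\<close>
  define \<rho> where "\<rho> = a / (2 * (1 + \<bar>\<eta>0\<bar>))"
  have \<rho>: "\<rho> > 0" "(1 + \<bar>\<eta>0\<bar>) * \<rho> = a / 2" unfolding \<rho>_def using a(1) by (auto simp: add_pos_nonneg field_simps)
  \<comment> \<open>Wide enough for the edges of the half strip to lie outside the strip of half width \<open>C\<close> and for the discs to lie inside.\<close>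
  define A where "A = 2 * a + 1"
  have A: "A > C" "A > 0" unfolding A_def using a by auto
  define r where "r = min (1 / 2) (\<mu> * \<rho> / 2)"
  have r: "r > 0" "r < 1" "r < \<mu> * \<rho>" unfolding r_def using \<mu> \<rho> by (auto simp: min_def)
  obtain Y1 where Y1: "\<And>q. \<bar>slant \<eta>0 q\<bar> < A \<Longrightarrow> Y1 < \<epsilon> * Im q \<Longrightarrow> complex_det (F' q) \<le> 0"
    using strip_orientation[OF A] by blast
  obtain Y2 where Y2: "\<And>q. \<bar>slant \<eta>0 q\<bar> \<le> A \<Longrightarrow> Y2 \<le> \<epsilon> * Im q \<Longrightarrow> dist (F q) e0 < r"
    using strip_limit[OF r(1), of A] by blast
  obtain Y3 where Y3: "\<And>q. \<bar>slant \<eta>0 q\<bar> \<le> A \<Longrightarrow> Y3 \<le> \<epsilon> * Im q \<Longrightarrow> branch p (F q) = q"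
    using strip_branch[of A] by metis
  define y where "y = \<bar>Y1\<bar> + \<bar>Y2\<bar> + \<bar>Y3\<bar> + \<rho> + 1"
  define z where "z = Complex (- (3 * a / 2) - \<eta>0 * (\<epsilon> * y)) (\<epsilon> * y)"
  have oz: "slant \<eta>0 z = - (3 * a / 2)" "\<epsilon> * Im z = y" unfolding z_def slant_def using eps by auto
  have reg: "- (2 * a) \<le> slant \<eta>0 q" "slant \<eta>0 q \<le> - a" "\<epsilon> * Im q \<ge> y - \<rho>" if q: "q \<in> cball z \<rho>" for q
  proof -
    have d: "cmod (q - z) \<le> \<rho>" using q by (simp add: dist_norm norm_minus_commute)
    have "\<bar>slant \<eta>0 (q - z)\<bar> \<le> (1 + \<bar>\<eta>0\<bar>) * \<rho>"
      using slant_abs_le[of \<eta>0 "q - z"] mult_left_mono[OF d, of "1 + \<bar>\<eta>0\<bar>"] by linarith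
    then show "- (2 * a) \<le> slant \<eta>0 q" "slant \<eta>0 q \<le> - a" using oz(1) unfolding \<rho>(2) slant_diff by linarith+
    have "\<bar>Im (q - z)\<bar> \<le> \<rho>" using abs_Im_le_cmod[of "q - z"] d by linarith
    then have "\<bar>\<epsilon> * Im q - \<epsilon> * Im z\<bar> \<le> \<rho>" using eps by auto
    then show "\<epsilon> * Im q \<ge> y - \<rho>" using oz(2) by linarith
  qed
  have reg2: "\<bar>slant \<eta>0 q\<bar> < A" "Y1 < \<epsilon> * Im q" "Y2 \<le> \<epsilon> * Im q" "Y3 \<le> \<epsilon> * Im q" if q: "q \<in> cball z \<rho>" for q
    using reg[OF q] a(1) unfolding A_def y_def by linarith+
  have near: "dist (F q) e0 < r" if q: "q \<in> cball z \<rho>" for q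
    using Y2[of q] reg2[OF q] by simp
  have "\<mu>\<^sup>2 * \<rho>\<^sup>2 \<le> r\<^sup>2"
  proof (rule area_expansion[where z=z and \<rho>=\<rho> and F=F and F'=F' and e=e0])
    show "(F has_derivative F' q) (at q)" for q by (rule der)
    show "inj_on F (cball z \<rho>)"
      by (rule inj_on_inverseI[where g="branch p"]) (rule Y3[OF less_imp_le[OF reg2(1)] reg2(4)])
    show "F ` cball z \<rho> \<subseteq> cball e0 r" using near by (auto simp: dist_commute less_imp_le)
    fix q assume q: "q \<in> cball z \<rho>"
    show "\<mu>\<^sup>2 \<le> \<bar>complex_det (F' q)\<bar>"
    proof (rule negative_det_eigenvalues[OF _ _ \<mu>])
      show "linear (F' q)" using der[of q] has_derivative_linear by blast
      show "complex_det (F' q) \<le> 0" using Y1 reg2[OF q] by auto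
      fix l assume l: "real_eigenvalue (F' q) l"
      have re: "Re (cnj u * q) \<ge> r0" "Re (cnj u * q) \<le> 2 * a / n"
      proof -
        have "n * r0 \<le> - slant \<eta>0 q" using reg(2)[OF q] a(3) by linarith
        then show "Re (cnj u * q) \<ge> r0" unfolding ru using n by (simp add: field_simps)
        show "Re (cnj u * q) \<le> 2 * a / n" unfolding ru using n reg(1)[OF q] by (intro divide_right_mono) auto
      qed
      have "F q \<in> ball e0 1" using near[OF q] r(2) by (simp add: dist_commute)
      then have "\<bar>l\<bar> \<ge> c / P (Re (cnj u * q))" using c(3) re(1) l by blast
      moreover have "c / P (Re (cnj u * q)) \<ge> \<mu>" unfolding \<mu>_def
        using c(1,2) re P_pos[of "Re (cnj u * q)"] P_mono[of "Re (cnj u * q)" "2 * a / n"]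
        by (intro divide_left_mono mult_pos_pos Pp) auto
      ultimately show "\<mu> \<le> \<bar>l\<bar>" by linarith
    qed
  qed (use \<rho> r in auto)
  then have "(\<mu> * \<rho>)\<^sup>2 \<le> r\<^sup>2" by (simp add: power_mult_distrib)
  then have "\<mu> * \<rho> \<le> r" by (rule power2_le_imp_le) (rule less_imp_le[OF r(1)])
  then show False using r(3) by simp
qed

end

end

context wc_map
begin

theorem no_escape_box:
  assumes h: "escape_box p b0 b1 d \<eta> c" and Fp: "Im (F p) = b1"
  shows False
proof -
  obtain N j0 j1 C where "fan F F' P p b0 b1 d N j0 j1 C" by (rule escape_box_imp_fan[OF h])
  then interpret fan F F' P p b0 b1 d N j0 j1 C .
  have "\<exists>\<eta>0 e0. j0 < \<eta>0 \<and> \<eta>0 < j1 \<and> e0 \<in> N \<and> slant \<eta>0 e0 = support N \<eta>0 \<and> (\<forall>e\<in>N. slant \<eta>0 e = support N \<eta>0 \<longrightarrow> e = e0)"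
    by (rule unique_tip) blast
  then obtain \<eta>0 e0 where t: "j0 < \<eta>0" "\<eta>0 < j1" "e0 \<in> N" "slant \<eta>0 e0 = support N \<eta>0"
    "\<forall>e\<in>N. slant \<eta>0 e = support N \<eta>0 \<longrightarrow> e = e0" by blast
  interpret fan_tip F F' P p b0 b1 d N j0 j1 C \<eta>0 e0
  proof unfold_locales
    show "j0 < \<eta>0" "\<eta>0 < j1" "e0 \<in> N" "slant \<eta>0 e0 = support N \<eta>0" by (rule t)+
    show "\<And>e. e \<in> N \<Longrightarrow> slant \<eta>0 e = support N \<eta>0 \<Longrightarrow> e = e0" using t(5) by blast
  qed
  obtain \<epsilon> where "\<epsilon> = 1 \<or> \<epsilon> = - 1"
    "\<And>Y. \<exists>r>0. \<exists>\<delta>>0. \<forall>\<eta> w. \<bar>\<eta> - \<eta>0\<bar> < \<delta> \<longrightarrow> w \<in> K \<eta> \<longrightarrow> dist w e0 < r \<longrightarrow> \<epsilon> * Im (branch p w) \<ge> Y"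
    using tip_sign by blast
  then show False using tip_contradiction[OF Fp] by blast
qed

end

section \<open>From a failure of injectivity or convexity to an escape box\<close>

lemma rotation_homeomorphism:
  assumes \<rho>: "cmod \<rho> = 1" and h: "homeomorphism U (F ` U) F g"
  shows "homeomorphism ((*) (cnj \<rho>) ` U) ((\<lambda>z. cnj \<rho> * F (\<rho> * z)) ` ((*) (cnj \<rho>) ` U)) (\<lambda>z. cnj \<rho> * F (\<rho> * z)) (\<lambda>w. cnj \<rho> * g (\<rho> * w))"
proof -
  have r: "\<rho> * cnj \<rho> = 1" "cnj \<rho> * \<rho> = 1" using \<rho> complex_norm_square[of \<rho>] by (auto simp: mult.commute)
  have r': "\<rho> * (cnj \<rho> * z) = z" "cnj \<rho> * (\<rho> * z) = z" for z using r by (auto simp flip: mult.assoc)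
  have im: "(\<lambda>z. cnj \<rho> * F (\<rho> * z)) ` ((*) (cnj \<rho>) ` U) = (*) (cnj \<rho>) ` (F ` U)"
    by (auto simp: image_image r')
  have cF: "continuous_on U F" "continuous_on (F ` U) g" "\<And>x. x \<in> U \<Longrightarrow> g (F x) = x"
    using h unfolding homeomorphism_def by auto
  show ?thesis unfolding im
  proof (rule homeomorphismI)
    show "continuous_on ((*) (cnj \<rho>) ` U) (\<lambda>z. cnj \<rho> * F (\<rho> * z))"
      by (intro continuous_intros continuous_on_compose2[OF cF(1)]) (auto simp: r')
    show "continuous_on ((*) (cnj \<rho>) ` F ` U) (\<lambda>w. cnj \<rho> * g (\<rho> * w))"
      by (intro continuous_intros continuous_on_compose2[OF cF(2)]) (auto simp: r')
  qed (use cF(3) in \<open>auto simp: r'\<close>)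
qed

lemma (in wc_map) wc_map_rotate:
  assumes \<rho>: "cmod \<rho> = 1"
  shows "wc_map (\<lambda>z. cnj \<rho> * F (\<rho> * z)) (\<lambda>z k. cnj \<rho> * F' (\<rho> * z) (\<rho> * k)) P"
proof -
  have r: "\<rho> * cnj \<rho> = 1" "cnj \<rho> * \<rho> = 1" using \<rho> complex_norm_square[of \<rho>] by (auto simp: mult.commute)
  have r': "\<rho> * (cnj \<rho> * z) = z" "cnj \<rho> * (\<rho> * z) = z" for z using r by (auto simp flip: mult.assoc)
  have r0: "\<rho> \<noteq> 0" using \<rho> by auto
  have opn: "open ((*) (cnj \<rho>) ` U)" if "open U" for U
  proof -
    have "(*) (cnj \<rho>) ` U = (*) \<rho> -` U"
    proof (intro set_eqI iffI)
      fix z assume "z \<in> (*) \<rho> -` U"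
      then show "z \<in> (*) (cnj \<rho>) ` U" by (intro image_eqI[of _ _ "\<rho> * z"]) (auto simp: r')
    qed (auto simp: r')
    moreover have "continuous_on UNIV ((*) \<rho>)" by (intro continuous_intros)
    ultimately show ?thesis using that by (simp add: open_vimage)
  qed
  show ?thesis
  proof (unfold_locales)
    show "continuous_on UNIV (\<lambda>z. cnj \<rho> * F (\<rho> * z))"
      by (intro continuous_intros continuous_on_compose2[OF cont_F]) auto
    fix p
    obtain U g where U: "open U" "\<rho> * p \<in> U" "open (F ` U)" "homeomorphism U (F ` U) F g" using loc by blast
    have im: "(\<lambda>z. cnj \<rho> * F (\<rho> * z)) ` ((*) (cnj \<rho>) ` U) = (*) (cnj \<rho>) ` (F ` U)"
      by (auto simp: image_image r')
    show "\<exists>U g. open U \<and> p \<in> U \<and> open ((\<lambda>z. cnj \<rho> * F (\<rho> * z)) ` U) \<and>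
        homeomorphism U ((\<lambda>z. cnj \<rho> * F (\<rho> * z)) ` U) (\<lambda>z. cnj \<rho> * F (\<rho> * z)) g"
    proof (intro exI conjI)
      show "open ((*) (cnj \<rho>) ` U)" by (rule opn[OF U(1)])
      show "p \<in> (*) (cnj \<rho>) ` U" using U(2) by (intro image_eqI[of _ _ "\<rho> * p"]) (auto simp: r')
      show "open ((\<lambda>z. cnj \<rho> * F (\<rho> * z)) ` (*) (cnj \<rho>) ` U)" unfolding im by (rule opn[OF U(3)])
      show "homeomorphism ((*) (cnj \<rho>) ` U) ((\<lambda>z. cnj \<rho> * F (\<rho> * z)) ` (*) (cnj \<rho>) ` U)
         (\<lambda>z. cnj \<rho> * F (\<rho> * z)) (\<lambda>w. cnj \<rho> * g (\<rho> * w))"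
        by (rule rotation_homeomorphism[OF \<rho> U(4)])
    qed
    have "((\<lambda>z. F (\<rho> * z)) has_derivative (\<lambda>k. F' (\<rho> * p) (\<rho> * k))) (at p)"
      by (rule has_derivative_compose[of "(*) \<rho>" "(*) \<rho>" p UNIV F "F' (\<rho> * p)"])
        (auto intro!: derivative_eq_intros der)
    then show "((\<lambda>z. cnj \<rho> * F (\<rho> * z)) has_derivative (\<lambda>k. cnj \<rho> * F' (\<rho> * p) (\<rho> * k))) (at p)"
      by (rule has_derivative_mult_right)
  next
    show "P \<in> slow_functions" by (rule slow)
    show "complex_W_condition (\<lambda>z. cnj \<rho> * F (\<rho> * z)) (\<lambda>z k. cnj \<rho> * F' (\<rho> * z) (\<rho> * k)) P"
      unfolding complex_W_condition_def
    proof (intro allI impI notI)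
      fix u assume u: "cmod u = 1"
      assume "\<exists>p l T. filterlim (\<lambda>k::nat. Re (cnj u * p k)) at_top sequentially \<and>
         (\<lambda>k. cnj \<rho> * F (\<rho> * p k)) \<longlonglongrightarrow> T \<and>
         (\<forall>k. real_eigenvalue (\<lambda>ka. cnj \<rho> * F' (\<rho> * p k) (\<rho> * ka)) (l k)) \<and>
         (\<lambda>k. l k * P (Re (cnj u * p k))) \<longlonglongrightarrow> 0"
      then obtain p l T where p: "filterlim (\<lambda>k::nat. Re (cnj u * p k)) at_top sequentially"
         "(\<lambda>k. cnj \<rho> * F (\<rho> * p k)) \<longlonglongrightarrow> T"
         "\<And>k. real_eigenvalue (\<lambda>ka. cnj \<rho> * F' (\<rho> * p k) (\<rho> * ka)) (l k)"
         "(\<lambda>k. l k * P (Re (cnj u * p k))) \<longlonglongrightarrow> 0" by blast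
      have e: "cnj (\<rho> * u) * (\<rho> * z) = cnj u * z" for z
      proof -
        have "cnj (\<rho> * u) * (\<rho> * z) = (cnj \<rho> * \<rho>) * (cnj u * z)" by (simp add: algebra_simps)
        then show ?thesis unfolding r by simp
      qed
      have "(\<lambda>k. \<rho> * (cnj \<rho> * F (\<rho> * p k))) \<longlonglongrightarrow> \<rho> * T" by (intro tendsto_intros p(2))
      then have l2: "(\<lambda>k. F (\<rho> * p k)) \<longlonglongrightarrow> \<rho> * T" unfolding r' .
      have l3: "real_eigenvalue (F' (\<rho> * p k)) (l k)" for k
      proof -
        obtain v where v: "v \<noteq> 0" "cnj \<rho> * F' (\<rho> * p k) (\<rho> * v) = l k *\<^sub>R v" using p(3)[of k] unfolding real_eigenvalue_def by blast
        have "F' (\<rho> * p k) (\<rho> * v) = \<rho> * (cnj \<rho> * F' (\<rho> * p k) (\<rho> * v))" by (simp only: r')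
        also have "\<dots> = l k *\<^sub>R (\<rho> * v)" unfolding v(2) by simp
        finally show ?thesis unfolding real_eigenvalue_def using v(1) r0 by (intro exI[of _ "\<rho> * v"]) auto
      qed
      have "\<exists>p l T. filterlim (\<lambda>k::nat. Re (cnj (\<rho> * u) * p k)) at_top sequentially \<and>
         (\<lambda>k. F (p k)) \<longlonglongrightarrow> T \<and> (\<forall>k. real_eigenvalue (F' (p k)) (l k)) \<and>
         (\<lambda>k. l k * P (Re (cnj (\<rho> * u) * p k))) \<longlonglongrightarrow> 0"
        by (rule exI[of _ "\<lambda>k. \<rho> * p k"], rule exI[of _ l], rule exI[of _ "\<rho> * T"], unfold e)
          (intro conjI allI p(1) p(4) l2 l3)
      moreover have "cmod (\<rho> * u) = 1" using \<rho> u by (simp add: norm_mult)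
      ultimately show False using wc unfolding complex_W_condition_def by blast
    qed
  qed
qed

context loc_homeo
begin

text \<open>The rotated map \<open>cnj \<rho> * F (\<rho> * z)\<close> has the rotated branches.\<close>

lemma lift_dom_rotate:
  assumes \<rho>: "cmod \<rho> = 1" and F1: "loc_homeo (\<lambda>z. cnj \<rho> * F (\<rho> * z))" and w: "w \<in> lift_dom p"
  shows "cnj \<rho> * w \<in> loc_homeo.lift_dom (\<lambda>z. cnj \<rho> * F (\<rho> * z)) (cnj \<rho> * p)"
    "loc_homeo.branch (\<lambda>z. cnj \<rho> * F (\<rho> * z)) (cnj \<rho> * p) (cnj \<rho> * w) = cnj \<rho> * branch p w"
proof -
  interpret R: loc_homeo "\<lambda>z. cnj \<rho> * F (\<rho> * z)" by (rule F1)
  have r: "\<rho> * cnj \<rho> = 1" "cnj \<rho> * \<rho> = 1" using \<rho> complex_norm_square[of \<rho>] by (auto simp: mult.commute)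
  have r': "\<rho> * (cnj \<rho> * z) = z" "cnj \<rho> * (\<rho> * z) = z" for z using r by (auto simp flip: mult.assoc)
  define S where "S = (*) (cnj \<rho>) ` closed_segment (F p) w"
  have Seq: "closed_segment (cnj \<rho> * F p) (cnj \<rho> * w) = S"
    unfolding S_def using closed_segment_linear_image[of "(*) (cnj \<rho>)" "F p" w]
    by (simp add: linear_times)
  define \<tau> where "\<tau> z = cnj \<rho> * branch p (\<rho> * z)" for z
  have "section_on (\<lambda>z. cnj \<rho> * F (\<rho> * z)) S \<tau>"
    unfolding section_on_def
  proof
    show "continuous_on S \<tau>" unfolding \<tau>_def S_def
      by (intro continuous_intros continuous_on_compose2[OF continuous_on_branch[OF lift_dom_starlike[OF w]]]) (auto simp: r')
    show "\<forall>x\<in>S. cnj \<rho> * F (\<rho> * \<tau> x) = x" unfolding \<tau>_def S_def using lift_dom_starlike[OF w] by (auto simp: r')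
  qed
  moreover have "closed_segment (cnj \<rho> * F (\<rho> * (cnj \<rho> * p))) (cnj \<rho> * w) \<subseteq> S" unfolding r' Seq ..
  moreover have "\<tau> (cnj \<rho> * F (\<rho> * (cnj \<rho> * p))) = cnj \<rho> * p" unfolding \<tau>_def r' by (simp add: lift_dom_base)
  ultimately show "cnj \<rho> * w \<in> R.lift_dom (cnj \<rho> * p)" "R.branch (cnj \<rho> * p) (cnj \<rho> * w) = cnj \<rho> * branch p w"
    using R.star_section_imp_lift_dom[of S \<tau> "cnj \<rho> * p" "cnj \<rho> * w"] unfolding \<tau>_def r' by auto
qed

lemma lift_dom_rotate_iff:
  assumes \<rho>: "cmod \<rho> = 1" and F1: "loc_homeo (\<lambda>z. cnj \<rho> * F (\<rho> * z))"
    and w: "cnj \<rho> * w \<in> loc_homeo.lift_dom (\<lambda>z. cnj \<rho> * F (\<rho> * z)) (cnj \<rho> * p)"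
  shows "w \<in> lift_dom p"
proof -
  have r: "\<rho> * cnj \<rho> = 1" "cnj \<rho> * \<rho> = 1" using \<rho> complex_norm_square[of \<rho>] by (auto simp: mult.commute)
  have r': "\<rho> * (cnj \<rho> * z) = z" "cnj \<rho> * (\<rho> * z) = z" for z using r by (auto simp flip: mult.assoc)
  interpret R: loc_homeo "\<lambda>z. cnj \<rho> * F (\<rho> * z)" by (rule F1)
  have eq: "(\<lambda>z. cnj (cnj \<rho>) * (cnj \<rho> * F (\<rho> * (cnj \<rho> * z)))) = F" by (rule ext) (simp add: r')
  have "cnj (cnj \<rho>) * (cnj \<rho> * w) \<in> loc_homeo.lift_dom (\<lambda>z. cnj (cnj \<rho>) * (cnj \<rho> * F (\<rho> * (cnj \<rho> * z)))) (cnj (cnj \<rho>) * (cnj \<rho> * p))"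
    by (rule R.lift_dom_rotate(1)[of "cnj \<rho>"]) (use \<rho> w loc_homeo_axioms eq in auto)
  then show ?thesis unfolding eq by (simp add: r')
qed

lemma surjective_branches:
  assumes "\<And>p. branch p ` lift_dom p = UNIV"
  shows "inj F" "convex (range F)"
proof -
  have r: "range F = lift_dom p" for p
  proof
    show "range F \<subseteq> lift_dom p"
    proof
      fix y assume "y \<in> range F"
      then obtain x where x: "y = F x" by auto
      have "x \<in> branch p ` lift_dom p" using assms[of p] by simp
      then obtain v where "v \<in> lift_dom p" "x = branch p v" by auto
      then show "y \<in> lift_dom p" using x by simp
    qed
    show "lift_dom p \<subseteq> range F"
    proof
      fix v assume "v \<in> lift_dom p"
      then show "v \<in> range F" by (intro image_eqI[of _ _ "branch p v"]) simp_all
    qed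
  qed
  show "inj F"
  proof (rule injI)
    fix x y assume "F x = F y"
    moreover have "x \<in> branch p ` lift_dom p" "y \<in> branch p ` lift_dom p" for p using assms[of p] by simp_all
    then obtain v w where "v \<in> lift_dom x" "x = branch x v" "w \<in> lift_dom x" "y = branch x w" by blast
    ultimately show "x = y" by (metis F_branch)
  qed
  show "convex (range F)"
    unfolding convex_contains_segment
  proof (intro ballI)
    fix a b assume a: "a \<in> range F" and b: "b \<in> range F"
    obtain p where "a = F p" using a by auto
    then show "closed_segment a b \<subseteq> range F" using lift_dom_starlike[of b p] b r[of p] by auto
  qed
qed

text \<open>Let \<open>q\<close> be a boundary point of the image of the branch. The local inverse \<open>g\<close> at \<open>q\<close> agrees with
  the branch near some point \<open>w'\<close> close to \<open>F q\<close>. On the way from a point \<open>V\<close> near \<open>w'\<close> to \<open>F q\<close> the lift domain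
  must be left, for otherwise \<open>q\<close> would be in the image; \<open>W\<close> is the first point outside. Up to \<open>W\<close> the
  branch agrees with \<open>g\<close>, which extends beyond. As \<open>V\<close> varies in an open set, it can be taken off the
  line through \<open>F p\<close> and \<open>F q\<close>.\<close>

lemma exit_triangle:
  assumes n: "branch p ` lift_dom p \<noteq> UNIV"
  obtains V W g r v where "r > 0" "section_on F (ball W r) g" "W \<notin> lift_dom p" "closed_segment V W - {W} \<subseteq> lift_dom p"
    "v \<in> closed_segment V W - {W}" "v \<in> ball W r" "branch p v = g v" "Im ((V - F p) * cnj (W - F p)) \<noteq> 0"
proof -
  define S where "S = branch p ` lift_dom p"
  have oS: "open S" unfolding S_def by (rule open_branch_image[OF open_lift_dom order_refl])
  have pS: "p \<in> S" unfolding S_def by (rule image_eqI[of _ _ "F p"]) (simp_all add: lift_dom_base)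
  have "\<not> closed S" using clopen[of S] oS pS n unfolding S_def by blast
  then obtain q where q: "q \<in> closure S" "q \<notin> S" by (metis closure_subset_eq subsetI)
  define wq where "wq = F q"
  obtain r g U where g: "r > 0" "section_on F (ball wq r) g" "g wq = q" "open U" "q \<in> U"
    "\<And>q. q \<in> U \<Longrightarrow> F q \<in> ball wq r \<and> g (F q) = q"
    using local_section[of q] unfolding wq_def by metis
  obtain q1 where q1: "q1 \<in> S" "q1 \<in> U" using q(1) g(4,5) by (meson closure_iff_nhds_not_empty disjoint_iff order_refl)
  define w' where "w' = F q1"
  have w': "w' \<in> lift_dom p" "branch p w' = q1" "w' \<in> ball wq r" "g w' = q1" using q1 g(6)[OF q1(2)] unfolding S_def w'_def by auto
  have agree: "branch p x = g x" if "connected E" "E \<subseteq> lift_dom p \<inter> ball wq r" "w' \<in> E" "x \<in> E" for E x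
    by (rule section_unique[where S=E and \<sigma>="branch p" and \<tau>=g and ?w0.0=w'])
      (use that w' section_on_subset[OF section_lift_dom, of E] section_on_subset[OF g(2), of E] in auto)
  have notall: False if "connected E" "E \<subseteq> lift_dom p \<inter> ball wq r" "w' \<in> E" "wq \<in> E" for E
  proof -
    have "branch p wq = q" using agree[OF that] g(3) by simp
    then show False using q(2) that(2,4) unfolding S_def by auto
  qed
  define A where "A = F p"
  have Aq: "wq \<noteq> A"
  proof
    assume "wq = A"
    moreover have "closed_segment (F p) w' \<subseteq> ball wq r" if "wq = F p"
      using closed_segment_subset[of "F p" "ball wq r" w'] w'(3) g(1) that by auto
    ultimately show False using notall[of "closed_segment (F p) w'"] lift_dom_starlike[OF w'(1)] unfolding A_def by auto
  qed
  define D where "D = wq - A"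
  have D: "D \<noteq> 0" using Aq unfolding D_def by simp
  have "open (lift_dom p \<inter> ball wq r)" using open_lift_dom by auto
  then obtain \<delta> where d: "\<delta> > 0" "ball w' \<delta> \<subseteq> lift_dom p \<inter> ball wq r" using w' open_contains_ball by blast
  obtain V where V: "V \<in> ball w' \<delta>" "Im ((V - A) * cnj D) \<noteq> 0"
  proof (cases "Im ((w' - A) * cnj D) = 0")
    case False then show ?thesis using that[of w'] d(1) by auto
  next
    case True
    define t where "t = \<delta> / (2 * cmod D)"
    have t: "t > 0" "t * cmod D = \<delta> / 2" unfolding t_def using d(1) D by auto
    have "(w' + of_real t * \<i> * D - A) * cnj D = (w' - A) * cnj D + of_real t * \<i> * (D * cnj D)"
      by (simp add: algebra_simps)
    also have "D * cnj D = of_real ((cmod D)\<^sup>2)" by (rule complex_norm_square[symmetric])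
    finally have "Im ((w' + of_real t * \<i> * D - A) * cnj D) = t * (cmod D)\<^sup>2" using True by simp
    moreover have "t * (cmod D)\<^sup>2 \<noteq> 0" using t(1) D by simp
    moreover have "w' + of_real t * \<i> * D \<in> ball w' \<delta>" using t d(1) by (simp add: dist_norm norm_mult)
    ultimately show ?thesis using that[of "w' + of_real t * \<i> * D"] by simp
  qed
  have VOm: "V \<in> lift_dom p" "V \<in> ball wq r" using V(1) d(2) by auto
  have sV: "branch p V = g V" by (rule agree[of "ball w' \<delta>"]) (use d V in auto)
  define x where "x t = (1 - t) *\<^sub>R V + t *\<^sub>R wq" for t :: real
  have xc: "continuous_on UNIV x" unfolding x_def by (intro continuous_intros)
  have xball: "x t \<in> ball wq r" if "t \<in> {0..1}" for t
  proof -
    have "x t \<in> closed_segment V wq" unfolding x_def in_segment using that by auto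
    then show ?thesis using closed_segment_subset[of V "ball wq r" wq] VOm g(1) by auto
  qed
  define T where "T = {0..1} \<inter> x -` (- lift_dom p)"
  have "closed T" unfolding T_def
    using xc open_lift_dom by (intro closed_Int) (auto simp: continuous_on_closed_vimage closed_Compl)
  have "T \<noteq> {}"
  proof
    assume "T = {}"
    then have sub: "x ` {0..1} \<subseteq> lift_dom p" unfolding T_def by auto
    have con: "connected (x ` {0..1} \<union> ball w' \<delta>)"
    proof (rule connected_Un)
      show "connected (x ` {0..1})" by (intro connected_continuous_image continuous_on_subset[OF xc]) auto
      have "V \<in> x ` {0..1}" by (rule image_eqI[of _ _ 0]) (auto simp: x_def)
      then show "x ` {0..1} \<inter> ball w' \<delta> \<noteq> {}" using V(1) by auto
    qed auto
    have "wq \<in> x ` {0..1}" by (rule image_eqI[of _ _ 1]) (auto simp: x_def)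
    have "x ` {0..1} \<subseteq> ball wq r" by (intro image_subsetI xball)
    then have all: "x ` {0..1} \<union> ball w' \<delta> \<subseteq> lift_dom p \<inter> ball wq r"
      by (intro Un_least Int_greatest sub d(2)) 
    show False
      by (rule notall[OF con all]) (use d(1) \<open>wq \<in> x ` {0..1}\<close> in simp_all)
  qed
  define t0 where "t0 = Inf T"
  have bT: "bdd_below T" unfolding T_def by auto
  have t0: "t0 \<in> T" unfolding t0_def by (rule closed_contains_Inf[OF \<open>T \<noteq> {}\<close> bT \<open>closed T\<close>])
  have before: "x t \<in> lift_dom p" if "0 \<le> t" "t < t0" for t
  proof (rule ccontr)
    assume "x t \<notin> lift_dom p"
    then have "t \<in> T" using that t0 unfolding T_def by auto
    then have "t0 \<le> t" unfolding t0_def using bT by (rule cInf_lower)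
    then show False using that by simp
  qed
  have x0: "x 0 = V" unfolding x_def by simp
  have t0p: "t0 > 0" "t0 \<le> 1" using t0 x0 VOm(1) unfolding T_def by (auto simp: less_le)
  define W where "W = x t0"
  have WOm: "W \<notin> lift_dom p" using t0 unfolding W_def T_def by auto
  have Wb: "W \<in> ball wq r" unfolding W_def by (rule xball) (use t0p in auto)
  obtain r' where r': "r' > 0" "ball W r' \<subseteq> ball wq r" using Wb open_ball open_contains_ball by metis
  have seg: "\<exists>s. 0 \<le> s \<and> s < t0 \<and> y = x s" if y: "y \<in> closed_segment V W - {W}" for y
  proof -
    obtain u where u: "0 \<le> u" "u \<le> 1" "y = (1 - u) *\<^sub>R V + u *\<^sub>R W" using y by (auto simp: in_segment)
    have "u \<noteq> 1" using y u(3) by auto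
    then have "u * t0 < t0" using u t0p by simp
    moreover have "y = x (u * t0)" unfolding u(3) W_def x_def by (simp add: algebra_simps)
    moreover have "0 \<le> u * t0" using u t0p by simp
    ultimately show ?thesis by blast
  qed
  have sub: "closed_segment V W - {W} \<subseteq> lift_dom p" using seg before by blast
  have xs: "x s \<in> closed_segment V W - {W}" "branch p (x s) = g (x s)" if s: "0 \<le> s" "s < t0" for s
  proof -
    have e: "x s = (1 - s / t0) *\<^sub>R V + (s / t0) *\<^sub>R W" unfolding W_def x_def using t0p
      by (simp add: algebra_simps)
    then have "x s \<in> closed_segment V W" unfolding in_segment using s t0p by (intro exI[of _ "s / t0"]) auto
    moreover have "x s \<noteq> W" using before[OF s] WOm by auto
    ultimately show "x s \<in> closed_segment V W - {W}" by simp
    have con: "connected (x ` {0..s} \<union> ball w' \<delta>)"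
    proof (rule connected_Un)
      show "connected (x ` {0..s})" by (intro connected_continuous_image continuous_on_subset[OF xc]) auto
      have "V \<in> x ` {0..s}" by (rule image_eqI[of _ _ 0]) (use s x0 in auto)
      then show "x ` {0..s} \<inter> ball w' \<delta> \<noteq> {}" using V(1) by auto
    qed auto
    have "x ` {0..s} \<subseteq> lift_dom p" by (intro image_subsetI before) (use s in auto)
    moreover have "x ` {0..s} \<subseteq> ball wq r" by (intro image_subsetI xball) (use s t0p in auto)
    ultimately have all: "x ` {0..s} \<union> ball w' \<delta> \<subseteq> lift_dom p \<inter> ball wq r"
      by (intro Un_least Int_greatest d(2))
    show "branch p (x s) = g (x s)" by (rule agree[OF con all]) (use d(1) s in simp_all)
  qed
  obtain s where s: "0 \<le> s" "s < t0" "x s \<in> ball W r'"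
  proof -
    have "(x \<longlongrightarrow> x t0) (at_left t0)"
      using xc by (metis UNIV_I at_within_open continuous_on_eq_continuous_at continuous_within filterlim_at_split isCont_def open_UNIV)
    then have "eventually (\<lambda>s. x s \<in> ball W r') (at_left t0)"
      using topological_tendstoD[of x "x t0" _ "ball W r'"] r'(1) unfolding W_def by auto
    moreover have "eventually (\<lambda>s. s \<in> {0<..<t0}) (at_left t0)" by (rule eventually_at_leftI[of 0]) (use t0p in auto)
    ultimately have "eventually (\<lambda>s. x s \<in> ball W r' \<and> s \<in> {0<..<t0}) (at_left t0)" by eventually_elim auto
    then obtain s where "x s \<in> ball W r' \<and> s \<in> {0<..<t0}" using eventually_happens'[of "at_left t0"] trivial_limit_at_left_real by blast
    then show ?thesis using that[of s] by auto
  qed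
  have "(V - A) * cnj (W - A) = of_real (1 - t0) * ((V - A) * cnj (V - A)) + of_real t0 * ((V - A) * cnj D)"
    unfolding W_def x_def D_def by (simp add: scaleR_conv_of_real algebra_simps)
  also have "(V - A) * cnj (V - A) = of_real ((cmod (V - A))\<^sup>2)" by (rule complex_norm_square[symmetric])
  finally have "Im ((V - A) * cnj (W - A)) = t0 * Im ((V - A) * cnj D)" by simp
  then have im: "Im ((V - F p) * cnj (W - F p)) \<noteq> 0" using V(2) t0p unfolding A_def by simp
  show ?thesis
    by (rule that[OF r'(1) section_on_subset[OF g(2) r'(2)] WOm sub xs(1)[OF s(1,2)] s(3) xs(2)[OF s(1,2)] im])
qed

end

context loc_homeo
begin

text \<open>The branch is defined on the triangle with vertices \<open>F p\<close>, \<open>V\<close>, \<open>W\<close> without the side from \<open>F p\<close> to \<open>W\<close>, by the star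
  shape of its domain. Change the base point to a point \<open>v0\<close> off that side. Then the branch extends over the
  side near \<open>F p\<close>, where the original branch is defined, and near \<open>W\<close>, where \<open>g\<close> is. If it
  extended over the whole side, it would lift the segment from \<open>F p\<close> to \<open>W\<close>. So there is an obstacle
  between, and a thin rectangle along the middle part of the side is an escape box.\<close>

lemma triangle_escape_box:
  assumes A: "Re (F p) = c" and W: "Re W = c" and V: "Re V > c" and ne: "Im (F p) \<noteq> Im W"
    and WOm: "W \<notin> lift_dom p" and VW: "closed_segment V W - {W} \<subseteq> lift_dom p"
    and g: "r > 0" "section_on F (ball W r) g"
    and v: "v \<in> closed_segment V W - {W}" "v \<in> ball W r" "branch p v = g v"
  obtains p' b0 b1 d where "escape_box p' b0 b1 d 0 c" "Im (F p') = b1"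
proof -
  define A where "A = F p"
  have rA: "Re A = c" using A A_def by simp
  define T where "T = convex hull {A, V, W}"
  define \<Delta> where "\<Delta> = T \<inter> {z. c < slant 0 z}"
  have cT: "convex T" unfolding T_def by simp
  have c\<Delta>: "convex \<Delta>" unfolding \<Delta>_def by (intro convex_Int cT convex_slant_gt)
  have om0: "slant 0 z = Re z" for z by (simp add: slant_def)
  have Tbar: "\<exists>a b s. 0 \<le> a \<and> 0 \<le> b \<and> 0 \<le> s \<and> a + b + s = 1 \<and> x = a *\<^sub>R A + b *\<^sub>R V + s *\<^sub>R W" if "x \<in> T" for x
    using that unfolding T_def convex_hull_3 by blast
  have Tmem: "a *\<^sub>R A + b *\<^sub>R V + s *\<^sub>R W \<in> T" if "0 \<le> a" "0 \<le> b" "0 \<le> s" "a + b + s = 1" for a b s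
    using that unfolding T_def convex_hull_3 by blast
  have \<Delta>lift_dom: "\<Delta> \<subseteq> lift_dom p"
  proof
    fix x assume x: "x \<in> \<Delta>"
    obtain a b s where abs: "0 \<le> a" "0 \<le> b" "0 \<le> s" "a + b + s = 1" "x = a *\<^sub>R A + b *\<^sub>R V + s *\<^sub>R W"
      using Tbar x unfolding \<Delta>_def by blast
    have "Re x > c" using x by (simp add: \<Delta>_def om0)
    moreover have "Re x = (a + b + s) * c + b * (Re V - c)" unfolding abs(5) using rA W by (simp add: algebra_simps)
    ultimately have "b \<noteq> 0" using abs(4) by auto
    then have b: "b > 0" using abs(2) by simp
    define m where "m = b + s"
    have m: "m > 0" "m \<le> 1" "a = 1 - m" unfolding m_def using b abs by auto
    define y where "y = (b / m) *\<^sub>R V + (s / m) *\<^sub>R W"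
    have "b / m + s / m = 1" using m(1) unfolding m_def by (simp add: add_divide_distrib[symmetric])
    then have bm: "b / m = 1 - s / m" by simp
    have "0 \<le> s / m" "s / m \<le> 1" using abs m unfolding m_def by auto
    then have "y \<in> closed_segment V W" unfolding y_def bm in_segment by blast
    moreover have "y \<noteq> W"
    proof
      assume "y = W"
      then have "Re y = c" using W by simp
      then have "(b / m) * Re V + (s / m) * c = c" unfolding y_def using W by simp
      then have "(b / m) * (Re V - c) = 0" unfolding bm by (simp add: algebra_simps)
      then show False using b m V by simp
    qed
    ultimately have "y \<in> lift_dom p" using VW by auto
    moreover have "x = (1 - m) *\<^sub>R F p + m *\<^sub>R y" unfolding abs(5) y_def m(3) A_def using m(1) by (simp add: scaleR_right_distrib)
    then have "x \<in> closed_segment (F p) y" unfolding in_segment using m by (intro exI[of _ m]) auto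
    ultimately show "x \<in> lift_dom p" using lift_dom_starlike by blast
  qed
  have AT: "A \<in> T" "W \<in> T" unfolding T_def by (auto intro: hull_inc)
  have seg\<Delta>: "open_segment u x \<subseteq> \<Delta>" if ux: "u \<in> \<Delta>" "x \<in> T" for u x
  proof
    fix z assume z: "z \<in> open_segment u x"
    obtain a b s where abs: "0 \<le> a" "0 \<le> b" "0 \<le> s" "a + b + s = 1" "x = a *\<^sub>R A + b *\<^sub>R V + s *\<^sub>R W" using Tbar[OF ux(2)] by blast
    have "Re x = (a + b + s) * c + b * (Re V - c)" unfolding abs(5) using rA W by (simp add: algebra_simps)
    moreover have "b * (Re V - c) \<ge> 0" using abs V by simp
    ultimately have rx: "Re x \<ge> c" unfolding abs(4) by linarith
    obtain t where t: "0 < t" "t < 1" "z = (1 - t) *\<^sub>R u + t *\<^sub>R x" using z by (auto simp: in_segment)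
    have "z \<in> T" using z cT that unfolding \<Delta>_def by (metis IntD1 closed_segment_subset open_closed_segment subsetD)
    moreover have "(1 - t) * (Re u - c) > 0" "t * (Re x - c) \<ge> 0" using t rx that(1) by (auto simp: \<Delta>_def om0)
    then have "Re z > c" unfolding t(3) by (simp add: algebra_simps)
    ultimately show "z \<in> \<Delta>" by (simp add: \<Delta>_def om0)
  qed
  have "((\<lambda>t. A + t *\<^sub>R (W - A)) \<longlongrightarrow> A + 0 *\<^sub>R (W - A)) (at_right 0)" by (intro tendsto_intros)
  then have ev1: "eventually (\<lambda>t. A + t *\<^sub>R (W - A) \<in> lift_dom p) (at_right (0::real))"
    by (rule topological_tendstoD[OF _ open_lift_dom]) (simp add: A_def lift_dom_base)
  have "((\<lambda>t. W + t *\<^sub>R (A - W)) \<longlongrightarrow> W + 0 *\<^sub>R (A - W)) (at_right 0)" by (intro tendsto_intros)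
  then have ev2: "eventually (\<lambda>t. W + t *\<^sub>R (A - W) \<in> ball W r) (at_right (0::real))"
    by (rule topological_tendstoD[OF _ open_ball]) (use g(1) in simp)
  have ev3: "eventually (\<lambda>t. t \<in> {0<..<1/2}) (at_right (0::real))" by (rule eventually_at_rightI[of 0 "1/2"]) auto
  have "eventually (\<lambda>t. A + t *\<^sub>R (W - A) \<in> lift_dom p \<and> W + t *\<^sub>R (A - W) \<in> ball W r \<and> t \<in> {0<..<1/2}) (at_right (0::real))"
    using ev1 ev2 ev3 by eventually_elim auto
  then obtain \<theta> where \<theta>: "A + \<theta> *\<^sub>R (W - A) \<in> lift_dom p" "W + \<theta> *\<^sub>R (A - W) \<in> ball W r" "0 < \<theta>" "\<theta> < 1/2"
    using eventually_happens'[OF trivial_limit_at_right_real] by fastforce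
  define S where "S t = A + t *\<^sub>R (W - A)" for t :: real
  have SRe: "Re (S t) = c" for t unfolding S_def using rA W by simp
  have ST: "S t \<in> T" if "0 \<le> t" "t \<le> 1" for t
    using Tmem[of "1 - t" 0 t] that unfolding S_def by (simp add: algebra_simps)
  define h where "h = Im W - Im A"
  have h0: "h \<noteq> 0" using ne unfolding h_def A_def by simp
  have SIm: "Im (S t) = Im A + t * h" for t unfolding S_def h_def by simp
  define b0 where "b0 = min (Im (S \<theta>)) (Im (S (1 - \<theta>)))"
  define b1 where "b1 = max (Im (S \<theta>)) (Im (S (1 - \<theta>)))"
  have par: "\<exists>t. \<theta> \<le> t \<and> t \<le> 1 - \<theta> \<and> y = Im A + t * h" if "b0 \<le> y" "y \<le> b1" for y
  proof (intro exI[of _ "(y - Im A) / h"] conjI)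
    show "y = Im A + (y - Im A) / h * h" using h0 by simp
    show "\<theta> \<le> (y - Im A) / h" "(y - Im A) / h \<le> 1 - \<theta>"
    proof -
      consider "h > 0" | "h < 0" using h0 by linarith
      then have "\<theta> \<le> (y - Im A) / h \<and> (y - Im A) / h \<le> 1 - \<theta>"
      proof cases
        case 1
        then have "\<theta> * h \<le> (1 - \<theta>) * h" using \<theta> by (intro mult_right_mono) auto
        then have "Im A + \<theta> * h \<le> y" "y \<le> Im A + (1 - \<theta>) * h" using that unfolding b0_def b1_def SIm by auto
        then show ?thesis using 1 by (simp add: field_simps)
      next
        case 2
        then have "(1 - \<theta>) * h \<le> \<theta> * h" using \<theta> by (intro mult_right_mono_neg) auto
        then have "Im A + (1 - \<theta>) * h \<le> y" "y \<le> Im A + \<theta> * h" using that unfolding b0_def b1_def SIm by auto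
        then show ?thesis using 2 by (simp add: field_simps)
      qed
      then show "\<theta> \<le> (y - Im A) / h" "(y - Im A) / h \<le> 1 - \<theta>" by auto
    qed
  qed
  \<comment> \<open>The point of the side at height \<open>Im A + t * h\<close> can be moved to the right by \<open>b * (Re V - c)\<close>, for \<open>b \<le> t0\<close>, without leaving the triangle.\<close>
  define \<kappa> where "\<kappa> = (Im V - Im A) / h"
  define t0 where "t0 = \<theta> / (\<bar>\<kappa>\<bar> + 1)"
  have t0: "t0 > 0" "t0 * (\<bar>\<kappa>\<bar> + 1) = \<theta>" unfolding t0_def using \<theta>(3) by (auto simp: add_nonneg_pos)
  define d where "d = c + t0 * (Re V - c)"
  have d: "d > c" unfolding d_def using t0 V by simp
  have hb: "slant_box b0 b1 d 0 c \<subseteq> \<Delta>"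
  proof
    fix z assume z: "z \<in> slant_box b0 b1 d 0 c"
    then have zz: "b0 \<le> Im z" "Im z \<le> b1" "c < Re z" "Re z \<le> d" by (auto simp: slant_box_def left_strip_def om0)
    obtain t where t: "\<theta> \<le> t" "t \<le> 1 - \<theta>" "Im z = Im A + t * h" using par[OF zz(1,2)] by auto
    define b where "b = (Re z - c) / (Re V - c)"
    have b: "0 < b" "b \<le> t0" "b * (Re V - c) = Re z - c" unfolding b_def using zz V by (auto simp: d_def field_simps)
    define s where "s = t - b * \<kappa>"
    have "\<bar>b * \<kappa>\<bar> + b \<le> t0 * (\<bar>\<kappa>\<bar> + 1)"
    proof -
      have "\<bar>b * \<kappa>\<bar> + b = b * (\<bar>\<kappa>\<bar> + 1)" using b(1) by (simp add: abs_mult algebra_simps)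
      also have "\<dots> \<le> t0 * (\<bar>\<kappa>\<bar> + 1)" using b by (intro mult_right_mono) auto
      finally show ?thesis .
    qed
    then have bk: "\<bar>b * \<kappa>\<bar> + b \<le> \<theta>" using t0 by simp
    have s: "s \<ge> 0" "1 - b - s \<ge> 0" using bk t b(1) unfolding s_def by linarith+
    have "z = (1 - b - s) *\<^sub>R A + b *\<^sub>R V + s *\<^sub>R W"
    proof (rule complex_eqI)
      show "Re z = Re ((1 - b - s) *\<^sub>R A + b *\<^sub>R V + s *\<^sub>R W)" using b(3) rA W by (simp add: algebra_simps)
      have "\<kappa> * h = Im V - Im A" unfolding \<kappa>_def using h0 by simp
      then have "b * (Im V - Im A) = b * \<kappa> * h" by simp
      moreover have "Im ((1 - b - s) *\<^sub>R A + b *\<^sub>R V + s *\<^sub>R W) = Im A + b * (Im V - Im A) + s * h"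
        by (simp add: h_def algebra_simps)
      ultimately show "Im z = Im ((1 - b - s) *\<^sub>R A + b *\<^sub>R V + s *\<^sub>R W)" unfolding t(3) s_def by (simp add: algebra_simps)
    qed
    then have "z \<in> T" using Tmem[of "1 - b - s" b s] s b by simp
    then show "z \<in> \<Delta>" using zz by (simp add: \<Delta>_def om0)
  qed
  define v0 where "v0 = Complex d b1"
  have v0: "v0 \<in> slant_box b0 b1 d 0 c" unfolding v0_def slant_box_def left_strip_def om0 using d by (auto simp: b0_def b1_def)
  have v0\<Delta>: "v0 \<in> \<Delta>" using hb v0 by auto
  define p' where "p' = branch p v0"
  have Fp': "F p' = v0" unfolding p'_def using \<Delta>lift_dom v0\<Delta> by auto
  have reb: "x \<in> lift_dom p'" "branch p' x = branch p x" if "x \<in> \<Delta>" for x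
    using lift_dom_rebase[OF c\<Delta> \<Delta>lift_dom, of p' x] that v0\<Delta> Fp' p'_def by auto
  have \<Delta>Om': "\<Delta> \<subseteq> lift_dom p'" using reb(1) by auto
  have near: "\<exists>u. u \<in> \<Delta> \<inter> ball x s" if xs: "x \<in> T" "s > 0" for x s
  proof (cases "v0 = x")
    case True then show ?thesis using v0\<Delta> that(2) by (intro exI[of _ v0]) auto
  next
    case False
    then have "x \<in> closure (open_segment v0 x)" by simp
    then obtain u where "u \<in> open_segment v0 x" "dist u x < s" using xs(2) unfolding closure_approachable by blast
    then show ?thesis using seg\<Delta>[OF v0\<Delta> that(1)] by (intro exI[of _ u]) (auto simp: dist_commute)
  qed
  have ext: "x \<in> lift_dom p'" "branch p' x = f x"
    if x: "x \<in> T" and f: "s > 0" "section_on F (ball x s) f" and ag: "\<And>u. u \<in> \<Delta> \<inter> ball x s \<Longrightarrow> branch p u = f u" for x s f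
  proof -
    obtain u where u: "u \<in> \<Delta> \<inter> ball x s" using near[OF x f(1)] by blast
    have "open_segment (F p') x \<subseteq> \<Delta>" unfolding Fp' by (rule seg\<Delta>[OF v0\<Delta> x])
    moreover have "branch p' u = f u" using reb(2) ag u by auto
    ultimately show "x \<in> lift_dom p'" "branch p' x = f x" using lift_dom_extend[OF c\<Delta> \<Delta>Om' _ f u] Fp' v0\<Delta> by auto
  qed
  have ext1: "x \<in> lift_dom p'" "branch p' x = branch p x" if x: "x \<in> T" "x \<in> lift_dom p" for x
  proof -
    obtain s where s: "s > 0" "ball x s \<subseteq> lift_dom p" using x(2) open_lift_dom open_contains_ball by blast
    show "x \<in> lift_dom p'" "branch p' x = branch p x" using ext[OF x(1) s(1) section_on_subset[OF section_lift_dom s(2)]] by auto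
  qed
  have agW: "branch p u = g u" if "u \<in> \<Delta> \<inter> ball W r" for u
  proof (rule section_unique[where S="\<Delta> \<inter> ball W r" and \<sigma>="branch p" and \<tau>=g and ?w0.0=v])
    show "connected (\<Delta> \<inter> ball W r)" by (intro convex_connected convex_Int c\<Delta> convex_ball)
    show "section_on F (\<Delta> \<inter> ball W r) (branch p)" by (rule section_on_subset[OF section_lift_dom]) (use \<Delta>lift_dom in auto)
    show "section_on F (\<Delta> \<inter> ball W r) g" by (rule section_on_subset[OF g(2)]) auto
    have "v \<in> \<Delta>"
    proof -
      obtain t where t: "0 \<le> t" "t \<le> 1" "v = (1 - t) *\<^sub>R V + t *\<^sub>R W" using v(1) by (auto simp: in_segment)
      have "t \<noteq> 1" using t(3) v(1) by auto
      then have "(1 - t) * (Re V - c) > 0" using t V by simp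
      then have "Re v > c" unfolding t(3) using W by (simp add: algebra_simps)
      moreover have "v \<in> T" using Tmem[of 0 "1 - t" t] t by simp
      ultimately show ?thesis by (simp add: \<Delta>_def om0)
    qed
    then show "v \<in> \<Delta> \<inter> ball W r" using v(2) by auto
  qed (use v that in auto)
  have ext2: "x \<in> lift_dom p'" if x: "x \<in> T" "x \<in> ball W r" for x
  proof -
    obtain s where s: "s > 0" "ball x s \<subseteq> ball W r" using x(2) open_ball open_contains_ball by blast
    show ?thesis by (rule ext(1)[OF x(1) s(1) section_on_subset[OF g(2) s(2)]]) (use agW s in auto)
  qed
  have e1: "S \<theta> \<in> lift_dom p'" by (rule ext1(1)) (use ST[of \<theta>] \<theta> in \<open>auto simp: S_def\<close>)
  have Sball: "S t \<in> ball W r" if "1 - \<theta> \<le> t" "t \<le> 1" for t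
  proof -
    have "S t = W + (1 - t) *\<^sub>R (A - W)" unfolding S_def by (simp add: algebra_simps)
    then have "dist W (S t) = (1 - t) * cmod (A - W)" using that by (simp add: dist_norm)
    also have "\<dots> \<le> \<theta> * cmod (A - W)" using that by (intro mult_right_mono) auto
    also have "\<dots> = dist W (W + \<theta> *\<^sub>R (A - W))" using \<theta> by (simp add: dist_norm)
    also have "\<dots> < r" using \<theta>(2) by simp
    finally show ?thesis by simp
  qed
  have e2: "S (1 - \<theta>) \<in> lift_dom p'" by (rule ext2) (use ST[of "1 - \<theta>"] Sball[of "1 - \<theta>"] \<theta> in auto)
  have exe: "\<exists>e. e \<in> left_strip b0 b1 d \<and> slant 0 e = c \<and> e \<notin> lift_dom p'"
  proof (rule ccontr)
    assume neg: "\<not> ?thesis"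
    have SOm: "S t \<in> lift_dom p'" if t: "0 \<le> t" "t \<le> 1" for t
    proof -
      consider "t \<le> \<theta>" | "\<theta> \<le> t" "t \<le> 1 - \<theta>" | "1 - \<theta> \<le> t" by linarith
      then show ?thesis
      proof cases
        case 1
        have "S t \<in> closed_segment (F p) (S \<theta>)"
          unfolding in_segment S_def A_def[symmetric] using 1 t \<theta>(3)
          by (intro exI[of _ "t / \<theta>"]) (auto simp: algebra_simps)
        then have "S t \<in> lift_dom p" using lift_dom_starlike[of "S \<theta>" p] \<theta>(1) unfolding S_def by blast
        then show ?thesis using ext1(1) ST[OF t] by blast
      next
        case 2
        have "b0 \<le> Im (S t) \<and> Im (S t) \<le> b1"
        proof (cases "h \<ge> 0")
          case True
          then have "\<theta> * h \<le> t * h" "t * h \<le> (1 - \<theta>) * h" using 2 by (auto intro: mult_right_mono)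
          then show ?thesis unfolding b0_def b1_def SIm by linarith
        next
          case False
          then have "t * h \<le> \<theta> * h" "(1 - \<theta>) * h \<le> t * h" using 2 by (auto intro: mult_right_mono_neg)
          then show ?thesis unfolding b0_def b1_def SIm by linarith
        qed
        then have "S t \<in> left_strip b0 b1 d" using SRe[of t] d by (simp add: left_strip_def)
        then show ?thesis using neg SRe[of t] om0 by auto
      next
        case 3
        then show ?thesis using ext2[OF ST[OF t]] Sball t by auto
      qed
    qed
    have TOm: "T \<subseteq> lift_dom p'"
    proof
      fix x assume x: "x \<in> T"
      show "x \<in> lift_dom p'"
      proof (cases "Re x > c")
        case True then show ?thesis using reb(1) x by (simp add: \<Delta>_def om0)
      next
        case False
        obtain a b s where abs: "0 \<le> a" "0 \<le> b" "0 \<le> s" "a + b + s = 1" "x = a *\<^sub>R A + b *\<^sub>R V + s *\<^sub>R W" using Tbar[OF x] by blast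
        have "Re x = (a + b + s) * c + b * (Re V - c)" unfolding abs(5) using rA W by (simp add: algebra_simps)
        then have "b * (Re V - c) \<le> 0" using False abs(4) by simp
        then have b: "b = 0" using abs(2) V by (simp add: mult_le_0_iff)
        then have a: "a = 1 - s" using abs(4) by simp
        have "x = S s" unfolding abs(5) S_def b a by (simp add: algebra_simps)
        then show ?thesis using SOm[of s] abs(1,3) a by simp
      qed
    qed
    have "W \<in> lift_dom p"
    proof (rule star_section_imp_lift_dom(1)[OF section_on_subset[OF section_lift_dom TOm]])
      show "closed_segment (F p) W \<subseteq> T" using AT closed_segment_subset[OF _ _ cT] unfolding A_def by blast
      show "branch p' (F p) = p" using ext1(2)[of "F p"] AT lift_dom_base A_def by auto
    qed
    then show False using WOm by simp
  qed
  have "escape_box p' b0 b1 d 0 c"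
    unfolding escape_box_def
  proof (intro conjI ballI exe)
    show "slant_box b0 b1 d 0 c \<subseteq> lift_dom p'" using hb \<Delta>Om' by auto
    show "F p' \<in> slant_box b0 b1 d 0 c" using v0 Fp' by simp
    fix b assume "b \<in> {b0, b1}"
    then have "b = Im (S \<theta>) \<or> b = Im (S (1 - \<theta>))" unfolding b0_def b1_def by (auto simp: min_def max_def split: if_splits)
    then have "Complex c b = S \<theta> \<or> Complex c b = S (1 - \<theta>)" using SRe by (auto simp: complex_eq_iff)
    then show "Complex (c - 0 * b) b \<in> lift_dom p'" using e1 e2 by auto
    show "c - 0 * b < d" using d by simp
  qed
  then show ?thesis by (rule that) (simp add: Fp' v0_def)
qed

end

context wc_map
begin

text \<open>The rotation by \<open>\<rho>\<close> makes the side from \<open>F p\<close> to \<open>W\<close> vertical, with the triangle to its right.\<close>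

theorem inj_and_convex_range: "inj F \<and> convex (range F)"
proof (rule ccontr)
  assume n: "\<not> ?thesis"
  then have "\<exists>p. branch p ` lift_dom p \<noteq> UNIV" using surjective_branches by blast
  then obtain p where p: "branch p ` lift_dom p \<noteq> UNIV" by blast
  obtain V W g r v where T: "r > 0" "section_on F (ball W r) g" "W \<notin> lift_dom p" "closed_segment V W - {W} \<subseteq> lift_dom p"
    "v \<in> closed_segment V W - {W}" "v \<in> ball W r" "branch p v = g v" "Im ((V - F p) * cnj (W - F p)) \<noteq> 0"
    by (rule exit_triangle[OF p])
  define D where "D = W - F p"
  have D0: "D \<noteq> 0" using T(8) unfolding D_def by auto
  define \<epsilon> where "\<epsilon> = sgn (Im ((V - F p) * cnj D))"
  have eps: "\<epsilon> = 1 \<or> \<epsilon> = - 1" "\<epsilon> * Im ((V - F p) * cnj D) > 0" using T(8) unfolding \<epsilon>_def D_def by (auto simp: sgn_if)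
  define \<rho> where "\<rho> = \<i> * of_real (\<epsilon> / cmod D) * D"
  have \<rho>: "cmod \<rho> = 1" unfolding \<rho>_def using D0 eps(1) by (auto simp: norm_mult norm_divide)
  have r: "\<rho> * cnj \<rho> = 1" "cnj \<rho> * \<rho> = 1" using \<rho> complex_norm_square[of \<rho>] by (auto simp: mult.commute)
  have r': "\<rho> * (cnj \<rho> * z) = z" "cnj \<rho> * (\<rho> * z) = z" for z using r by (auto simp flip: mult.assoc)
  have cr: "cnj \<rho> * z = of_real (\<epsilon> / cmod D) * (- \<i> * (z * cnj D))" for z unfolding \<rho>_def by simp
  have crD: "cnj \<rho> * D = of_real (- \<epsilon> * cmod D) * \<i>"
  proof -
    have "D * cnj D = of_real ((cmod D)\<^sup>2)" by (rule complex_norm_square[symmetric])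
    then show ?thesis unfolding cr using D0 by (simp add: power2_eq_square field_simps)
  qed
  have crV: "Re (cnj \<rho> * (V - F p)) > 0"
  proof -
    have Ri: "Re (of_real k * (- \<i> * w)) = k * Im w" for k w by simp
    have "Re (cnj \<rho> * (V - F p)) = \<epsilon> / cmod D * Im ((V - F p) * cnj D)" unfolding cr by (rule Ri)
    also have "\<dots> = (\<epsilon> * Im ((V - F p) * cnj D)) / cmod D" by (rule times_divide_eq_left)
    also have "\<dots> > 0" using eps(2) D0 by (intro divide_pos_pos) simp_all
    finally show ?thesis .
  qed
  define F1 where "F1 = (\<lambda>z. cnj \<rho> * F (\<rho> * z))"
  interpret R: wc_map F1 "\<lambda>z k. cnj \<rho> * F' (\<rho> * z) (\<rho> * k)" P
    unfolding F1_def by (rule wc_map_rotate[OF \<rho>])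
  have lh: "loc_homeo (\<lambda>z. cnj \<rho> * F (\<rho> * z))" using R.loc_homeo_axioms F1_def by simp
  define m where "m z = cnj \<rho> * z" for z
  have Omi: "m w \<in> R.lift_dom (m p) \<longleftrightarrow> w \<in> lift_dom p" for w
    using lift_dom_rotate(1)[OF \<rho> lh] lift_dom_rotate_iff[OF \<rho> lh] unfolding m_def F1_def by blast
  have sgi: "R.branch (m p) (m w) = m (branch p w)" if "w \<in> lift_dom p" for w
    using lift_dom_rotate(2)[OF \<rho> lh that] unfolding m_def F1_def .
  have F1p: "F1 (m p) = m (F p)" unfolding F1_def m_def r' ..
  have mdist: "dist (m x) (m y) = dist x y" for x y
    unfolding m_def dist_norm by (simp add: norm_mult \<rho> flip: right_diff_distrib)
  have minj: "m x = m y \<longleftrightarrow> x = y" for x y unfolding m_def using r' by metis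
  have lm: "linear m" unfolding m_def by (rule linear_times)
  have mseg: "closed_segment (m x) (m y) = m ` closed_segment x y" for x y
    by (rule closed_segment_linear_image[OF lm])
  have mdiff: "m x - m y = m (x - y)" for x y using linear_diff[OF lm] by simp
  have mWA: "m W - m (F p) = of_real (- \<epsilon> * cmod D) * \<i>" unfolding mdiff D_def[symmetric] using crD m_def by simp
  have "\<exists>p' b0 b1 d. R.escape_box p' b0 b1 d 0 (Re (m W)) \<and> Im (F1 p') = b1"
  proof (rule R.triangle_escape_box[of "m p" "Re (m W)" "m W" "m V" r "\<lambda>w. m (g (\<rho> * w))" "m v"])
    show "Re (m W) = Re (m W)" ..
    show "\<exists>p' b0 b1 d. R.escape_box p' b0 b1 d 0 (Re (m W)) \<and> Im (F1 p') = b1"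
      if "R.escape_box p' b0 b1 d 0 (Re (m W))" "Im (F1 p') = b1" for p' b0 b1 d using that by blast
    have "Re (m W - m (F p)) = 0" unfolding mWA by simp
    then show re: "Re (F1 (m p)) = Re (m W)" unfolding F1p by simp
    have "Re (m V - m (F p)) > 0" unfolding mdiff using crV m_def by simp
    then show "Re (m W) < Re (m V)" using re F1p by simp
    have "Im (m W - m (F p)) = - \<epsilon> * cmod D" unfolding mWA by simp
    then show "Im (F1 (m p)) \<noteq> Im (m W)" unfolding F1p using eps(1) D0 by auto
    show "m W \<notin> R.lift_dom (m p)" using Omi T(3) by simp
    show "closed_segment (m V) (m W) - {m W} \<subseteq> R.lift_dom (m p)" unfolding mseg using T(4) Omi by auto
    show "r > 0" by (rule T(1))
    have mb: "\<rho> * w \<in> ball W r" if "w \<in> ball (m W) r" for w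
      using that mdist[of W "\<rho> * w"] unfolding m_def r' by simp
    show "section_on F1 (ball (m W) r) (\<lambda>w. m (g (\<rho> * w)))"
      unfolding section_on_def
    proof
      have cg: "continuous_on (ball W r) g" "\<And>w. w \<in> ball W r \<Longrightarrow> F (g w) = w" using T(2) unfolding section_on_def by auto
      show "continuous_on (ball (m W) r) (\<lambda>w. m (g (\<rho> * w)))" unfolding m_def[of "g _"]
        by (intro continuous_intros continuous_on_compose2[OF cg(1)]) (use mb in auto)
      show "\<forall>w\<in>ball (m W) r. F1 (m (g (\<rho> * w))) = w"
      proof
        fix w assume "w \<in> ball (m W) r"
        then have "F (g (\<rho> * w)) = \<rho> * w" using cg(2) mb by blast
        then show "F1 (m (g (\<rho> * w))) = w" unfolding F1_def m_def r' by (simp add: r')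
      qed
    qed
    show "m v \<in> closed_segment (m V) (m W) - {m W}" unfolding mseg using T(5) minj by auto
    show "m v \<in> ball (m W) r" using T(6) mdist by simp
    have "v \<in> lift_dom p" using T(4,5) by auto
    then show "R.branch (m p) (m v) = m (g (\<rho> * m v))" using sgi T(7) unfolding m_def r' by simp
  qed
  then show False using R.no_escape_box by blast
qed

end

section \<open>The real plane\<close>

lemma continuous_on_c2v [continuous_intros]: "continuous_on S f \<Longrightarrow> continuous_on S (\<lambda>x. c2v (f x))"
  using bounded_linear.continuous_on[OF bounded_linear_c2v] by blast

lemma continuous_on_v2c [continuous_intros]: "continuous_on S f \<Longrightarrow> continuous_on S (\<lambda>x. v2c (f x))"
  using bounded_linear.continuous_on[OF bounded_linear_v2c] by blast

lemma rot_mult: "rot \<theta> *v c2v z = c2v (cis \<theta> * z)"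
  by (simp add: rot_def c2v_def vec_eq_iff forall_2 matrix_vector_mult_def sum_2)

lemma W_condition_imp_complex_W_condition:
  assumes diff: "\<And>p. F differentiable (at p)" and P: "P \<in> slow_functions"
    and W: "\<And>\<theta>. \<not> (\<exists>(x :: nat \<Rightarrow> real) (y :: nat \<Rightarrow> real) (l :: nat \<Rightarrow> real) T.
        filterlim x at_top sequentially \<and>
        (\<lambda>k. conj_rot \<theta> F (vector [x k, y k])) \<longlonglongrightarrow> T \<and>
        (\<forall>k. real_eigenvalue (frechet_derivative (conj_rot \<theta> F) (at (vector [x k, y k]))) (l k)) \<and>
        (\<lambda>k. l k * P (x k)) \<longlonglongrightarrow> 0)"
  shows "complex_W_condition (\<lambda>z. v2c (F (c2v z))) (\<lambda>z k. v2c (frechet_derivative F (at (c2v z)) (c2v k))) P"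
  unfolding complex_W_condition_def
proof (intro allI impI notI)
  fix u assume u: "cmod u = 1"
  assume "\<exists>p l T. filterlim (\<lambda>k::nat. Re (cnj u * p k)) at_top sequentially \<and>
     (\<lambda>k. v2c (F (c2v (p k)))) \<longlonglongrightarrow> T \<and>
     (\<forall>k. real_eigenvalue (\<lambda>ka. v2c (frechet_derivative F (at (c2v (p k))) (c2v ka))) (l k)) \<and>
     (\<lambda>k. l k * P (Re (cnj u * p k))) \<longlonglongrightarrow> 0"
  then obtain p l T where p: "filterlim (\<lambda>k::nat. Re (cnj u * p k)) at_top sequentially"
     "(\<lambda>k. v2c (F (c2v (p k)))) \<longlonglongrightarrow> T"
     "\<And>k. real_eigenvalue (\<lambda>ka. v2c (frechet_derivative F (at (c2v (p k))) (c2v ka))) (l k)"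
     "(\<lambda>k. l k * P (Re (cnj u * p k))) \<longlonglongrightarrow> 0" by blast
  define \<theta> where "\<theta> = - Arg u"
  have "u \<noteq> 0" using u by auto
  then have cA: "cis (Arg u) = u" using u by (simp add: cis_Arg sgn_eq)
  have cu: "cnj u = cis \<theta>" "u = cis (- \<theta>)" using cA cis_cnj[of "Arg u"] unfolding \<theta>_def by auto
  have uu: "u * (cnj u * z) = z" "cnj u * (u * z) = z" for z
    using u complex_norm_square[of u] by (auto simp: mult.commute simp flip: mult.assoc)
  define x where "x k = Re (cnj u * p k)" for k
  define y where "y k = Im (cnj u * p k)" for k
  have v: "vector [x k, y k] = c2v (cnj u * p k)" for k unfolding c2v_def x_def y_def ..
  have cr: "conj_rot \<theta> F (c2v z) = c2v (cnj u * v2c (F (c2v (u * z))))" for z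
    unfolding conj_rot_def rot_mult cu(2)[symmetric] by (metis c2v_v2c cu(1) rot_mult)
  have l1: "(\<lambda>k. conj_rot \<theta> F (vector [x k, y k])) \<longlonglongrightarrow> c2v (cnj u * T)"
    unfolding v cr uu by (intro bounded_linear.tendsto[OF bounded_linear_c2v] tendsto_intros p(2))
  have l2: "real_eigenvalue (frechet_derivative (conj_rot \<theta> F) (at (vector [x k, y k]))) (l k)" for k
  proof -
    define L where "L = frechet_derivative F (at (c2v (p k)))"
    have dL: "(F has_derivative L) (at (c2v (p k)))" unfolding L_def using diff frechet_derivative_works by blast
    have lm: "bounded_linear (\<lambda>x. rot a *v x)" for a using matrix_vector_mul_bounded_linear .
    have "((\<lambda>x. rot (- \<theta>) *v x) has_derivative (\<lambda>x. rot (- \<theta>) *v x)) (at (c2v (cnj u * p k)))"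
      by (rule bounded_linear_imp_has_derivative[OF lm])
    moreover have e: "rot (- \<theta>) *v c2v (cnj u * p k) = c2v (p k)" unfolding rot_mult cu(2)[symmetric] uu ..
    have "(F has_derivative L) (at (rot (- \<theta>) *v c2v (cnj u * p k)))" unfolding e by (rule dL)
    ultimately have "((\<lambda>x. F (rot (- \<theta>) *v x)) has_derivative (\<lambda>x. L (rot (- \<theta>) *v x))) (at (c2v (cnj u * p k)))"
      by (rule has_derivative_compose)
    then have "(conj_rot \<theta> F has_derivative (\<lambda>x. rot \<theta> *v L (rot (- \<theta>) *v x))) (at (c2v (cnj u * p k)))"
      unfolding conj_rot_def by (rule bounded_linear.has_derivative[OF lm])
    then have fd: "frechet_derivative (conj_rot \<theta> F) (at (vector [x k, y k])) = (\<lambda>x. rot \<theta> *v L (rot (- \<theta>) *v x))"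
      unfolding v by (rule frechet_derivative_at[symmetric])
    obtain w where w: "w \<noteq> 0" "v2c (L (c2v w)) = l k *\<^sub>R w" using p(3)[of k] unfolding real_eigenvalue_def L_def by blast
    have "L (c2v w) = c2v (l k *\<^sub>R w)" using w(2) by (metis c2v_v2c)
    then have "rot \<theta> *v L (rot (- \<theta>) *v c2v (cnj u * w)) = c2v (cnj u * (l k *\<^sub>R w))"
      unfolding rot_mult cu(2)[symmetric] uu by (simp add: rot_mult cu(1))
    also have "\<dots> = l k *\<^sub>R c2v (cnj u * w)" using linear_scale[OF linear_c2v, of "l k" "cnj u * w"] by simp
    finally have "rot \<theta> *v L (rot (- \<theta>) *v c2v (cnj u * w)) = l k *\<^sub>R c2v (cnj u * w)" .
    moreover have "c2v (cnj u * w) \<noteq> 0"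
    proof
      assume "c2v (cnj u * w) = 0"
      then have "cmod (cnj u * w) = 0" using norm_c2v[of "cnj u * w"] by simp
      then show False using w(1) u by (simp add: norm_mult)
    qed
    ultimately show ?thesis unfolding fd real_eigenvalue_def by blast
  qed
  show False using W[of \<theta>] p(1,4) l1 l2 unfolding x_def[symmetric] by blast
qed

lemma homeomorphism_c2v:
  assumes h: "homeomorphism U (F ` U) F g"
  shows "homeomorphism (v2c ` U) ((\<lambda>z. v2c (F (c2v z))) ` (v2c ` U)) (\<lambda>z. v2c (F (c2v z))) (\<lambda>w. v2c (g (c2v w)))"
proof -
  have im: "(\<lambda>z. v2c (F (c2v z))) ` (v2c ` U) = v2c ` (F ` U)" by (auto simp: image_image)
  have cF: "continuous_on U F" "continuous_on (F ` U) g" "\<And>x. x \<in> U \<Longrightarrow> g (F x) = x"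
    using h unfolding homeomorphism_def by auto
  show ?thesis unfolding im
  proof (rule homeomorphismI)
    show "continuous_on (v2c ` U) (\<lambda>z. v2c (F (c2v z)))"
      by (intro continuous_intros continuous_on_compose2[OF cF(1)]) auto
    show "continuous_on (v2c ` F ` U) (\<lambda>w. v2c (g (c2v w)))"
      by (intro continuous_intros continuous_on_compose2[OF cF(2)]) auto
  qed (use cF(3) in auto)
qed

theorem theorem1p6:
  fixes F :: "real^2 \<Rightarrow> real^2"
  assumes "\<And>p. F differentiable (at p)"
    and "local_homeomorphism F"
    and "W_condition F"
  shows "inj F \<and> convex (range F)"
proof -
  define G where "G z = v2c (F (c2v z))" for z
  obtain P where P: "P \<in> slow_functions" "complex_W_condition G (\<lambda>z k. v2c (frechet_derivative F (at (c2v z)) (c2v k))) P"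
    using assms(3) W_condition_imp_complex_W_condition[OF assms(1)] unfolding W_condition_def G_def by blast
  have opn: "open (v2c ` U)" if "open U" for U
  proof -
    have "v2c ` U = c2v -` U"
    proof (intro set_eqI iffI)
      fix z assume "z \<in> c2v -` U"
      then show "z \<in> v2c ` U" by (intro image_eqI[of _ _ "c2v z"]) auto
    qed auto
    moreover have "continuous_on UNIV c2v" using continuous_on_c2v[OF continuous_on_id] by simp
    ultimately show ?thesis using that by (simp add: open_vimage)
  qed
  have dF: "(F has_derivative frechet_derivative F (at x)) (at x)" for x
    using assms(1) frechet_derivative_works by blast
  interpret wc_map G "\<lambda>z k. v2c (frechet_derivative F (at (c2v z)) (c2v k))" P
  proof (unfold_locales)
    have "continuous_on UNIV F"
      by (rule continuous_at_imp_continuous_on, rule ballI, rule has_derivative_continuous, rule dF)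
    from continuous_on_compose2[OF this continuous_on_c2v[OF continuous_on_id] subset_UNIV]
    show "continuous_on UNIV G" unfolding G_def[abs_def] by (rule continuous_on_v2c)
    fix p
    obtain U g where U: "open U" "c2v p \<in> U" "open (F ` U)" "homeomorphism U (F ` U) F g"
      using assms(2) unfolding local_homeomorphism_def by blast
    have im: "G ` (v2c ` U) = v2c ` (F ` U)" by (auto simp: image_image G_def)
    show "\<exists>U g. open U \<and> p \<in> U \<and> open (G ` U) \<and> homeomorphism U (G ` U) G g"
    proof (intro exI conjI)
      show "open (v2c ` U)" by (rule opn[OF U(1)])
      show "p \<in> v2c ` U" using U(2) by (intro image_eqI[of _ _ "c2v p"]) auto
      show "open (G ` (v2c ` U))" unfolding im by (rule opn[OF U(3)])
      show "homeomorphism (v2c ` U) (G ` v2c ` U) G (\<lambda>w. v2c (g (c2v w)))"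
        using homeomorphism_c2v[OF U(4)] unfolding G_def[abs_def] .
    qed
    have "((\<lambda>z. F (c2v z)) has_derivative (\<lambda>k. frechet_derivative F (at (c2v p)) (c2v k))) (at p)"
      by (rule has_derivative_compose[OF bounded_linear_imp_has_derivative[OF bounded_linear_c2v] dF])
    then show "(G has_derivative (\<lambda>k. v2c (frechet_derivative F (at (c2v p)) (c2v k)))) (at p)"
      unfolding G_def[abs_def] by (rule bounded_linear.has_derivative[OF bounded_linear_v2c])
  qed (rule P)+
  have F: "F = (\<lambda>x. c2v (G (v2c x)))" unfolding G_def by simp
  have "inj F"
  proof (rule injI)
    fix x y assume "F x = F y"
    then have "G (v2c x) = G (v2c y)" unfolding G_def by simp
    then have "v2c x = v2c y" using inj_and_convex_range by (auto dest: injD)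
    then show "x = y" by (metis c2v_v2c)
  qed
  moreover have "range F = c2v ` range G"
  proof -
    have "range v2c = UNIV" by (metis UNIV_I surj_def v2c_c2v)
    then show ?thesis by (subst F) (metis image_image)
  qed
  ultimately show ?thesis using inj_and_convex_range convex_linear_image[OF linear_c2v] by simp
qed


end
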